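(* Let $\mathcal I$ be a weakly quasihomogeneous (w.q.h.) ideal in $C_n=\mathcal O_n$ or $C_n=\mathcal E_n$, where for $C_n=\mathcal E_n$ the ideal $\mathcal I$ is assumed to be finitely generated. Then: (i) Any two volume forms on $(\mathbb K^n,0)$ (which, in the case $\mathbb K=\mathbb R$, define the same orientation in $T_0\mathbb R^n$) can be joined (via pullback) by a $1$-parameter family of diffeomorphisms $\phi_t$ such that $\phi_t^*\mathcal I=\mathcal I$, i.e. by a $(\mathcal D_n)_{\mathcal I}$-isotopy. (ii) For a given volume form $\Omega_n$ on $(\mathbb K^n,0)$, let $\mathcal D_{\Omega_n}$ be the subgroup of $\mathcal D_n$ whose elements preserve $\Omega_n$. Then for any ideal $\mathcal J\subset C_n$, $\phi^*\mathcal I=\mathcal J$ for some $\phi\in\mathcal D_n$ (for $\mathbb K=\mathbb C$), respectively some $\phi\in\mathcal D_n^+$ (for $\mathbb K=\mathbb R$), implies $h^*\mathcal I=\mathcal J$ for some $h\in\mathcal D_{\Omega_n}$.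
   Context: $\mathbb K=\mathbb C$ or $\mathbb R$. $\mathcal O_n$ is the ring of $\mathbb K$-analytic function germs on $(\mathbb K^n,0)$ and $\mathcal E_n$ the ring of $C^\infty$ function germs on $(\mathbb R^n,0)$. $\mathcal D_n=\mathrm{Diff}(\mathbb K^n,0)$ is the group of (correspondingly smooth) origin-preserving diffeomorphism germs and, over $\mathbb R$, $\mathcal D_n^+$ is the subgroup of orientation-preserving ones. For $\phi\in\mathcal D_n$ and $\mathcal I=\langle g_1,\dots,g_p\rangle$, $\phi^*\mathcal I=\langle g_1\circ\phi,\dots,g_p\circ\phi\rangle$, and $(\mathcal D_n)_{\mathcal I}=\{\phi\in\mathcal D_n:\phi^*\mathcal I=\mathcal I\}$. Two volume forms $\Omega_0,\Omega_1$ are joined by a $(\mathcal D_n)_{\mathcal I}$-isotopy if there is a smooth family $\phi_t\in(\mathcal D_n)_{\mathcal I}$, $t\in[0,1]$, with $\phi_0=\mathrm{Id}$ and $\phi_1^*\Omega_1=\Omega_0$. An ideal $\mathcal I$ in $C_n$ is w.q.h. if it has a set of generators $g_1,\dots,g_p$ for which there exist integer weights $w_i\ge0$ ($1\le i\le n$) with $\sum_iw_i>0$ and weighted degrees $\delta_j$ ($1\le j\le p$) such that each $g_j$ is quasihomogeneous of degree $\delta_j$, i.e. $\sum_iw_ix_i\,\partial g_j/\partial x_i=\delta_jg_j$. *)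

theory Defs
  imports "HOL-Analysis.Analysis" "HOL-Algebra.Ideal"
begin

text \<open>
  The ground field is a type \<open>'k\<close> (instantiated to \<^typ>\<open>real\<close> or \<^typ>\<open>complex\<close>) and the
  ambient space is \<open>'k ^ 'n\<close>. Function germs at the origin form a quotient type. Map germs and
  germs of differential forms are given by representatives that are total functions, constrained
  and compared only near the origin.
\<close>

quotient_type (overloaded) ('a, 'b) germ = "'a::{topological_space, zero} \<Rightarrow> 'b" /
  "\<lambda>f g. eventually (\<lambda>x. f x = g x) (nhds 0)"
  morphisms rep_germ germ
  by (rule equivpI) (auto intro!: reflpI sympI transpI elim: eventually_mono eventually_elim2)

instantiation germ :: ("{topological_space, zero}", comm_ring_1) comm_ring_1
begin

lift_definition zero_germ :: "('a, 'b) germ" is "\<lambda>_. 0" .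
lift_definition one_germ :: "('a, 'b) germ" is "\<lambda>_. 1" .
lift_definition plus_germ :: "('a, 'b) germ \<Rightarrow> ('a, 'b) germ \<Rightarrow> ('a, 'b) germ"
  is "\<lambda>f g x. f x + g x" by (auto elim: eventually_elim2)
lift_definition times_germ :: "('a, 'b) germ \<Rightarrow> ('a, 'b) germ \<Rightarrow> ('a, 'b) germ"
  is "\<lambda>f g x. f x * g x" by (auto elim: eventually_elim2)
lift_definition minus_germ :: "('a, 'b) germ \<Rightarrow> ('a, 'b) germ \<Rightarrow> ('a, 'b) germ"
  is "\<lambda>f g x. f x - g x" by (auto elim: eventually_elim2)
lift_definition uminus_germ :: "('a, 'b) germ \<Rightarrow> ('a, 'b) germ"
  is "\<lambda>f x. - f x" by (auto elim: eventually_mono)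

instance
  by standard (transfer; simp add: algebra_simps)+

end

section \<open>Regularity classes\<close>

fun Ck_on :: "nat \<Rightarrow> 'a::real_normed_vector set \<Rightarrow> ('a \<Rightarrow> 'b::real_normed_vector) \<Rightarrow> bool" where
  "Ck_on 0 S f \<longleftrightarrow> continuous_on S f"
| "Ck_on (Suc k) S f \<longleftrightarrow>
     (\<forall>x\<in>S. f differentiable (at x)) \<and> (\<forall>v. Ck_on k S (\<lambda>x. frechet_derivative f (at x) v))"

text \<open>Meant for open sets \<open>S\<close> in finite-dimensional spaces.\<close>

definition Cinf_on :: "'a::real_normed_vector set \<Rightarrow> ('a \<Rightarrow> 'b::real_normed_vector) \<Rightarrow> bool" where
  "Cinf_on S f \<longleftrightarrow> (\<forall>k. Ck_on k S f)"

definition analytic_at_0 :: "('k::real_normed_field ^ 'n \<Rightarrow> 'k) \<Rightarrow> bool" where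
  "analytic_at_0 f \<longleftrightarrow> (\<exists>(c :: ('n \<Rightarrow> nat) \<Rightarrow> 'k) r. r > 0 \<and>
     (\<forall>x\<in>ball 0 r. ((\<lambda>\<alpha>. c \<alpha> * (\<Prod>i\<in>UNIV. (x $ i) ^ \<alpha> i)) has_sum f x) UNIV))"

definition smooth_at_0 :: "('k::real_normed_field ^ 'n \<Rightarrow> 'k) \<Rightarrow> bool" where
  "smooth_at_0 f \<longleftrightarrow> (\<exists>U. open U \<and> 0 \<in> U \<and> Cinf_on U f)"

text \<open>\<open>Analytic\<close> stands for the ring \<open>\<O>\<^sub>n\<close>, \<open>Smooth\<close> for \<open>\<E>\<^sub>n\<close>; the latter is only meant
  for the field \<^typ>\<open>real\<close>.\<close>

datatype regularity = Analytic | Smooth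

fun regular :: "regularity \<Rightarrow> ('k::real_normed_field ^ 'n \<Rightarrow> 'k) \<Rightarrow> bool" where
  "regular Analytic f \<longleftrightarrow> analytic_at_0 f"
| "regular Smooth f \<longleftrightarrow> smooth_at_0 f"

definition regular_map :: "regularity \<Rightarrow> ('k::real_normed_field ^ 'n \<Rightarrow> 'k ^ 'n) \<Rightarrow> bool" where
  "regular_map C \<phi> \<longleftrightarrow> (\<forall>i. regular C (\<lambda>x. \<phi> x $ i))"

definition germ_ring :: "regularity \<Rightarrow> ('k::real_normed_field ^ 'n, 'k) germ ring" where
  "germ_ring C = \<lparr>carrier = {germ f | f. regular C f},
     monoid.mult = (*), one = 1, ring.zero = 0, add = (+)\<rparr>"

section \<open>Diffeomorphism germs and their action on ideals\<close>

definition diffeos :: "regularity \<Rightarrow> ('k::real_normed_field ^ 'n \<Rightarrow> 'k ^ 'n) set" where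
  "diffeos C = {\<phi>. regular_map C \<phi> \<and> \<phi> 0 = 0 \<and>
     (\<exists>\<psi>. regular_map C \<psi> \<and> \<psi> 0 = 0 \<and>
        (\<forall>\<^sub>F x in nhds 0. \<psi> (\<phi> x) = x) \<and> (\<forall>\<^sub>F x in nhds 0. \<phi> (\<psi> x) = x))}"

definition oriented_diffeos :: "regularity \<Rightarrow> (real ^ 'n \<Rightarrow> real ^ 'n) set" where
  "oriented_diffeos C = {\<phi> \<in> diffeos C. det (matrix (frechet_derivative \<phi> (at 0))) > 0}"

text \<open>The pullback is generated by the compositions of all elements of the ideal; any generating
  family of the ideal gives the same result, since composition with a diffeomorphism germ is a
  ring homomorphism.\<close>

definition pullback_ideal ::
  "regularity \<Rightarrow> ('k::real_normed_field ^ 'n \<Rightarrow> 'k ^ 'n) \<Rightarrow>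
   ('k ^ 'n, 'k) germ set \<Rightarrow> ('k ^ 'n, 'k) germ set" where
  "pullback_ideal C \<phi> I = genideal (germ_ring C) {germ (f \<circ> \<phi>) | f. germ f \<in> I}"

definition ideal_stabilizer ::
  "regularity \<Rightarrow> ('k::real_normed_field ^ 'n, 'k) germ set \<Rightarrow> ('k ^ 'n \<Rightarrow> 'k ^ 'n) set" where
  "ideal_stabilizer C I = {\<phi> \<in> diffeos C. pullback_ideal C \<phi> I = I}"

section \<open>Weakly quasihomogeneous ideals\<close>

definition partial_deriv ::
  "'n \<Rightarrow> ('k::real_normed_field ^ 'n \<Rightarrow> 'k) \<Rightarrow> 'k ^ 'n \<Rightarrow> 'k" where
  "partial_deriv i f x = deriv (\<lambda>z. f (\<chi> j. if j = i then z else x $ j)) (x $ i)"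

lemma partial_deriv_cong_germ:
  fixes f g :: "'k::real_normed_field ^ 'n \<Rightarrow> 'k"
  assumes "\<forall>\<^sub>F x in nhds 0. f x = g x"
  shows "\<forall>\<^sub>F x in nhds 0. \<forall>i. partial_deriv i f x = partial_deriv i g x"
proof -
  obtain U where U: "open U" "0 \<in> U" "\<And>x. x \<in> U \<Longrightarrow> f x = g x"
    using assms by (auto simp: eventually_nhds)
  have "partial_deriv i f x = partial_deriv i g x" if x: "x \<in> U" for i x
  proof -
    let ?p = "\<lambda>z. \<chi> j. if j = i then z else x $ j"
    have px: "?p (x $ i) = x"
      by (auto simp: vec_eq_iff)
    have "continuous_on UNIV ?p"
    proof (rule continuous_on_vec_lambda)
      fix j
      show "continuous_on UNIV (\<lambda>z. if j = i then z else x $ j)"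
        by (cases "j = i") auto
    qed
    then have "open (?p -` U)"
      by (rule open_vimage[OF U(1)])
    moreover have "x $ i \<in> ?p -` U"
      unfolding vimage_eq px by (rule x)
    ultimately have "\<forall>\<^sub>F z in nhds (x $ i). f (?p z) = g (?p z)"
      unfolding eventually_nhds using U(3) by (intro exI[of _ "?p -` U"]) auto
    then show ?thesis
      unfolding partial_deriv_def by (rule deriv_cong_ev) (rule refl)
  qed
  with U(1,2) show ?thesis
    by (auto simp: eventually_nhds)
qed

lift_definition quasihomogeneous ::
  "('n \<Rightarrow> nat) \<Rightarrow> int \<Rightarrow> ('k::real_normed_field ^ 'n, 'k) germ \<Rightarrow> bool" is
  "\<lambda>w \<delta> f. \<forall>\<^sub>F x in nhds 0.
     (\<Sum>i\<in>UNIV. of_nat (w i) * x $ i * partial_deriv i f x) = of_int \<delta> * f x"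
proof -
  fix w \<delta> and f g :: "'k ^ 'n \<Rightarrow> 'k"
  assume fg: "\<forall>\<^sub>F x in nhds 0. f x = g x"
  have "\<forall>\<^sub>F x in nhds 0.
     ((\<Sum>i\<in>UNIV. of_nat (w i) * x $ i * partial_deriv i f x) = of_int \<delta> * f x) =
     ((\<Sum>i\<in>UNIV. of_nat (w i) * x $ i * partial_deriv i g x) = of_int \<delta> * g x)"
    using fg partial_deriv_cong_germ[OF fg] by eventually_elim (simp only:)
  then show "(\<forall>\<^sub>F x in nhds 0.
     (\<Sum>i\<in>UNIV. of_nat (w i) * x $ i * partial_deriv i f x) = of_int \<delta> * f x) =
     (\<forall>\<^sub>F x in nhds 0.
     (\<Sum>i\<in>UNIV. of_nat (w i) * x $ i * partial_deriv i g x) = of_int \<delta> * g x)"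
    by (rule eventually_subst)
qed

definition finitely_generated ::
  "regularity \<Rightarrow> ('k::real_normed_field ^ 'n, 'k) germ set \<Rightarrow> bool" where
  "finitely_generated C I \<longleftrightarrow>
     (\<exists>G. finite G \<and> G \<subseteq> carrier (germ_ring C) \<and> I = genideal (germ_ring C) G)"

definition wqh :: "regularity \<Rightarrow> ('k::real_normed_field ^ 'n, 'k) germ set \<Rightarrow> bool" where
  "wqh C I \<longleftrightarrow>
     (\<exists>G w. finite G \<and> G \<subseteq> carrier (germ_ring C) \<and> I = genideal (germ_ring C) G \<and>
        (\<Sum>i\<in>UNIV. w i) > 0 \<and> (\<forall>g\<in>G. \<exists>\<delta>. quasihomogeneous w \<delta> g))"

section \<open>Volume forms and isotopies\<close>

text \<open>The arguments of a form of top degree are indexed by \<open>'n\<close> itself, so that no ordering of the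
  coordinates has to be chosen.\<close>

type_synonym ('k, 'n) top_form = "'k ^ 'n \<Rightarrow> ('n \<Rightarrow> 'k ^ 'n) \<Rightarrow> 'k"

definition alternating_form :: "(('n \<Rightarrow> 'k::field ^ 'n) \<Rightarrow> 'k) \<Rightarrow> bool" where
  "alternating_form \<eta> \<longleftrightarrow>
     (\<forall>v i. Vector_Spaces.linear (*s) (*) (\<lambda>y. \<eta> (v(i := y)))) \<and>
     (\<forall>v i j. i \<noteq> j \<and> v i = v j \<longrightarrow> \<eta> v = 0)"

definition volume_form :: "regularity \<Rightarrow> ('k::real_normed_field, 'n::finite) top_form \<Rightarrow> bool" where
  "volume_form C \<Omega> \<longleftrightarrow>
     (\<forall>\<^sub>F x in nhds 0. alternating_form (\<Omega> x)) \<and>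
     (\<forall>v. regular C (\<lambda>x. \<Omega> x v)) \<and> (\<exists>v. \<Omega> 0 v \<noteq> 0)"

definition same_orientation :: "(real, 'n::finite) top_form \<Rightarrow> (real, 'n) top_form \<Rightarrow> bool" where
  "same_orientation \<Omega>0 \<Omega>1 \<longleftrightarrow> (\<forall>v. \<Omega>0 0 v > 0 \<longleftrightarrow> \<Omega>1 0 v > 0)"

definition pullback_form ::
  "('k::real_normed_field ^ 'n \<Rightarrow> 'k ^ 'n) \<Rightarrow> ('k, 'n::finite) top_form \<Rightarrow> ('k, 'n) top_form" where
  "pullback_form \<phi> \<Omega> x v = \<Omega> (\<phi> x) (\<lambda>i. frechet_derivative \<phi> (at x) (v i))"

definition volume_preserving ::
  "regularity \<Rightarrow> ('k::real_normed_field, 'n::finite) top_form \<Rightarrow> ('k ^ 'n \<Rightarrow> 'k ^ 'n) set" where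
  "volume_preserving C \<Omega> =
     {\<phi> \<in> diffeos C. \<forall>\<^sub>F x in nhds 0. pullback_form \<phi> \<Omega> x = \<Omega> x}"

text \<open>A smooth family is jointly infinitely differentiable in \<open>(t, x)\<close>, in the real sense, near
  \<open>[0,1] \<times> {0}\<close>; each of its members is of the given regularity class.\<close>

definition joined_by_isotopy ::
  "regularity \<Rightarrow> ('k::real_normed_field ^ 'n, 'k) germ set \<Rightarrow>
   ('k, 'n::finite) top_form \<Rightarrow> ('k, 'n) top_form \<Rightarrow> bool" where
  "joined_by_isotopy C I \<Omega>0 \<Omega>1 \<longleftrightarrow>
     (\<exists>\<phi> :: real \<Rightarrow> 'k ^ 'n \<Rightarrow> 'k ^ 'n.
        (\<exists>U. open U \<and> {0..1} \<times> {0} \<subseteq> U \<and> Cinf_on U (\<lambda>(t, x). \<phi> t x)) \<and>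
        (\<forall>t\<in>{0..1}. \<phi> t \<in> ideal_stabilizer C I) \<and>
        (\<forall>\<^sub>F x in nhds 0. \<phi> 0 x = x) \<and>
        (\<forall>\<^sub>F x in nhds 0. pullback_form (\<phi> 1) \<Omega>1 x = \<Omega>0 x))"

end

theory Submission
  imports Defs "HOL-Algebra.QuotRing"
begin

text \<open>The Euler field \<open>E = \<Sum>\<^sub>i w\<^sub>i x\<^sub>i \<partial>/\<partial>x\<^sub>i\<close> multiplies each quasihomogeneous generator by
  its degree, so for every function germ \<open>s\<close> the substitution
  \<open>\<Phi>\<^sub>s(x) = (exp (w\<^sub>i s(x)) x\<^sub>i)\<^sub>i\<close>, which moves each point along its own orbit of \<open>E\<close>,
  multiplies a generator of degree \<open>\<delta>\<close> by the unit \<open>exp (\<delta> s)\<close>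
  (\<open>quasihomogeneous_scaling_map\<close>). Such a map is a diffeomorphism germ whose inverse has the same
  shape (\<open>scaling_map_inverse\<close>), hence it preserves the ideal
  (\<open>scaling_map_stabilizes_ideal\<close>). The proof moves volume forms with these maps only, so no
  flow of a time-dependent vector field is needed: everything is reduced to equations for the
  single function \<open>s\<close>.

  Let \<open>W = \<Sum>\<^sub>i w\<^sub>i > 0\<close>. The Jacobian determinant of \<open>\<Phi>\<^sub>s\<close> is \<open>exp (W s) (1 + E s)\<close>
  (\<open>det_jacobian_scaling_map\<close>). A density \<open>\<rho>\<close> can be written as \<open>\<rho> = E F + W F\<close>: divide the
  coefficient of a monomial of weighted degree \<open>m\<close> by \<open>W + m\<close>, or integrate
  \<open>t\<^sup>W\<^sup>-\<^sup>1 \<rho>(t\<^sup>w x)\<close> over \<open>0 \<le> t \<le> 1\<close>. If \<open>F(0) \<noteq> 0\<close>, put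
  \<open>F = c exp (W s)\<close>; then \<open>\<rho> = c W exp (W s) (1 + E s)\<close>, so \<open>\<rho>\<close> is the pullback of the constant
  density \<open>c W\<close> under \<open>\<Phi>\<^sub>s\<close> (\<open>density_normal_form\<close>). Bringing two densities to the same constant
  and composing one such map with the inverse of the other gives a function \<open>S\<close> for which
  \<open>\<Phi>\<^sub>S\<close> carries one volume form to the other (\<open>scaling_map_equalizes_volume_forms\<close>). The logarithm
  needed to define \<open>S\<close> exists because the two forms induce the same orientation, or because the
  field is complex. The family \<open>\<Phi>\<^sub>t\<^sub>S\<close> with \<open>0 \<le> t \<le> 1\<close> is the isotopy of part (i). For part (ii),
  the first part applied to \<open>\<Omega>\<close> and to its pullback under \<open>\<phi>\<inverse>\<close> gives a map \<open>k\<close> that preserves the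
  ideal, and \<open>h = k \<circ> \<phi>\<close>.

  The argument is carried out once, in the locale \<open>regular_calculus\<close>, which lists what it needs to
  know about a class of function germs. The rest of the work is to show that real and complex
  analytic germs and real smooth germs form such classes. On the analytic side this
  rests on estimates of the weighted sum of absolute values of power series coefficients.\<close>

section \<open>Weighted scalings and coordinates\<close>

abbreviation total_weight :: "('n::finite \<Rightarrow> nat) \<Rightarrow> nat" where
  "total_weight w \<equiv> \<Sum>i\<in>UNIV. w i"

text \<open>The time \<open>z\<close> flow of the Euler field. Additive (logarithmic) time makes sense over both fields
  and turns composition of flows into addition.\<close>

definition weighted_scaling :: "('n::finite \<Rightarrow> nat) \<Rightarrow> 'k::{real_normed_field, banach} \<Rightarrow> 'k ^ 'n \<Rightarrow> 'k ^ 'n" where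
  "weighted_scaling w z x = (\<chi> i. exp (of_nat (w i) * z) * x $ i)"

lemma weighted_scaling_nth [simp]: "weighted_scaling w z x $ i = exp (of_nat (w i) * z) * x $ i"
  by (simp add: weighted_scaling_def)

lemma weighted_scaling_add: "weighted_scaling w (a + b) x = weighted_scaling w a (weighted_scaling w b x)"
  by (simp add: vec_eq_iff distrib_left exp_add)

lemma weighted_scaling_0 [simp]: "weighted_scaling w 0 x = x"
  by (simp add: vec_eq_iff)

lemma weighted_scaling_minus:
  "weighted_scaling w (- z) (weighted_scaling w z x) = x" "weighted_scaling w z (weighted_scaling w (- z) x) = x"
  using weighted_scaling_add[of w "- z" z x] weighted_scaling_add[of w z "- z" x] by simp_all

lemma weighted_scaling_zero [simp]: "weighted_scaling w z 0 = 0"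
  by (simp add: vec_eq_iff)

lemma norm_weighted_scaling_nth_le:
  "norm (weighted_scaling w z x $ i) \<le> exp (real (total_weight w) * norm z) * norm (x $ i)"
proof -
  have "norm (exp (of_nat (w i) * z)) \<le> exp (norm (of_nat (w i) * z))" by (rule norm_exp)
  also have "\<dots> = exp (real (w i) * norm z)" by (simp add: norm_mult)
  also have "\<dots> \<le> exp (real (total_weight w) * norm z)"
    unfolding exp_le_cancel_iff by (intro mult_right_mono of_nat_mono member_le_sum) auto
  finally show ?thesis unfolding weighted_scaling_nth norm_mult by (rule mult_right_mono) simp
qed

lemma norm_axis_eq: "norm (axis i x :: 'k::real_normed_vector ^ 'n::finite) = norm x"
proof (rule antisym)
  have "norm (axis i x :: 'k ^ 'n) \<le> (\<Sum>j\<in>UNIV. norm ((axis i x :: 'k ^ 'n) $ j))"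
    unfolding norm_vec_def by (rule L2_set_le_sum) simp
  also have "\<dots> = norm x" by (simp add: axis_def if_distrib[of norm] cong: if_cong)
  finally show "norm (axis i x :: 'k ^ 'n) \<le> norm x" .
  show "norm x \<le> norm (axis i x :: 'k ^ 'n)"
    using Finite_Cartesian_Product.norm_nth_le[of "axis i x :: 'k ^ 'n" i] by (simp add: axis_def)
qed

lemma bounded_linear_axis: "bounded_linear (axis i :: 'k::real_normed_vector \<Rightarrow> 'k ^ 'n::finite)"
  by (rule bounded_linear_intro[of _ 1]) (auto simp: vec_eq_iff axis_def norm_axis_eq[unfolded axis_def])

lemma vec_eq_sum_axis: "(x :: 'k::real_normed_field ^ 'n::finite) = (\<Sum>i\<in>UNIV. axis i (x $ i))"
  by (simp add: vec_eq_iff axis_def if_distrib[of "\<lambda>v. v $ _"] cong: if_cong)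

lemma has_derivative_vec:
  fixes f :: "'a::real_normed_vector \<Rightarrow> 'k::real_normed_field ^ 'n::finite"
  assumes "\<And>i. ((\<lambda>x. f x $ i) has_derivative (\<lambda>v. f' v $ i)) F"
  shows "(f has_derivative f') F"
proof -
  have "((\<lambda>x. \<Sum>i\<in>UNIV. axis i (f x $ i) :: 'k ^ 'n) has_derivative (\<lambda>v. \<Sum>i\<in>UNIV. axis i (f' v $ i))) F"
    by (intro has_derivative_sum bounded_linear.has_derivative[OF bounded_linear_axis] assms)
  then show ?thesis by (simp only: vec_eq_sum_axis[symmetric])
qed

text \<open>Connects the coordinatewise definition of partial derivatives with total derivatives over the
  ground field.\<close>

lemma partial_deriv_eqI:
  fixes f :: "'k::real_normed_field ^ 'n::finite \<Rightarrow> 'k"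
  assumes "(f has_derivative (\<lambda>v. \<Sum>j\<in>UNIV. v $ j * a j)) (at x)"
  shows "partial_deriv i f x = a i"
proof -
  have p: "(\<chi> j. if j = i then z else x $ j) = x + axis i (z - x $ i)" for z
    by (simp add: vec_eq_iff axis_def)
  have x0: "axis i 0 = (0 :: 'k ^ 'n)" by (simp add: vec_eq_iff axis_def)
  have "((\<lambda>z. x + axis i (z - x $ i)) has_derivative (\<lambda>z. axis i z)) (at (x $ i))"
    by (auto intro!: derivative_eq_intros bounded_linear.has_derivative[OF bounded_linear_axis])
  then have "((\<lambda>z. f (x + axis i (z - x $ i))) has_derivative (\<lambda>z. \<Sum>j\<in>UNIV. axis i z $ j * a j)) (at (x $ i))"
    by (rule has_derivative_compose) (use assms in \<open>simp add: x0\<close>)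
  also have "(\<lambda>z. \<Sum>j\<in>UNIV. axis i z $ j * a j) = (*) (a i)"
    by (auto simp: axis_def if_distrib[of "(*) _"] mult.commute[of _ "a _"] cong: if_cong)
  finally show ?thesis
    unfolding partial_deriv_def p by (intro DERIV_imp_deriv) (simp add: has_field_derivative_def)
qed

section \<open>Closure properties of \<open>C\<^sup>k\<close> maps\<close>

lemma Ck_on_cong:
  assumes "open S" "\<And>x. x \<in> S \<Longrightarrow> f x = g x" "Ck_on k S f"
  shows "Ck_on k S g"
  using assms(2,3)
proof (induction k arbitrary: f g)
  case 0
  then show ?case using continuous_on_cong[of S S f g] by simp
next
  case (Suc k)
  have D: "(g has_derivative frechet_derivative f (at x)) (at x)" if "x \<in> S" for x
    by (rule has_derivative_transform_within_open[where f = f, OF _ \<open>open S\<close> that])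
      (use Suc.prems that in \<open>auto simp: frechet_derivative_works\<close>)
  then have e: "frechet_derivative g (at x) = frechet_derivative f (at x)" if "x \<in> S" for x
    using that frechet_derivative_at by metis
  have "Ck_on k S (\<lambda>x. frechet_derivative g (at x) v)" for v
    by (rule Suc.IH[of "\<lambda>x. frechet_derivative f (at x) v"]) (use Suc.prems e in auto)
  then show ?case using D by (auto simp: differentiable_def)
qed

text \<open>The way to establish higher regularity: any explicit formula for the derivative may be used in
  place of the chosen one.\<close>

lemma Ck_on_SucI:
  assumes "open S" "\<And>x. x \<in> S \<Longrightarrow> (f has_derivative D x) (at x)" "\<And>v. Ck_on k S (\<lambda>x. D x v)"
  shows "Ck_on (Suc k) S f"
proof -
  have "frechet_derivative f (at x) = D x" if "x \<in> S" for x
    using assms(2)[OF that] frechet_derivative_at by metis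
  then have "Ck_on k S (\<lambda>x. frechet_derivative f (at x) v)" for v
    using Ck_on_cong[OF assms(1) _ assms(3)[of v]] by simp
  then show ?thesis using assms(2) by (auto simp: differentiable_def)
qed

lemma Ck_on_SucD:
  assumes "Ck_on (Suc k) S f"
  shows "x \<in> S \<Longrightarrow> (f has_derivative frechet_derivative f (at x)) (at x)"
    and "Ck_on k S (\<lambda>x. frechet_derivative f (at x) v)"
  using assms by (auto simp: frechet_derivative_works[symmetric])

lemma Ck_on_Suc_imp: "Ck_on (Suc k) S f \<Longrightarrow> Ck_on k S f"
proof (induction k arbitrary: f)
  case 0
  then show ?case
    by (auto intro!: continuous_at_imp_continuous_on differentiable_imp_continuous_within)
next
  case (Suc k)
  have "\<forall>v. Ck_on k S (\<lambda>x. frechet_derivative f (at x) v)"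
    using Suc.IH Suc.prems by (metis Ck_on.simps(2))
  then show ?case using Suc.prems by (metis Ck_on.simps(2))
qed

lemma Ck_on_subset: "Ck_on k S f \<Longrightarrow> T \<subseteq> S \<Longrightarrow> Ck_on k T f"
  by (induction k arbitrary: f) (auto intro: continuous_on_subset)

lemma Ck_on_const: "open S \<Longrightarrow> Ck_on k S (\<lambda>_. c)"
proof (induction k arbitrary: c)
  case (Suc k)
  show ?case by (rule Ck_on_SucI[OF Suc.prems has_derivative_const Suc.IH[OF Suc.prems]])
qed simp

lemma Ck_on_bounded_linear_compose:
  assumes "open S" "bounded_linear L" "Ck_on k S f"
  shows "Ck_on k S (\<lambda>x. L (f x))"
  using assms(3)
proof (induction k arbitrary: f)
  case 0
  then show ?case using bounded_linear.continuous_on[OF assms(2)] by simp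
next
  case (Suc k)
  show ?case
    by (rule Ck_on_SucI[OF assms(1) bounded_linear.has_derivative[OF assms(2) Ck_on_SucD(1)[OF Suc.prems]]])
      (auto intro: Suc.IH[OF Ck_on_SucD(2)[OF Suc.prems]])
qed

lemma Ck_on_bounded_linear:
  assumes "open S" "bounded_linear L"
  shows "Ck_on k S L"
proof -
  have "Ck_on k S (\<lambda>x. x)"
  proof (cases k)
    case (Suc m)
    show ?thesis unfolding Suc by (rule Ck_on_SucI[OF assms(1) has_derivative_ident Ck_on_const[OF assms(1)]])
  qed simp
  then show ?thesis using Ck_on_bounded_linear_compose[OF assms] by blast
qed

lemma Ck_on_add:
  assumes "open S" "Ck_on k S f" "Ck_on k S g"
  shows "Ck_on k S (\<lambda>x. f x + g x)"
  using assms(2,3)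
proof (induction k arbitrary: f g)
  case (Suc k)
  show ?case
    by (rule Ck_on_SucI[OF assms(1) has_derivative_add[OF Ck_on_SucD(1)[OF Suc.prems(1)] Ck_on_SucD(1)[OF Suc.prems(2)]]])
      (auto intro!: Suc.IH Ck_on_SucD(2) Suc.prems simp del: Ck_on.simps)
qed (auto intro: continuous_on_add)

lemma Ck_on_sum:
  assumes "open S" "\<And>i. i \<in> I \<Longrightarrow> Ck_on k S (f i)"
  shows "Ck_on k S (\<lambda>x. \<Sum>i\<in>I. f i x)"
  using assms(2)
  by (induction I rule: infinite_finite_induct) (auto intro: Ck_on_const Ck_on_add assms(1))

lemma Ck_on_bilinear:
  assumes "open S" "bounded_bilinear P" "Ck_on k S f" "Ck_on k S g"
  shows "Ck_on k S (\<lambda>x. P (f x) (g x))"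
  using assms(3,4)
proof (induction k arbitrary: f g)
  case 0
  then show ?case by (auto intro: bounded_bilinear.continuous_on[OF assms(2)])
next
  case (Suc k)
  show ?case
    by (rule Ck_on_SucI[OF assms(1) bounded_bilinear.FDERIV[OF assms(2) Ck_on_SucD(1)[OF Suc.prems(1)] Ck_on_SucD(1)[OF Suc.prems(2)]]])
      (assumption | intro Ck_on_add[OF assms(1)] Suc.IH[OF Ck_on_Suc_imp[OF Suc.prems(1)] Ck_on_SucD(2)[OF Suc.prems(2)]]
          Suc.IH[OF Ck_on_SucD(2)[OF Suc.prems(1)] Ck_on_Suc_imp[OF Suc.prems(2)]])+
qed

lemmas Ck_on_mult = Ck_on_bilinear[OF _ bounded_bilinear_mult]

lemma Ck_on_prod:
  fixes f :: "'i \<Rightarrow> 'a::real_normed_vector \<Rightarrow> 'b::real_normed_field"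
  assumes "open S" "\<And>i. i \<in> I \<Longrightarrow> Ck_on k S (f i)"
  shows "Ck_on k S (\<lambda>x. \<Prod>i\<in>I. f i x)"
  using assms(2)
  by (induction I rule: infinite_finite_induct) (auto intro: Ck_on_const Ck_on_mult assms(1))

text \<open>The derivative of \<open>g \<circ> f\<close> applies the derivative of \<open>g\<close> to a moving vector. Expanding that
  vector in the standard basis leaves directional derivatives of \<open>g\<close> along fixed vectors, to which
  the induction hypothesis applies.\<close>

lemma Ck_on_compose:
  fixes f :: "'a::real_normed_vector \<Rightarrow> 'b::euclidean_space"
  assumes "open S" "f ` S \<subseteq> T" "Ck_on k S f" "Ck_on k T g"
  shows "Ck_on k S (\<lambda>x. g (f x))"
  using assms(3,4)
proof (induction k arbitrary: g)
  case 0
  then show ?case using assms(2) continuous_on_compose2[of T g S f] by simp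
next
  case (Suc k)
  let ?f' = "\<lambda>x. frechet_derivative f (at x)" and ?g' = "\<lambda>y. frechet_derivative g (at y)"
  have D: "((\<lambda>x. g (f x)) has_derivative (\<lambda>v. \<Sum>b\<in>Basis. (?f' x v \<bullet> b) *\<^sub>R ?g' (f x) b)) (at x)" if x: "x \<in> S" for x
  proof -
    have g: "(g has_derivative ?g' (f x)) (at (f x))"
      by (rule Ck_on_SucD(1)[OF Suc.prems(2)]) (use x assms(2) in auto)
    then interpret bounded_linear "?g' (f x)" by (rule has_derivative_bounded_linear)
    have "?g' (f x) (?f' x v) = (\<Sum>b\<in>Basis. (?f' x v \<bullet> b) *\<^sub>R ?g' (f x) b)" for v
    proof -
      have "?g' (f x) (?f' x v) = ?g' (f x) (\<Sum>b\<in>Basis. (?f' x v \<bullet> b) *\<^sub>R b)"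
        by (simp add: euclidean_representation)
      then show ?thesis by (simp only: sum scaleR)
    qed
    then show ?thesis
      using has_derivative_compose[OF Ck_on_SucD(1)[OF Suc.prems(1) x] g] by simp
  qed
  show ?case
  proof (rule Ck_on_SucI[OF assms(1) D])
    fix v
    have "Ck_on k S (\<lambda>x. ?f' x v \<bullet> b)" for b
      by (rule Ck_on_bounded_linear_compose[OF assms(1) bounded_linear_inner_left Ck_on_SucD(2)[OF Suc.prems(1)]])
    moreover have "Ck_on k S (\<lambda>x. ?g' (f x) b)" for b
      by (rule Suc.IH[OF Ck_on_Suc_imp[OF Suc.prems(1)] Ck_on_SucD(2)[OF Suc.prems(2)]])
    ultimately show "Ck_on k S (\<lambda>x. \<Sum>b\<in>Basis. (?f' x v \<bullet> b) *\<^sub>R ?g' (f x) b)"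
      by (intro Ck_on_sum assms(1) Ck_on_bilinear[OF assms(1) bounded_bilinear_scaleR])
  qed auto
qed

lemma Ck_on_exp: "Ck_on k UNIV (exp :: 'b::{real_normed_field,banach} \<Rightarrow> 'b)"
proof (induction k)
  case (Suc k)
  have "(exp has_derivative (\<lambda>v. v * exp x)) (at x)" for x :: 'b
    using DERIV_exp[of x] by (simp add: has_field_derivative_def mult.commute[of _ "exp x"])
  then show ?case
    by (rule Ck_on_SucI[OF open_UNIV]) (intro Ck_on_mult Suc Ck_on_const open_UNIV)
qed (auto intro: continuous_intros)

lemma Ck_on_inverse: "Ck_on k (- {0}) (inverse :: 'b::real_normed_field \<Rightarrow> 'b)"
proof (induction k)
  case 0
  show ?case by (auto intro!: continuous_intros)
next
  case (Suc k)
  have "(inverse has_derivative (\<lambda>v. - (inverse x * v * inverse x))) (at x)" if "x \<in> - {0}" for x :: 'b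
    using has_derivative_inverse'[of x UNIV] that by auto
  moreover have "Ck_on k (- {0}) (\<lambda>x. - (inverse x * v * inverse x))" for v :: 'b
    by (intro Ck_on_bounded_linear_compose[OF _ bounded_linear_minus[OF bounded_linear_ident]] Ck_on_mult Suc Ck_on_const) auto
  ultimately show ?case
    by (intro Ck_on_SucI[where D = "\<lambda>x v. - (inverse x * v * inverse x)"]) auto
qed

lemma Ck_on_vec:
  fixes f :: "'a::real_normed_vector \<Rightarrow> 'k::real_normed_field ^ 'n::finite"
  assumes "open S" "\<And>i. Ck_on k S (\<lambda>x. f x $ i)"
  shows "Ck_on k S f"
proof -
  have "Ck_on k S (\<lambda>x. \<Sum>i\<in>UNIV. axis i (f x $ i) :: 'k ^ 'n)"
    by (intro Ck_on_sum Ck_on_bounded_linear_compose[OF _ bounded_linear_axis] assms)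
  then show ?thesis by (simp only: vec_eq_sum_axis[symmetric])
qed

lemma Ck_on_vec_nth:
  fixes f :: "'a::real_normed_vector \<Rightarrow> 'k::real_normed_vector ^ 'n::finite"
  shows "open S \<Longrightarrow> Ck_on k S f \<Longrightarrow> Ck_on k S (\<lambda>x. f x $ i)"
  by (rule Ck_on_bounded_linear_compose[OF _ bounded_linear_vec_nth])

section \<open>Inverse functions and the Euler equation for smooth germs\<close>

lemma Ck_on_det:
  fixes A :: "'a::real_normed_vector \<Rightarrow> 'k::real_normed_field ^ 'n::finite ^ 'n"
  assumes "open S" "\<And>i j. Ck_on k S (\<lambda>x. A x $ i $ j)"
  shows "Ck_on k S (\<lambda>x. det (A x))"
  unfolding det_def
  by (intro Ck_on_sum Ck_on_mult Ck_on_prod Ck_on_const assms)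

lemma Ck_on_continuous_on: "Ck_on k S f \<Longrightarrow> continuous_on S f"
proof (induction k)
  case (Suc k)
  then show ?case using Ck_on_Suc_imp by blast
qed simp

lemma Cinf_on_Ck: "Cinf_on S f \<Longrightarrow> Ck_on k S f"
  by (simp add: Cinf_on_def)

text \<open>The \<open>C\<^sup>1\<close> inverse function theorem yields the inverse \<open>g\<close> and its derivative. By Cramer's rule
  that derivative at \<open>y\<close> is a smooth function of \<open>g y\<close>, so if \<open>g\<close> is \<open>C\<^sup>k\<close> then so is its
  derivative.\<close>

lemma smooth_inverse_function:
  fixes f :: "real ^ 'n::finite \<Rightarrow> real ^ 'n"
  assumes U: "open U" "0 \<in> U" and f: "Cinf_on U f" and f0: "f 0 = 0"
    and D0: "(f has_derivative (\<lambda>v. v)) (at 0)"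
  obtains V g where "open V" "0 \<in> V" "g 0 = 0" "g ` V \<subseteq> U" "Cinf_on V g" "\<And>y. y \<in> V \<Longrightarrow> f (g y) = y"
proof -
  let ?f' = "\<lambda>x. frechet_derivative f (at x)"
  have f': "(f has_derivative ?f' x) (at x)" if "x \<in> U" for x
    using Ck_on_SucD(1)[OF Cinf_on_Ck[OF f] that] .
  have bl: "bounded_linear (?f' x)" if "x \<in> U" for x
    using f'[OF that] by (rule has_derivative_bounded_linear)
  have ap: "blinfun_apply (Blinfun (?f' x)) = ?f' x" if "x \<in> U" for x
    using bounded_linear_Blinfun_apply[OF bl[OF that]] .
  have cont: "continuous_on U (\<lambda>x. Blinfun (?f' x))"
  proof (rule continuous_at_imp_continuous_on, rule ballI, rule continuous_blinfun_componentwiseI1)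
    fix x and b :: "real ^ 'n" assume x: "x \<in> U"
    have "continuous_on U (\<lambda>x. ?f' x b)"
      by (rule Ck_on_continuous_on[OF Ck_on_SucD(2)[OF Cinf_on_Ck[OF f]]])
    then have "continuous_on U (\<lambda>x. blinfun_apply (Blinfun (?f' x)) b)"
      by (rule continuous_on_eq) (simp add: ap)
    then show "continuous (at x) (\<lambda>x. blinfun_apply (Blinfun (?f' x)) b)"
      using x U(1) continuous_on_eq_continuous_at by blast
  qed
  have id: "?f' 0 = (\<lambda>v. v)" using D0 frechet_derivative_at by metis
  have id': "Blinfun (?f' 0) = id_blinfun"
    by (rule blinfun_eqI) (simp add: ap[OF U(2)] id bounded_linear_Blinfun_apply[OF bounded_linear_ident])
  have d: "(f has_derivative blinfun_apply (Blinfun (?f' x))) (at x)" if "x \<in> U" for x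
    using f'[OF that] by (simp add: ap[OF that])
  obtain U' V g g' where *: "open U'" "U' \<subseteq> U" "0 \<in> U'" "open V" "0 \<in> V" "homeomorphism U' V f g"
    "\<And>y. y \<in> V \<Longrightarrow> (g has_derivative (g' y)) (at y)"
    "\<And>y. y \<in> V \<Longrightarrow> g' y = inv_into UNIV (blinfun_apply (Blinfun (?f' (g y))))"
    "\<And>y. y \<in> V \<Longrightarrow> bij (blinfun_apply (Blinfun (?f' (g y))))"
  proof (rule inverse_function_theorem_scaled[where f = f and f' = "\<lambda>x. Blinfun (?f' x)", OF U(1) d cont U(2) f0 id'])
  qed (assumption | rule that)+
  have gV: "g y \<in> U" "f (g y) = y" if "y \<in> V" for y
    using *(2,6) that unfolding homeomorphism_def by blast+
  have g0: "g 0 = 0"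
    using *(3,6) f0 unfolding homeomorphism_def by metis
  define A where "A x = matrix (?f' x)" for x
  have Amul: "A x *v v = ?f' x v" if "x \<in> U" for x v
    using matrix_works[of "?f' x" v] bounded_linear.linear[OF bl[OF that]]
    by (simp add: A_def linear_matrix_vector_mul_eq)
  have det: "det (A (g y)) \<noteq> 0" if y: "y \<in> V" for y
  proof -
    have "(*v) (A (g y)) = ?f' (g y)" by (rule ext) (rule Amul[OF gV(1)[OF y]])
    then have "inj ((*v) (A (g y)))"
      using *(9)[OF y] gV(1)[OF y] by (simp add: ap bij_def)
    then have "invertible (A (g y))"
      by (metis invertible_left_inverse matrix_left_invertible_injective)
    then show ?thesis by (simp add: invertible_det_nz)
  qed
  \<comment> \<open>The matrix of Cramer's rule: column \<open>k\<close> of \<open>A x\<close> is replaced by \<open>v\<close>.\<close>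
  define B where "B v k x = (\<chi> i j. if j = k then v $ i else A x $ i $ j)" for v :: "real ^ 'n" and k x
  have g'eq: "g' y v = (\<chi> k. det (B v k (g y)) * inverse (det (A (g y))))" if y: "y \<in> V" for y v
  proof -
    have "?f' (g y) (g' y v) = v"
      using *(8,9)[OF y] gV(1)[OF y] by (simp add: ap bij_def surj_f_inv_f)
    then have "A (g y) *v g' y v = v" by (simp add: Amul gV(1)[OF y])
    then show ?thesis using cramer[OF det[OF y], of "g' y v" v]
      by (simp add: B_def divide_inverse)
  qed
  have CA: "Ck_on k U (\<lambda>x. A x $ i $ j)" for k i j
    using Ck_on_vec_nth[OF U(1) Ck_on_SucD(2)[OF Cinf_on_Ck[OF f]], of _ "axis j 1" i]
    by (simp add: A_def matrix_def)
  have CB: "Ck_on k U (\<lambda>x. det (B v l x))" for k v l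
  proof (rule Ck_on_det[OF U(1)])
    show "Ck_on k U (\<lambda>x. B v l x $ i $ j)" for i j
      by (cases "j = l") (auto simp: B_def intro: CA Ck_on_const[OF U(1)])
  qed
  have Cg: "Ck_on k V g" for k
  proof (induction k)
    case 0
    then show ?case using *(6) by (simp add: homeomorphism_def)
  next
    case (Suc k)
    have gU: "g ` V \<subseteq> U" using gV by auto
    show ?case
    proof (rule Ck_on_SucI[OF *(4) *(7)])
      fix v
      have "Ck_on k V (\<lambda>y. det (B v l (g y)) * inverse (det (A (g y))))" for l
      proof (rule Ck_on_mult[OF *(4)])
        show "Ck_on k V (\<lambda>y. det (B v l (g y)))"
          by (rule Ck_on_compose[OF *(4) gU Suc CB])
        have "Ck_on k V (\<lambda>y. det (A (g y)))"
          by (rule Ck_on_compose[OF *(4) gU Suc Ck_on_det[OF U(1) CA]])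
        then show "Ck_on k V (\<lambda>y. inverse (det (A (g y))))"
          by (rule Ck_on_compose[OF *(4) _ _ Ck_on_inverse, rotated]) (use det in auto)
      qed
      then have "Ck_on k V (\<lambda>y. \<chi> l. det (B v l (g y)) * inverse (det (A (g y))))"
        by (intro Ck_on_vec[OF *(4)]) simp
      then show "Ck_on k V (\<lambda>y. g' y v)"
        by (rule Ck_on_cong[OF *(4), rotated]) (simp add: g'eq)
    qed
  qed
  show ?thesis
    by (rule that[where g = g, OF *(4,5) g0]) (use gV Cg in \<open>auto simp: Cinf_on_def\<close>)
qed

text \<open>The same flow in multiplicative time \<open>t = exp z\<close>, which also reaches the limit \<open>t = 0\<close>.\<close>

definition weighted_power :: "('n::finite \<Rightarrow> nat) \<Rightarrow> real \<Rightarrow> real ^ 'n \<Rightarrow> real ^ 'n" where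
  "weighted_power w t x = (\<chi> i. t ^ w i * x $ i)"

lemma norm_weighted_power_le:
  assumes "0 \<le> t" "t \<le> 1"
  shows "norm (weighted_power w t x) \<le> norm x"
proof -
  have "norm (weighted_power w t x $ i) \<le> norm (x $ i)" for i
    using assms power_le_one[of t "w i"] by (simp add: weighted_power_def abs_mult mult_left_le_one_le)
  then show ?thesis unfolding norm_vec_def by (intro L2_set_mono) auto
qed

lemma has_derivative_coords:
  fixes f :: "real ^ 'n::finite \<Rightarrow> 'b::real_normed_vector"
  assumes "(f has_derivative f') F"
  shows "f' v = (\<Sum>i\<in>UNIV. v $ i *\<^sub>R f' (axis i 1))"
proof -
  interpret bounded_linear f' using assms by (rule has_derivative_bounded_linear)
  have "v = (\<Sum>i\<in>UNIV. v $ i *\<^sub>R axis i 1)"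
    by (simp add: vec_eq_iff axis_def if_distrib[of "\<lambda>u. _ * u"] cong: if_cong)
  then have "f' v = f' (\<Sum>i\<in>UNIV. v $ i *\<^sub>R axis i 1)" by simp
  then show ?thesis by (simp only: sum scaleR)
qed

lemma continuous_on_weighted_power: "continuous_on S (\<lambda>(x, t). weighted_power w t x)"
  unfolding weighted_power_def case_prod_beta
  by (intro continuous_intros)

lemma continuous_on_weighted_power_integrand:
  assumes "continuous_on (ball 0 r) f"
  shows "continuous_on (ball 0 r \<times> cbox 0 1) (\<lambda>(x, t). t ^ m * f (weighted_power w t x))"
proof -
  have "continuous_on (ball 0 r \<times> cbox 0 1) (\<lambda>p. f ((\<lambda>(x, t). weighted_power w t x) p))"
    by (rule continuous_on_compose2[OF assms continuous_on_weighted_power])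
      (use norm_weighted_power_le in \<open>auto intro: le_less_trans[OF norm_weighted_power_le]\<close>)
  then show ?thesis by (auto simp: case_prod_beta intro!: continuous_intros)
qed

lemma continuous_on_slice:
  assumes "continuous_on (A \<times> B) (\<lambda>(x, t). f x t)" "x \<in> A"
  shows "continuous_on B (f x)"
proof -
  have "continuous_on B (\<lambda>t. (\<lambda>(x, t). f x t) (x, t))"
    by (rule continuous_on_compose2[OF assms(1)]) (use assms(2) in \<open>auto intro!: continuous_intros\<close>)
  then show ?thesis by simp
qed

lemma weighted_power_integrable:
  assumes "continuous_on (ball 0 r) f" "x \<in> ball 0 r"
  shows "(\<lambda>t. t ^ m * f (weighted_power w t x) :: real) integrable_on {0..1}"
  using integrable_continuous[OF continuous_on_slice[OF continuous_on_weighted_power_integrand[OF assms(1)] assms(2)]]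
  by simp

text \<open>Differentiation under the integral sign. The partial derivatives are integrals of the same kind
  with a higher power of \<open>t\<close>, which makes induction on the order of differentiability possible.\<close>

lemma weighted_mean_has_derivative:
  fixes f :: "real ^ 'n::finite \<Rightarrow> real"
  assumes f: "Ck_on (Suc k) (ball 0 r) f" and x: "x \<in> ball 0 r"
  shows "((\<lambda>x. integral {0..1} (\<lambda>t. t ^ m * f (weighted_power w t x))) has_derivative
    (\<lambda>v. \<Sum>i\<in>UNIV. v $ i * integral {0..1} (\<lambda>t. t ^ (m + w i) * frechet_derivative f (at (weighted_power w t x)) (axis i 1)))) (at x)"
proof -
  let ?S = "ball 0 r :: (real ^ 'n) set"
  let ?d = "\<lambda>i y. frechet_derivative f (at y) (axis i 1)"
  define N where "N i = Blinfun (\<lambda>v :: real ^ 'n. v $ i)" for i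
  have N: "blinfun_apply (N i) v = v $ i" for i v
    unfolding N_def by (simp add: bounded_linear_Blinfun_apply bounded_linear_vec_nth)
  define fx where "fx x t = (\<Sum>i\<in>UNIV. (t ^ (m + w i) * ?d i (weighted_power w t x)) *\<^sub>R N i)" for x t
  have cd: "continuous_on ?S (?d i)" for i
    by (rule Ck_on_continuous_on[OF Ck_on_SucD(2)[OF f]])
  have cf: "continuous_on ?S f" by (rule Ck_on_continuous_on[OF f])
  have ball: "weighted_power w t y \<in> ?S" if "y \<in> ?S" "t \<in> cbox 0 1" for y t
    using norm_weighted_power_le[of t w y] that by (auto intro: le_less_trans)
  have fxa: "blinfun_apply (fx x t) v = (\<Sum>i\<in>UNIV. v $ i * (t ^ (m + w i) * ?d i (weighted_power w t x)))" for x t v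
    by (simp add: fx_def blinfun.sum_left blinfun.scaleR_left N mult.commute)
  have cfx: "continuous_on (?S \<times> cbox 0 1) (\<lambda>(x, t). fx x t)"
    using continuous_on_weighted_power_integrand[OF cd] unfolding fx_def case_prod_beta
    by (intro continuous_on_sum continuous_on_scaleR continuous_on_const)
  have "((\<lambda>x. integral (cbox 0 1) (\<lambda>t. t ^ m * f (weighted_power w t x))) has_derivative
      blinfun_apply (integral (cbox 0 1) (fx x))) (at x within ?S)"
  proof (rule leibniz_rule[OF _ _ cfx x convex_ball])
    fix y t assume y: "y \<in> ?S" and t: "t \<in> cbox 0 (1::real)"
    have "(weighted_power w t has_derivative weighted_power w t) (at y)"
    proof -
      have "bounded_linear (weighted_power w t)"
        by (intro linear_conv_bounded_linear[THEN iffD1] linearI)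
          (auto simp: weighted_power_def vec_eq_iff algebra_simps)
      then show ?thesis by (rule bounded_linear_imp_has_derivative)
    qed
    then have "((\<lambda>x. f (weighted_power w t x)) has_derivative (\<lambda>v. frechet_derivative f (at (weighted_power w t y)) (weighted_power w t v))) (at y)"
      by (rule has_derivative_compose[where f = "weighted_power w t", OF _ Ck_on_SucD(1)[OF f ball[OF y t]]])
    then have "((\<lambda>x. t ^ m * f (weighted_power w t x)) has_derivative (\<lambda>v. t ^ m * frechet_derivative f (at (weighted_power w t y)) (weighted_power w t v))) (at y)"
      by (rule has_derivative_mult_right)
    also have "(\<lambda>v. t ^ m * frechet_derivative f (at (weighted_power w t y)) (weighted_power w t v)) = blinfun_apply (fx y t)"
      unfolding fxa by (subst has_derivative_coords[OF Ck_on_SucD(1)[OF f ball[OF y t]]])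
        (auto simp: weighted_power_def sum_distrib_left power_add mult_ac)
    finally show "((\<lambda>x. t ^ m * f (weighted_power w t x)) has_derivative blinfun_apply (fx y t)) (at y within ?S)"
      by (rule has_derivative_at_withinI)
  next
    fix y assume "y \<in> ?S"
    then show "(\<lambda>t. t ^ m * f (weighted_power w t y)) integrable_on cbox 0 1"
      using weighted_power_integrable[OF cf] by simp
  qed
  moreover have "blinfun_apply (integral (cbox 0 1) (fx x)) v =
     (\<Sum>i\<in>UNIV. v $ i * integral {0..1} (\<lambda>t. t ^ (m + w i) * ?d i (weighted_power w t x)))" for v
  proof -
    have int: "(\<lambda>t. t ^ (m + w i) * ?d i (weighted_power w t x)) integrable_on cbox 0 1" for i
      using weighted_power_integrable[OF cd x] by simp
    have "fx x integrable_on cbox 0 1"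
      by (rule integrable_continuous[OF continuous_on_slice[OF cfx x]])
    then have "blinfun_apply (integral (cbox 0 1) (fx x)) v = integral (cbox 0 1) (\<lambda>t. blinfun_apply (fx x t) v)"
      by (rule blinfun_apply_integral)
    also have "\<dots> = (\<Sum>i\<in>UNIV. integral (cbox 0 1) (\<lambda>t. v $ i * (t ^ (m + w i) * ?d i (weighted_power w t x))))"
      unfolding fxa by (rule integral_sum) (auto intro!: integrable_on_mult_right int[simplified] simp del: integrable_on_cmult_iff)
    finally show ?thesis by simp
  qed
  then have "blinfun_apply (integral (cbox 0 1) (fx x)) =
     (\<lambda>v. \<Sum>i\<in>UNIV. v $ i * integral {0..1} (\<lambda>t. t ^ (m + w i) * ?d i (weighted_power w t x)))" by (rule ext)
  ultimately show ?thesis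
    using at_within_open[OF x open_ball] by simp
qed

lemma Ck_on_weighted_mean:
  fixes f :: "real ^ 'n::finite \<Rightarrow> real"
  assumes "Ck_on k (ball 0 r) f"
  shows "Ck_on k (ball 0 r) (\<lambda>x. integral {0..1} (\<lambda>t. t ^ m * f (weighted_power w t x)))"
  using assms
proof (induction k arbitrary: f m)
  case 0
  then show ?case
    using integral_continuous_on_param[OF continuous_on_weighted_power_integrand[of r f m w]] by simp
next
  case (Suc k)
  show ?case
    by (rule Ck_on_SucI[OF open_ball weighted_mean_has_derivative[OF Suc.prems]])
      (assumption | intro Ck_on_sum Ck_on_mult Ck_on_const open_ball Suc.IH[OF Ck_on_SucD(2)[OF Suc.prems]])+
qed

text \<open>The solution is a weighted integral of \<open>f\<close> along the orbit from the origin to \<open>x\<close>; the equation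
  holds because the integrand of its left-hand side is the derivative of \<open>t\<^sup>W f(t\<^sup>w x)\<close>.\<close>

lemma smooth_euler_equation:
  fixes f :: "real ^ 'n::finite \<Rightarrow> real"
  assumes f: "Cinf_on (ball 0 r) f" and W: "total_weight w > 0"
  obtains F where "Cinf_on (ball 0 r) F"
    "\<And>x. x \<in> ball 0 r \<Longrightarrow> frechet_derivative F (at x) (\<chi> i. real (w i) * x $ i) + real (total_weight w) * F x = f x"
proof -
  let ?S = "ball 0 r :: (real ^ 'n) set"
  \<comment> \<open>The exponent \<open>W - 1\<close> of the weight \<open>t\<^sup>W\<^sup>-\<^sup>1\<close>.\<close>
  obtain n where n: "(total_weight w) = Suc n" using W gr0_implies_Suc by blast
  define F where "F x = integral {0..1} (\<lambda>t. t ^ n * f (weighted_power w t x))" for x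
  have CF: "Cinf_on ?S F"
    using Ck_on_weighted_mean[OF Cinf_on_Ck[OF f]] by (simp add: Cinf_on_def F_def[abs_def])
  let ?d = "\<lambda>i y. frechet_derivative f (at y) (axis i 1)"
  have "frechet_derivative F (at x) (\<chi> i. real (w i) * x $ i) + real (total_weight w) * F x = f x"
    if x: "x \<in> ?S" for x
  proof -
    have f1: "Ck_on (Suc 0) ?S f" by (rule Cinf_on_Ck[OF f])
    have cd: "continuous_on ?S (?d i)" for i
      by (rule Ck_on_continuous_on[OF Ck_on_SucD(2)[OF f1]])
    have cf: "continuous_on ?S f" by (rule Ck_on_continuous_on[OF f1])
    note int = weighted_power_integrable[OF _ x]
    have "frechet_derivative F (at x) = (\<lambda>v. \<Sum>i\<in>UNIV. v $ i * integral {0..1} (\<lambda>t. t ^ (n + w i) * ?d i (weighted_power w t x)))"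
      unfolding F_def[abs_def] by (rule frechet_derivative_at[OF weighted_mean_has_derivative[OF f1 x], symmetric])
    then have "frechet_derivative F (at x) (\<chi> i. real (w i) * x $ i) + real (total_weight w) * F x =
       (\<Sum>i\<in>UNIV. integral {0..1} (\<lambda>t. (real (w i) * x $ i) * (t ^ (n + w i) * ?d i (weighted_power w t x)))) +
       integral {0..1} (\<lambda>t. real (Suc n) * (t ^ n * f (weighted_power w t x)))"
      by (simp add: F_def n del: of_nat_Suc of_nat_sum)
    also have "\<dots> = integral {0..1} (\<lambda>t. (\<Sum>i\<in>UNIV. (real (w i) * x $ i) * (t ^ (n + w i) * ?d i (weighted_power w t x)))
       + real (Suc n) * (t ^ n * f (weighted_power w t x)))"
    proof -
      have I: "(\<lambda>t. (real (w i) * x $ i) * (t ^ (n + w i) * ?d i (weighted_power w t x))) integrable_on {0..1}" for i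
        by (intro integrable_on_mult_right int cd)
      show ?thesis
        unfolding integral_sum[OF finite_class.finite_UNIV I, symmetric]
        by (rule integral_add[symmetric]) (intro integrable_sum I finite_class.finite_UNIV integrable_on_mult_right int cf)+
    qed
    also have "\<dots> = 1 ^ Suc n * f (weighted_power w 1 x) - 0 ^ Suc n * f (weighted_power w 0 x)"
    proof (rule integral_unique, rule fundamental_theorem_of_calculus)
      fix t :: real assume t: "t \<in> {0..1}"
      have y: "weighted_power w t x \<in> ?S" using norm_weighted_power_le[of t w x] x t by (auto intro: le_less_trans)
      have "((\<lambda>t. weighted_power w t x) has_derivative (\<lambda>h. \<chi> i. h * (real (w i) * t ^ (w i - 1) * x $ i))) (at t)"
        by (rule has_derivative_vec) (auto simp: weighted_power_def intro!: derivative_eq_intros)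
      then have "((\<lambda>t. f (weighted_power w t x)) has_derivative (\<lambda>h. frechet_derivative f (at (weighted_power w t x)) (\<chi> i. h * (real (w i) * t ^ (w i - 1) * x $ i)))) (at t)"
        by (rule has_derivative_compose[where f = "\<lambda>t. weighted_power w t x", OF _ Ck_on_SucD(1)[OF f1 y]])
      then have "((\<lambda>t. f (weighted_power w t x)) has_derivative (\<lambda>h. (\<Sum>i\<in>UNIV. real (w i) * t ^ (w i - 1) * x $ i * ?d i (weighted_power w t x)) * h)) (at t)"
        by (subst (asm) has_derivative_coords[OF Ck_on_SucD(1)[OF f1 y]]) (simp add: sum_distrib_right sum_distrib_left mult_ac)
      then have *: "((\<lambda>t. f (weighted_power w t x)) has_field_derivative (\<Sum>i\<in>UNIV. real (w i) * t ^ (w i - 1) * x $ i * ?d i (weighted_power w t x))) (at t)"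
        by (simp add: has_field_derivative_def)
      have e: "real (w i) * t ^ (w i - 1) * t ^ Suc n = real (w i) * t ^ (n + w i)" for i
        by (cases "w i") (simp_all add: power_add)
      have "((\<lambda>t. t ^ Suc n * f (weighted_power w t x)) has_field_derivative
         (\<Sum>i\<in>UNIV. (real (w i) * x $ i) * (t ^ (n + w i) * ?d i (weighted_power w t x))) + real (Suc n) * (t ^ n * f (weighted_power w t x))) (at t)"
      proof (rule DERIV_cong[OF DERIV_mult[OF DERIV_pow *]])
        have "(\<Sum>i\<in>UNIV. real (w i) * t ^ (w i - 1) * x $ i * ?d i (weighted_power w t x)) * t ^ Suc n =
          (\<Sum>i\<in>UNIV. (real (w i) * t ^ (w i - 1) * t ^ Suc n) * (x $ i * ?d i (weighted_power w t x)))"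
          by (simp add: sum_distrib_right sum_distrib_left mult_ac)
        also have "\<dots> = (\<Sum>i\<in>UNIV. (real (w i) * x $ i) * (t ^ (n + w i) * ?d i (weighted_power w t x)))"
          unfolding e by (simp add: mult_ac)
        finally show "real (Suc n) * t ^ (Suc n - Suc 0) * f (weighted_power w t x) + (\<Sum>i\<in>UNIV. real (w i) * t ^ (w i - 1) * x $ i * ?d i (weighted_power w t x)) * t ^ Suc n =
          (\<Sum>i\<in>UNIV. (real (w i) * x $ i) * (t ^ (n + w i) * ?d i (weighted_power w t x))) + real (Suc n) * (t ^ n * f (weighted_power w t x))"
          by (simp del: power_Suc of_nat_Suc)
      qed
      then show "((\<lambda>t. t ^ Suc n * f (weighted_power w t x)) has_vector_derivative
         (\<Sum>i\<in>UNIV. (real (w i) * x $ i) * (t ^ (n + w i) * ?d i (weighted_power w t x))) + real (Suc n) * (t ^ n * f (weighted_power w t x))) (at t within {0..1})"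
        using has_real_derivative_iff_has_vector_derivative has_vector_derivative_at_within by blast
    qed simp
    also have "\<dots> = f x" by (simp add: weighted_power_def)
    finally show ?thesis .
  qed
  with CF show ?thesis by (rule that)
qed

section \<open>Norm bounds for convergent power series\<close>

definition mdeg :: "('n::finite \<Rightarrow> nat) \<Rightarrow> nat" where
  "mdeg \<alpha> = (\<Sum>i\<in>UNIV. \<alpha> i)"

definition monomial :: "('n::finite \<Rightarrow> nat) \<Rightarrow> 'k::comm_monoid_mult ^ 'n \<Rightarrow> 'k" where
  "monomial \<alpha> x = (\<Prod>i\<in>UNIV. (x $ i) ^ \<alpha> i)"

definition polydisc :: "real \<Rightarrow> ('k::real_normed_vector ^ 'n) set" where
  "polydisc r = {x. \<forall>i. norm (x $ i) \<le> r}"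

abbreviation coeff_weights :: "real \<Rightarrow> (('n::finite \<Rightarrow> nat) \<Rightarrow> 'k::real_normed_vector) \<Rightarrow> ('n \<Rightarrow> nat) \<Rightarrow> real" where
  "coeff_weights r c \<equiv> \<lambda>\<alpha>. norm (c \<alpha>) * r ^ mdeg \<alpha>"

abbreviation coeff_norm :: "real \<Rightarrow> (('n::finite \<Rightarrow> nat) \<Rightarrow> 'k::real_normed_vector) \<Rightarrow> real" where
  "coeff_norm r c \<equiv> infsum (coeff_weights r c) UNIV"

abbreviation power_terms :: "(('n::finite \<Rightarrow> nat) \<Rightarrow> 'k) \<Rightarrow> 'k::comm_monoid_mult ^ 'n \<Rightarrow> ('n \<Rightarrow> nat) \<Rightarrow> 'k" where
  "power_terms c x \<equiv> \<lambda>\<alpha>. c \<alpha> * monomial \<alpha> x"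

text \<open>The function \<open>f\<close> is the sum of a power series whose coefficients have \<open>l\<^sup>1\<close> norm at most \<open>M\<close>
  with weights \<open>r\<^sup>|\<^sup>\<alpha>\<^sup>|\<close>. These functions form a Banach algebra, and the bound \<open>M\<close> is carried along
  so that contraction arguments can be run in it.\<close>

definition mpowser_le :: "real \<Rightarrow> real \<Rightarrow> ('k::{real_normed_field, euclidean_space} ^ 'n::finite \<Rightarrow> 'k) \<Rightarrow> bool" where
  "mpowser_le r M f \<longleftrightarrow> (\<exists>c. coeff_weights r c summable_on UNIV \<and>
     (coeff_norm r c) \<le> M \<and>
     (\<forall>x\<in>polydisc r. (power_terms c x has_sum f x) UNIV))"

lemma mpowserE:
  assumes "mpowser_le r M f"
  obtains c where "coeff_weights r c summable_on UNIV"
    "(coeff_norm r c) \<le> M"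
    "\<And>x. x \<in> polydisc r \<Longrightarrow> (power_terms c x has_sum f x) UNIV"
  using assms unfolding mpowser_le_def by blast

lemma monomial_add: "monomial (\<lambda>i. \<alpha> i + \<beta> i) x = monomial \<alpha> x * monomial \<beta> x"
  by (simp add: monomial_def power_add prod.distrib)

lemma mdeg_add: "mdeg (\<lambda>i. \<alpha> i + \<beta> i) = mdeg \<alpha> + mdeg \<beta>"
  by (simp add: mdeg_def sum.distrib)

lemma mdeg_eq_0_iff: "mdeg \<alpha> = 0 \<longleftrightarrow> \<alpha> = (\<lambda>_. 0)"
  by (auto simp: mdeg_def fun_eq_iff)

lemma norm_monomial_le:
  fixes x :: "'k::real_normed_field ^ 'n::finite"
  assumes "x \<in> polydisc r"
  shows "norm (monomial \<alpha> x) \<le> r ^ mdeg \<alpha>"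
proof -
  have "norm (monomial \<alpha> x) = (\<Prod>i\<in>UNIV. norm (x $ i) ^ \<alpha> i)"
    by (simp add: monomial_def prod_norm[symmetric] norm_power)
  also have "\<dots> \<le> (\<Prod>i\<in>UNIV. r ^ \<alpha> i)"
    using assms by (intro prod_mono) (auto simp: polydisc_def intro!: power_mono)
  also have "\<dots> = r ^ mdeg \<alpha>"
    by (simp add: mdeg_def power_sum)
  finally show ?thesis .
qed

lemma monomial_zero_eq: "monomial \<alpha> (0 :: 'k::real_normed_field ^ 'n::finite) = (if \<alpha> = (\<lambda>_. 0) then 1 else 0)"
proof (cases "\<alpha> = (\<lambda>_. 0)")
  case False
  then obtain i where "\<alpha> i \<noteq> 0" by auto
  then show ?thesis using False by (auto simp: monomial_def intro!: prod_zero bexI[of _ i])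
qed (simp add: monomial_def)

lemma zero_in_polydisc [simp]: "0 \<le> r \<Longrightarrow> 0 \<in> polydisc r"
  by (simp add: polydisc_def)

lemma polydisc_mono: "r \<le> r' \<Longrightarrow> polydisc r \<subseteq> polydisc r'"
  by (auto simp: polydisc_def intro: order_trans)

lemma mpowser_mono:
  assumes "mpowser_le r M f" "M \<le> N"
  shows "mpowser_le r N f"
  using assms unfolding mpowser_le_def by (meson order_trans)

lemma mpowser_cong:
  assumes "mpowser_le r M f" "\<And>x. x \<in> polydisc r \<Longrightarrow> f x = g x"
  shows "mpowser_le r M g"
  using assms by (auto simp: mpowser_le_def)

lemma mpowser_monomial:
  assumes "0 \<le> r"
  shows "mpowser_le r (norm a * r ^ mdeg \<alpha>) (\<lambda>x. a * monomial \<alpha> x)"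
  unfolding mpowser_le_def
proof (intro exI[of _ "\<lambda>\<beta>. if \<beta> = \<alpha> then a else 0"] conjI ballI)
  have s: "((\<lambda>\<beta>. norm (if \<beta> = \<alpha> then a else 0) * r ^ mdeg \<beta>) has_sum norm a * r ^ mdeg \<alpha>) UNIV"
    by (rule has_sum_finite_neutralI[of "{\<alpha>}"]) auto
  show "(\<lambda>\<beta>. norm (if \<beta> = \<alpha> then a else 0) * r ^ mdeg \<beta>) summable_on UNIV"
    using s by (rule has_sum_imp_summable)
  show "(\<Sum>\<^sub>\<infinity>\<beta>. norm (if \<beta> = \<alpha> then a else 0) * r ^ mdeg \<beta>) \<le> norm a * r ^ mdeg \<alpha>"
    using infsumI[OF s] by simp
  fix x :: "'a ^ 'b"
  show "((\<lambda>\<beta>. (if \<beta> = \<alpha> then a else 0) * monomial \<beta> x) has_sum a * monomial \<alpha> x) UNIV"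
    by (rule has_sum_finite_neutralI[of "{\<alpha>}"]) auto
qed

text \<open>Completeness of the Banach algebra, in a form that admits any index set. It is the only place
  where double series are rearranged: products, compositions and limits are obtained by expanding them into
  families of functions whose bounds have a finite sum.\<close>

lemma mpowser_sum:
  fixes f :: "'j \<Rightarrow> 'k::{real_normed_field, euclidean_space} ^ 'n::finite \<Rightarrow> 'k"
  assumes r: "r > 0"
    and f: "\<And>j. j \<in> J \<Longrightarrow> mpowser_le r (M j) (f j)"
    and M: "M summable_on J"
    and g: "\<And>x. x \<in> polydisc r \<Longrightarrow> ((\<lambda>j. f j x) has_sum g x) J"
  shows "mpowser_le r (infsum M J) g"
proof -
  obtain c where c: "\<And>j. j \<in> J \<Longrightarrow> (\<lambda>\<alpha>. norm (c j \<alpha>) * r ^ mdeg \<alpha>) summable_on UNIV"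
    "\<And>j. j \<in> J \<Longrightarrow> (\<Sum>\<^sub>\<infinity>\<alpha>. norm (c j \<alpha>) * r ^ mdeg \<alpha>) \<le> M j"
    "\<And>j x. j \<in> J \<Longrightarrow> x \<in> polydisc r \<Longrightarrow> ((\<lambda>\<alpha>. c j \<alpha> * monomial \<alpha> x) has_sum f j x) UNIV"
    proof -
    have "\<forall>j. \<exists>c. j \<in> J \<longrightarrow> coeff_weights r c summable_on UNIV \<and>
       (coeff_norm r c) \<le> M j \<and>
       (\<forall>x\<in>polydisc r. (power_terms c x has_sum f j x) UNIV)"
      using f unfolding mpowser_le_def by blast
    from choice[OF this] show ?thesis using that by blast
  qed
  define N where "N j = (\<Sum>\<^sub>\<infinity>\<alpha>. norm (c j \<alpha>) * r ^ mdeg \<alpha>)" for j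
  have N0: "N j \<ge> 0" for j unfolding N_def using r by (intro infsum_nonneg) auto
  have Ns: "N summable_on J"
    by (rule summable_on_comparison_test[OF M]) (use c(2) N0 in \<open>auto simp: N_def\<close>)
  have abs: "(\<lambda>(j,\<alpha>). norm (c j \<alpha>) * r ^ mdeg \<alpha>) summable_on J \<times> UNIV"
    by (rule summable_on_SigmaI[where g = N]) (use c(1) Ns r in \<open>auto simp: N_def\<close>)
  have abs': "(\<lambda>(\<alpha>,j). norm (c j \<alpha>) * r ^ mdeg \<alpha>) summable_on UNIV \<times> J"
    using abs by (subst (asm) summable_on_swap) simp
  have tot: "(\<Sum>\<^sub>\<infinity>(j,\<alpha>)\<in>J \<times> UNIV. norm (c j \<alpha>) * r ^ mdeg \<alpha>) = infsum N J"
    using infsum_Sigma'_banach[OF abs] by (simp add: N_def[abs_def])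
  have sj: "(\<lambda>j. norm (c j \<alpha>) * r ^ mdeg \<alpha>) summable_on J" for \<alpha>
    using summable_on_SigmaD1[OF abs', of \<alpha>] by simp
  have sj': "(\<lambda>j. norm (c j \<alpha>)) summable_on J" for \<alpha>
    using sj[of \<alpha>] r summable_on_cmult_left'[of "r ^ mdeg \<alpha>" "\<lambda>j. norm (c j \<alpha>)" J] by simp
  have sc: "(\<lambda>j. c j \<alpha>) summable_on J" for \<alpha>
    using sj'[of \<alpha>] by (rule abs_summable_summable)
  define d where "d \<alpha> = (\<Sum>\<^sub>\<infinity>j\<in>J. c j \<alpha>)" for \<alpha>
  define D where "D \<alpha> = (\<Sum>\<^sub>\<infinity>j\<in>J. norm (c j \<alpha>) * r ^ mdeg \<alpha>)" for \<alpha>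
  have Ds: "D summable_on UNIV" "infsum D UNIV = infsum N J"
    using summable_on_Sigma_banach[OF abs'] infsum_swap_banach[OF abs'] 
    by (simp_all add: D_def[abs_def] N_def[abs_def])
  have dD: "norm (d \<alpha>) * r ^ mdeg \<alpha> \<le> D \<alpha>" for \<alpha>
    unfolding d_def D_def using sj'[of \<alpha>] norm_infsum_bound[of "\<lambda>j. c j \<alpha>" J] r
    by (simp add: infsum_cmult_left')
  have ds: "coeff_weights r d summable_on UNIV"
    by (rule summable_on_comparison_test[OF Ds(1)]) (use dD r in auto)
  show ?thesis unfolding mpowser_le_def
  proof (intro exI[of _ d] conjI ballI)
    show "coeff_weights r d summable_on UNIV" by (rule ds)
    have "(coeff_norm r d) \<le> infsum D UNIV"
      by (rule infsum_mono[OF ds Ds(1)]) (rule dD)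
    also have "\<dots> \<le> infsum M J" unfolding Ds(2)
      by (rule infsum_mono[OF Ns M]) (simp add: N_def c(2))
    finally show "(coeff_norm r d) \<le> infsum M J" .
    fix x :: "'k ^ 'n" assume x: "x \<in> polydisc r"
    have "(\<lambda>p. norm (case p of (j,\<alpha>) \<Rightarrow> c j \<alpha> * monomial \<alpha> x)) summable_on J \<times> UNIV"
      by (rule Infinite_Sum.abs_summable_on_comparison_test'[OF abs])
        (use norm_monomial_le[OF x] in \<open>auto simp: norm_mult intro!: mult_left_mono\<close>)
    then have s: "(\<lambda>(j,\<alpha>). c j \<alpha> * monomial \<alpha> x) summable_on J \<times> UNIV"
      by (rule abs_summable_summable)
    then obtain S where S: "((\<lambda>(j,\<alpha>). c j \<alpha> * monomial \<alpha> x) has_sum S) (J \<times> UNIV)"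
      by (auto simp: summable_on_def)
    have "((\<lambda>j. f j x) has_sum S) J"
      using has_sum_SigmaD[OF S, of "\<lambda>j. f j x"] c(3)[OF _ x] by simp
    then have "S = g x" using g[OF x] has_sum_unique by blast
    moreover have S': "((\<lambda>(\<alpha>,j). c j \<alpha> * monomial \<alpha> x) has_sum S) (UNIV \<times> J)"
      using S by (subst (asm) has_sum_swap) simp
    have "((\<lambda>j. c j \<alpha> * monomial \<alpha> x) has_sum d \<alpha> * monomial \<alpha> x) J" for \<alpha>
      unfolding d_def by (intro has_sum_cmult_left has_sum_infsum sc)
    then have "(power_terms d x has_sum S) UNIV"
      using has_sum_SigmaD[OF S', of "\<lambda>\<alpha>. d \<alpha> * monomial \<alpha> x"] by simp
    ultimately show "(power_terms d x has_sum g x) UNIV" by simp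
  qed
qed

lemma mpowser_const: "0 \<le> r \<Longrightarrow> mpowser_le r (norm a) (\<lambda>_. a)"
  using mpowser_monomial[of r a "\<lambda>_. 0"] by (simp add: monomial_def mdeg_def)

lemma mpowser_coord: "0 \<le> r \<Longrightarrow> mpowser_le r r (\<lambda>x. x $ i)"
  using mpowser_monomial[of r 1 "\<lambda>j. if j = i then 1 else 0"]
  by (simp add: monomial_def mdeg_def if_distrib[of "power _"] cong: if_cong)

lemma mpowser_add:
  assumes r: "r > 0" and "mpowser_le r M f" "mpowser_le r N g"
  shows "mpowser_le r (M + N) (\<lambda>x. f x + g x)"
proof -
  have "mpowser_le r (infsum (\<lambda>b. if b then M else N) UNIV) (\<lambda>x. f x + g x)"
    by (rule mpowser_sum[where f = "\<lambda>b. if b then f else g"])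
      (use assms in \<open>auto simp: UNIV_bool add.commute intro!: has_sum_finiteI\<close>)
  then show ?thesis by (simp add: UNIV_bool add.commute)
qed

lemma mpowser_mult:
  assumes r: "r > 0" and f: "mpowser_le r M f" and g: "mpowser_le r N g"
  shows "mpowser_le r (M * N) (\<lambda>x. f x * g x)"
proof -
  obtain c where c: "coeff_weights r c summable_on UNIV"
    "(coeff_norm r c) \<le> M"
    "\<And>x. x \<in> polydisc r \<Longrightarrow> (power_terms c x has_sum f x) UNIV"
    using mpowserE[OF f] by blast
  obtain d where d: "coeff_weights r d summable_on UNIV"
    "(coeff_norm r d) \<le> N"
    "\<And>x. x \<in> polydisc r \<Longrightarrow> (power_terms d x has_sum g x) UNIV"
    using mpowserE[OF g] by blast
  let ?C = "\<Sum>\<^sub>\<infinity>\<alpha>. norm (c \<alpha>) * r ^ mdeg \<alpha>" and ?D = "\<Sum>\<^sub>\<infinity>\<alpha>. norm (d \<alpha>) * r ^ mdeg \<alpha>"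
  have D0: "?D \<ge> 0" "?C \<ge> 0" using r by (auto intro!: infsum_nonneg)
  have 1: "mpowser_le r (norm (c \<alpha>) * r ^ mdeg \<alpha> * ?D) (\<lambda>x. (c \<alpha> * monomial \<alpha> x) * g x)" for \<alpha>
  proof -
    have e: "norm (c \<alpha> * d \<beta>) * r ^ mdeg (\<lambda>i. \<alpha> i + \<beta> i) = norm (c \<alpha>) * r ^ mdeg \<alpha> * (norm (d \<beta>) * r ^ mdeg \<beta>)" for \<beta>
      by (simp add: mdeg_add power_add norm_mult)
    have "mpowser_le r (\<Sum>\<^sub>\<infinity>\<beta>. norm (c \<alpha> * d \<beta>) * r ^ mdeg (\<lambda>i. \<alpha> i + \<beta> i)) (\<lambda>x. (c \<alpha> * monomial \<alpha> x) * g x)"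
    proof (rule mpowser_sum[OF r])
      show "mpowser_le r (norm (c \<alpha> * d \<beta>) * r ^ mdeg (\<lambda>i. \<alpha> i + \<beta> i)) (\<lambda>x. (c \<alpha> * d \<beta>) * monomial (\<lambda>i. \<alpha> i + \<beta> i) x)" for \<beta>
        using r by (intro mpowser_monomial) simp
      show "(\<lambda>\<beta>. norm (c \<alpha> * d \<beta>) * r ^ mdeg (\<lambda>i. \<alpha> i + \<beta> i)) summable_on UNIV"
        unfolding e by (intro summable_on_cmult_right d)
      fix x :: "'a ^ 'b" assume x: "x \<in> polydisc r"
      show "((\<lambda>\<beta>. c \<alpha> * d \<beta> * monomial (\<lambda>i. \<alpha> i + \<beta> i) x) has_sum c \<alpha> * monomial \<alpha> x * g x) UNIV"
        using has_sum_cmult_right[OF d(3)[OF x], of "c \<alpha> * monomial \<alpha> x"]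
        by (simp add: monomial_add mult_ac)
    qed
    then show ?thesis unfolding e by (simp add: infsum_cmult_right')
  qed
  have "mpowser_le r (\<Sum>\<^sub>\<infinity>\<alpha>. norm (c \<alpha>) * r ^ mdeg \<alpha> * ?D) (\<lambda>x. f x * g x)"
    by (rule mpowser_sum[OF r 1]) (auto intro!: summable_on_cmult_left has_sum_cmult_left c)
  then have "mpowser_le r (?C * ?D) (\<lambda>x. f x * g x)" by (simp add: infsum_cmult_left')
  then show ?thesis
    by (rule mpowser_mono) (use c d D0 in \<open>intro mult_mono, auto\<close>)
qed

lemma mpowser_shrink_radius:
  assumes f: "mpowser_le r M f" and s: "0 < s" "s \<le> r"
  shows "mpowser_le s M f"
proof -
  obtain c where c: "coeff_weights r c summable_on UNIV"
    "(coeff_norm r c) \<le> M"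
    "\<And>x. x \<in> polydisc r \<Longrightarrow> (power_terms c x has_sum f x) UNIV"
    using mpowserE[OF f] by blast
  have le: "norm (c \<alpha>) * s ^ mdeg \<alpha> \<le> norm (c \<alpha>) * r ^ mdeg \<alpha>" for \<alpha>
    using s by (intro mult_left_mono power_mono) auto
  have sm: "coeff_weights s c summable_on UNIV"
    by (rule summable_on_comparison_test[OF c(1)]) (use le s in auto)
  show ?thesis unfolding mpowser_le_def
    by (rule exI[of _ c]) (use sm c infsum_mono[OF sm c(1) le] polydisc_mono[OF s(2)] in force)
qed

lemma mpowser_bound:
  assumes "mpowser_le r M f" "x \<in> polydisc r"
  shows "norm (f x) \<le> M"
proof -
  obtain c where c: "coeff_weights r c summable_on UNIV"
    "(coeff_norm r c) \<le> M"
    "(power_terms c x has_sum f x) UNIV"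
    using mpowserE[OF assms(1)] assms(2) by blast
  have "norm (f x) \<le> (coeff_norm r c)"
    by (rule norm_infsum_le[OF c(3) has_sum_infsum[OF c(1)]])
      (use norm_monomial_le[OF assms(2)] in \<open>auto simp: norm_mult intro!: mult_left_mono\<close>)
  with c(2) show ?thesis by simp
qed

lemma mpowser_coeff_0:
  assumes r: "r > 0" and h: "\<And>x. x \<in> polydisc r \<Longrightarrow> (power_terms c x has_sum f x) UNIV"
  shows "c (\<lambda>_. 0) = f (0 :: 'k::{real_normed_field, euclidean_space} ^ 'n::finite)"
proof -
  have "((\<lambda>\<alpha>. c \<alpha> * monomial \<alpha> (0 :: 'k ^ 'n)) has_sum c (\<lambda>_. 0)) UNIV"
    by (rule has_sum_finite_neutralI[of "{\<lambda>_. 0}"]) (auto simp: monomial_zero_eq)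
  then show ?thesis using h[of 0] r has_sum_unique by (auto simp: less_imp_le)
qed

text \<open>Without a constant term, every term gains at least one factor \<open>s / r\<close> when the radius shrinks
  from \<open>r\<close> to \<open>s\<close>. This is the source of all smallness.\<close>

lemma mpowser_shrink:
  assumes f: "mpowser_le r M f" and r: "0 < s" "s \<le> r" and 0: "f 0 = 0"
  shows "mpowser_le s (s / r * M) f"
proof -
  obtain c where c: "coeff_weights r c summable_on UNIV"
    "(coeff_norm r c) \<le> M"
    "\<And>x. x \<in> polydisc r \<Longrightarrow> (power_terms c x has_sum f x) UNIV"
    using mpowserE[OF f] by blast
  have c0: "c (\<lambda>_. 0) = 0" using mpowser_coeff_0[of r c f] c(3) r 0 by auto
  have le: "norm (c \<alpha>) * s ^ mdeg \<alpha> \<le> s / r * (norm (c \<alpha>) * r ^ mdeg \<alpha>)" for \<alpha>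
  proof (cases "mdeg \<alpha>")
    case 0
    then show ?thesis using c0 by (simp add: mdeg_eq_0_iff)
  next
    case (Suc k)
    have "s ^ k \<le> r ^ k" using r by (intro power_mono) auto
    then show ?thesis unfolding Suc using r by (auto simp: field_simps intro!: mult_right_mono)
  qed
  have sm': "(\<lambda>\<alpha>. s / r * (norm (c \<alpha>) * r ^ mdeg \<alpha>)) summable_on UNIV"
    by (intro summable_on_cmult_right c)
  have sm: "coeff_weights s c summable_on UNIV"
    by (rule summable_on_comparison_test[OF sm']) (use le r in auto)
  have "(coeff_norm s c) \<le> s / r * (coeff_norm r c)"
    using infsum_mono[OF sm sm' le] unfolding infsum_cmult_right' .
  also have "\<dots> \<le> s / r * M" using c(2) r by (intro mult_left_mono) auto
  finally show ?thesis unfolding mpowser_le_def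
    using sm c polydisc_mono[OF r(2)] by (intro exI[of _ c]) force
qed

lemma mpowser_power: "r > 0 \<Longrightarrow> mpowser_le r M f \<Longrightarrow> mpowser_le r (M ^ k) (\<lambda>x. f x ^ k)"
  by (induction k) (use mpowser_const[of r 1] in \<open>auto intro: mpowser_mult\<close>)

lemma mpowser_prod: "finite S \<Longrightarrow> r > 0 \<Longrightarrow> (\<And>i. i \<in> S \<Longrightarrow> mpowser_le r (M i) (f i)) \<Longrightarrow> mpowser_le r (\<Prod>i\<in>S. M i) (\<lambda>x. \<Prod>i\<in>S. f i x)"
  by (induction rule: finite_induct) (use mpowser_const[of r 1] in \<open>auto intro: mpowser_mult\<close>)

text \<open>Expand \<open>f\<close> into monomials; each of them, evaluated at \<open>\<phi>\<close>, is bounded by the corresponding power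
  of \<open>R\<close>.\<close>

lemma mpowser_compose:
  assumes f: "mpowser_le R N f" and r: "r > 0" and \<phi>: "\<And>i. mpowser_le r R (\<lambda>x. \<phi> x $ i)"
  shows "mpowser_le r N (\<lambda>x. f (\<phi> x))"
proof -
  obtain c where c: "coeff_weights R c summable_on UNIV"
    "(coeff_norm R c) \<le> N"
    "\<And>x. x \<in> polydisc R \<Longrightarrow> (power_terms c x has_sum f x) UNIV"
    using mpowserE[OF f] by blast
  have "mpowser_le r (coeff_norm R c) (\<lambda>x. f (\<phi> x))"
  proof (rule mpowser_sum[OF r _ c(1)])
    fix \<alpha>
    have "mpowser_le r (\<Prod>i\<in>UNIV. R ^ \<alpha> i) (\<lambda>x. monomial \<alpha> (\<phi> x))"
      unfolding monomial_def by (intro mpowser_prod mpowser_power \<phi> r) auto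
    then have "mpowser_le r (R ^ mdeg \<alpha>) (\<lambda>x. monomial \<alpha> (\<phi> x))"
      by (simp add: mdeg_def power_sum)
    then show "mpowser_le r (norm (c \<alpha>) * R ^ mdeg \<alpha>) (\<lambda>x. c \<alpha> * monomial \<alpha> (\<phi> x))"
      using r by (intro mpowser_mult mpowser_const) auto
  next
    fix x :: "'a ^ 'c" assume "x \<in> polydisc r"
    then have "\<phi> x \<in> polydisc R" using mpowser_bound[OF \<phi>] by (auto simp: polydisc_def)
    then show "((\<lambda>\<alpha>. c \<alpha> * monomial \<alpha> (\<phi> x)) has_sum f (\<phi> x)) UNIV" by (rule c(3))
  qed
  then show ?thesis by (rule mpowser_mono) (rule c(2))
qed

lemma mpowser_compose_powser:
  assumes r: "r > 0" and f: "mpowser_le r M f" and M: "M \<ge> 0"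
    and a: "summable (\<lambda>k. norm (a k) * M ^ k)"
    and g: "\<And>z. norm z \<le> M \<Longrightarrow> (\<lambda>k. a k * z ^ k) sums g z"
  shows "mpowser_le r (\<Sum>k. norm (a k) * M ^ k) (\<lambda>x. g (f x))"
proof -
  have hs: "((\<lambda>k. norm (a k) * M ^ k) has_sum (\<Sum>k. norm (a k) * M ^ k)) UNIV"
    using a M by (intro sums_nonneg_imp_has_sum) (auto intro: summable_sums)
  have "mpowser_le r (\<Sum>\<^sub>\<infinity>k. norm (a k) * M ^ k) (\<lambda>x. g (f x))"
  proof (rule mpowser_sum[OF r])
    show "mpowser_le r (norm (a k) * M ^ k) (\<lambda>x. a k * f x ^ k)" for k
      using r f by (intro mpowser_mult mpowser_const mpowser_power) auto
    show "(\<lambda>k. norm (a k) * M ^ k) summable_on UNIV" using hs by (rule has_sum_imp_summable)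
    fix x :: "'a ^ 'b" assume "x \<in> polydisc r"
    then have b: "norm (f x) \<le> M" by (rule mpowser_bound[OF f])
    show "((\<lambda>k. a k * f x ^ k) has_sum g (f x)) UNIV"
    proof (rule norm_summable_imp_has_sum[OF _ g[OF b]])
      show "summable (\<lambda>k. norm (a k * f x ^ k))"
        by (rule summable_comparison_test'[OF a, of 0])
          (use b in \<open>auto simp: norm_mult norm_power intro!: mult_left_mono power_mono\<close>)
    qed
  qed
  then show ?thesis using infsumI[OF hs] by simp
qed

lemma mpowser_exp:
  assumes r: "r > 0" and f: "mpowser_le r M f" and M: "M \<ge> 0"
  shows "mpowser_le r (exp M) (\<lambda>x. exp (f x))"
proof -
  have 1: "(\<lambda>k. norm (inverse (fact k) :: 'a) * M ^ k) sums exp M"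
    using exp_converges[of M] by (simp add: norm_inverse divide_inverse mult.commute)
  have "(\<lambda>k. inverse (fact k) * z ^ k) sums exp z" for z :: 'a
    using exp_converges[of z] by (simp add: scaleR_conv_of_real of_real_inverse)
  from mpowser_compose_powser[OF r f M sums_summable[OF 1] this] sums_unique[OF 1] show ?thesis by simp
qed

lemma mpowser_exp_minus_1:
  assumes r: "r > 0" and f: "mpowser_le r M f" and M: "M \<ge> 0"
  shows "mpowser_le r (exp M - 1) (\<lambda>x. exp (f x) - 1)"
proof -
  let ?a = "\<lambda>k. if k = 0 then 0 else inverse (fact k)"
  have 1: "(\<lambda>k. norm (?a k :: 'a) * M ^ k) sums (exp M - 1)"
  proof -
    have "(\<lambda>k. M ^ k /\<^sub>R fact k - (if k = 0 then 1 else 0)) sums (exp M - 1)"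
      by (intro sums_diff exp_converges) (use sums_If_finite_set[of "{0}" "\<lambda>_. 1 :: real"] in simp)
    also have "(\<lambda>k. M ^ k /\<^sub>R fact k - (if k = 0 then 1 else 0)) = (\<lambda>k. norm (?a k :: 'a) * M ^ k)"
      by (auto simp: norm_inverse divide_inverse mult.commute)
    finally show ?thesis .
  qed
  have 2: "(\<lambda>k. ?a k * z ^ k) sums (exp z - 1)" for z :: 'a
  proof -
    have "(\<lambda>k. z ^ k /\<^sub>R fact k - (if k = 0 then 1 else 0)) sums (exp z - 1)"
      by (intro sums_diff exp_converges) (use sums_If_finite_set[of "{0}" "\<lambda>_. 1 :: 'a"] in simp)
    also have "(\<lambda>k. z ^ k /\<^sub>R fact k - (if k = 0 then 1 else 0)) = (\<lambda>k. ?a k * z ^ k)"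
      by (auto simp: scaleR_conv_of_real of_real_inverse)
    finally show ?thesis .
  qed
  from mpowser_compose_powser[OF r f M sums_summable[OF 1] 2] sums_unique[OF 1] show ?thesis by simp
qed

section \<open>Analytic germs and their derivatives\<close>

lemma summable_on_imp_bounded:
  fixes f :: "'a \<Rightarrow> 'b::real_normed_vector"
  assumes "f summable_on UNIV"
  obtains K where "\<And>a. norm (f a) \<le> K"
proof -
  obtain S where S: "(f has_sum S) UNIV" using assms by (auto simp: summable_on_def)
  then have "\<forall>\<^sub>F X in finite_subsets_at_top UNIV. dist (sum f X) S < 1"
    unfolding has_sum_def by (rule tendstoD) simp
  then obtain X where X: "finite X" "\<And>Y. finite Y \<Longrightarrow> X \<subseteq> Y \<Longrightarrow> dist (sum f Y) S < 1"
    unfolding eventually_finite_subsets_at_top by auto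
  have "norm (f a) \<le> 2 + (\<Sum>a\<in>X. norm (f a))" for a
  proof (cases "a \<in> X")
    case True
    then show ?thesis using member_le_sum[of a X "\<lambda>a. norm (f a)"] X(1) by auto
  next
    case False
    then have "f a = sum f (insert a X) - sum f X" using X(1) by simp
    then have "norm (f a) = dist (sum f (insert a X)) (sum f X)" by (simp add: dist_norm)
    also have "\<dots> \<le> dist (sum f (insert a X)) S + dist (sum f X) S"
      by (rule dist_triangle2)
    also have "\<dots> < 1 + 1" using X by (intro add_strict_mono) auto
    finally show ?thesis using sum_nonneg[of X "\<lambda>a. norm (f a)"] by simp
  qed
  then show ?thesis by (rule that)
qed

text \<open>Sums over a box of exponents factor into finite geometric sums, one for each coordinate.\<close>

lemma summable_on_geometric_multiindex:
  "(\<lambda>\<alpha>::'n::finite \<Rightarrow> nat. (1/2::real) ^ mdeg \<alpha>) summable_on UNIV"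
proof (rule nonneg_bdd_above_summable_on)
  show "bdd_above (sum (\<lambda>\<alpha>::'n \<Rightarrow> nat. (1/2::real) ^ mdeg \<alpha>) ` {F. F \<subseteq> UNIV \<and> finite F})"
  proof (rule bdd_aboveI2)
    fix F :: "('n \<Rightarrow> nat) set" assume "F \<in> {F. F \<subseteq> UNIV \<and> finite F}"
    then have F: "finite F" by simp
    define N where "N = (\<Sum>\<alpha>\<in>F. mdeg \<alpha>)"
    have N: "\<alpha> i \<le> N" if "\<alpha> \<in> F" for \<alpha> i
      using member_le_sum[of i UNIV \<alpha>] member_le_sum[of \<alpha> F mdeg] that F
      by (fastforce simp: N_def mdeg_def)
    have "(\<Sum>\<alpha>\<in>F. (1/2::real) ^ mdeg \<alpha>) \<le> (\<Sum>\<alpha>\<in>PiE (UNIV :: 'n set) (\<lambda>_. {..N}). (1/2::real) ^ mdeg \<alpha>)"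
      by (rule sum_mono2) (use N in \<open>auto intro!: finite_PiE\<close>)
    also have "\<dots> = (\<Prod>i\<in>(UNIV :: 'n set). \<Sum>k\<le>N. (1/2::real) ^ k)"
      by (subst prod_sum_PiE) (auto simp: mdeg_def power_sum)
    also have "\<dots> \<le> (\<Prod>i\<in>(UNIV :: 'n set). 2)"
    proof (rule prod_mono, intro conjI)
      show "0 \<le> (\<Sum>k\<le>N. (1/2::real) ^ k)" by (intro sum_nonneg) auto
      have "(\<Sum>k\<le>N. (1/2::real) ^ k) = 2 * (1 - (1/2) ^ Suc N)"
        using sum_gp0[of "1/2::real" N] by simp
      then show "(\<Sum>k\<le>N. (1/2::real) ^ k) \<le> 2" by simp
    qed
    finally show "(\<Sum>\<alpha>\<in>F. (1/2::real) ^ mdeg \<alpha>) \<le> (\<Prod>i\<in>(UNIV :: 'n set). 2)" .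
  qed
qed auto

text \<open>Convergence at one point with equal nonzero coordinates bounds the terms there; halving the radius
  then gives absolute convergence with a geometric majorant.\<close>

lemma analytic_at_0_iff_mpowser:
  fixes f :: "'k::{real_normed_field, euclidean_space} ^ 'n::finite \<Rightarrow> 'k"
  shows "analytic_at_0 f \<longleftrightarrow> (\<exists>r>0. \<exists>M. mpowser_le r M f)"
proof
  assume "analytic_at_0 f"
  then obtain c r where r: "r > 0"
    and c: "\<And>x. x \<in> ball 0 r \<Longrightarrow> (power_terms c x has_sum f x) UNIV"
    unfolding analytic_at_0_def monomial_def by blast
  define s where "s = r / (2 * real CARD('n))"
  have s: "s > 0" using r by (simp add: s_def)
  have ball: "x \<in> ball 0 r" if "x \<in> polydisc s" for x :: "'k ^ 'n"
  proof -
    have "norm x \<le> (\<Sum>i\<in>UNIV. norm (x $ i))"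
      unfolding norm_vec_def by (rule L2_set_le_sum) simp
    also have "\<dots> \<le> (\<Sum>i\<in>(UNIV :: 'n set). s)"
      using that by (intro sum_mono) (auto simp: polydisc_def)
    also have "\<dots> < r" using r by (simp add: s_def)
    finally show ?thesis by simp
  qed
  let ?x = "(\<chi> i. of_real s) :: 'k ^ 'n"
  have mx: "monomial \<alpha> ?x = of_real (s ^ mdeg \<alpha>)" for \<alpha>
    by (simp add: monomial_def mdeg_def power_sum)
  have "?x \<in> polydisc s" using s by (simp add: polydisc_def)
  then have "power_terms c ?x summable_on UNIV"
    by (intro has_sum_imp_summable[OF c] ball)
  then obtain K where K: "\<And>\<alpha>. norm (c \<alpha> * monomial \<alpha> ?x) \<le> K"
    by (rule summable_on_imp_bounded) blast
  have le: "norm (c \<alpha>) * (s/2) ^ mdeg \<alpha> \<le> K * (1/2) ^ mdeg \<alpha>" for \<alpha>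
    using mult_right_mono[OF K[of \<alpha>], of "(1/2) ^ mdeg \<alpha>"] s
    by (simp add: mx norm_mult power_divide norm_power)
  have sm: "(\<lambda>\<alpha>. norm (c \<alpha>) * (s/2) ^ mdeg \<alpha>) summable_on UNIV"
    by (rule summable_on_comparison_test[OF summable_on_cmult_right[OF summable_on_geometric_multiindex]])
      (use le s in auto)
  have "mpowser_le (s/2) (\<Sum>\<^sub>\<infinity>\<alpha>. norm (c \<alpha>) * (s/2) ^ mdeg \<alpha>) f"
    unfolding mpowser_le_def using sm c ball polydisc_mono[of "s/2" s] s
    by (intro exI[of _ c]) auto
  then show "\<exists>r>0. \<exists>M. mpowser_le r M f" using s by (intro exI[of _ "s/2"]) auto
next
  assume "\<exists>r>0. \<exists>M. mpowser_le r M f"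
  then obtain r M where r: "r > 0" and "mpowser_le r M f" by blast
  then obtain c where c: "\<And>x. x \<in> polydisc r \<Longrightarrow> (power_terms c x has_sum f x) UNIV"
    using mpowserE by blast
  have "x \<in> polydisc r" if "x \<in> ball 0 r" for x :: "'k ^ 'n"
    using that Finite_Cartesian_Product.norm_nth_le[of x] by (auto simp: polydisc_def intro: order_trans less_imp_le)
  then show "analytic_at_0 f" unfolding analytic_at_0_def monomial_def[symmetric]
    using r c by blast
qed

lemma has_sum_finite_sum:
  fixes f :: "'i \<Rightarrow> 'a \<Rightarrow> 'b::real_normed_vector"
  assumes "\<And>i. i \<in> I \<Longrightarrow> (f i has_sum s i) A"
  shows "((\<lambda>x. \<Sum>i\<in>I. f i x) has_sum (\<Sum>i\<in>I. s i)) A"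
  using assms by (induction I rule: infinite_finite_induct) (auto intro: has_sum_add)

definition open_polydisc :: "real \<Rightarrow> ('k::real_normed_vector ^ 'n) set" where
  "open_polydisc r = {x. \<forall>i. norm (x $ i) < r}"

lemma open_open_polydisc: "open (open_polydisc r :: ('k::real_normed_vector ^ 'n::finite) set)"
  unfolding open_polydisc_def Collect_all_eq
  by (intro open_INT ballI open_Collect_less continuous_intros) auto

lemma open_polydisc_subset_polydisc: "open_polydisc r \<subseteq> polydisc r"
  by (auto simp: open_polydisc_def polydisc_def less_imp_le)

lemma polydisc_subset_open_polydisc: "s < r \<Longrightarrow> polydisc s \<subseteq> open_polydisc r"
  by (auto simp: open_polydisc_def polydisc_def intro: le_less_trans)

lemma zero_in_open_polydisc [simp]: "0 < r \<Longrightarrow> 0 \<in> open_polydisc r"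
  by (simp add: open_polydisc_def)

lemma convex_polydisc: "convex (polydisc r :: ('k::real_normed_vector ^ 'n) set)"
proof (rule convexI)
  fix x y :: "'k ^ 'n" and u v :: real
  assume *: "x \<in> polydisc r" "y \<in> polydisc r" "0 \<le> u" "0 \<le> v" "u + v = 1"
  have "norm ((u *\<^sub>R x + v *\<^sub>R y) $ i) \<le> r" for i
  proof -
    have "norm ((u *\<^sub>R x + v *\<^sub>R y) $ i) \<le> u * norm (x $ i) + v * norm (y $ i)"
      using norm_triangle_ineq[of "u *\<^sub>R (x $ i)" "v *\<^sub>R (y $ i)"] * by simp
    also have "\<dots> \<le> u * r + v * r"
      using * by (intro add_mono mult_left_mono) (auto simp: polydisc_def)
    finally show ?thesis using * by (metis distrib_right mult_1)
  qed
  then show "u *\<^sub>R x + v *\<^sub>R y \<in> polydisc r" by (simp add: polydisc_def)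
qed

text \<open>The exponent of a partial derivative of a monomial. For \<open>\<alpha> i = 0\<close> the truncated subtraction is
  harmless, because the term carries the factor \<open>\<alpha> i\<close>.\<close>

abbreviation lower_exponent :: "'n \<Rightarrow> ('n \<Rightarrow> nat) \<Rightarrow> 'n \<Rightarrow> nat" where
  "lower_exponent i \<alpha> \<equiv> \<alpha>(i := \<alpha> i - 1)"

lemma monomial_lower: "of_nat (\<alpha> i) * (x $ i * monomial (lower_exponent i \<alpha>) x) = of_nat (\<alpha> i) * monomial \<alpha> (x :: 'k::comm_semiring_1 ^ 'n::finite)"
proof (cases "\<alpha> i")
  case (Suc k)
  have "monomial \<alpha> x = (x $ i) ^ \<alpha> i * (\<Prod>j\<in>UNIV-{i}. (x $ j) ^ \<alpha> j)"
    unfolding monomial_def by (subst prod.remove[of UNIV i]) auto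
  moreover have "monomial (lower_exponent i \<alpha>) x = (x $ i) ^ (\<alpha> i - 1) * (\<Prod>j\<in>UNIV-{i}. (x $ j) ^ \<alpha> j)"
    unfolding monomial_def by (subst prod.remove[of UNIV i]) auto
  ultimately show ?thesis using Suc by (simp add: mult_ac)
qed simp

lemma mdeg_lower: "\<alpha> i > 0 \<Longrightarrow> Suc (mdeg (lower_exponent i \<alpha>)) = mdeg (\<alpha> :: 'n::finite \<Rightarrow> nat)"
  unfolding mdeg_def by (subst (1 2) sum.remove[of UNIV i]) auto

lemma has_derivative_monomial:
  fixes x :: "'k::real_normed_field ^ 'n::finite"
  shows "(monomial \<alpha> has_derivative (\<lambda>v. \<Sum>i\<in>UNIV. v $ i * (of_nat (\<alpha> i) * monomial (lower_exponent i \<alpha>) x))) (at x within S)"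
proof -
  have "((\<lambda>x. \<Prod>i\<in>UNIV. (x $ i) ^ \<alpha> i) has_derivative
     (\<lambda>v. \<Sum>i\<in>UNIV. (of_nat (\<alpha> i) * v $ i * (x $ i) ^ (\<alpha> i - 1)) * (\<Prod>j\<in>UNIV-{i}. (x $ j) ^ \<alpha> j))) (at x within S)"
    by (intro has_derivative_prod has_derivative_power bounded_linear.has_derivative[OF bounded_linear_vec_nth] has_derivative_ident)
  also have "(\<lambda>v. \<Sum>i\<in>UNIV. (of_nat (\<alpha> i) * v $ i * (x $ i) ^ (\<alpha> i - 1)) * (\<Prod>j\<in>UNIV-{i}. (x $ j) ^ \<alpha> j)) =
     (\<lambda>v. \<Sum>i\<in>UNIV. v $ i * (of_nat (\<alpha> i) * monomial (lower_exponent i \<alpha>) x))"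
  proof (intro ext sum.cong refl)
    fix v :: "'k ^ 'n" and i
    have "monomial (lower_exponent i \<alpha>) x = (x $ i) ^ (\<alpha> i - 1) * (\<Prod>j\<in>UNIV-{i}. (x $ j) ^ \<alpha> j)"
      unfolding monomial_def by (subst prod.remove[of UNIV i]) auto
    then show "(of_nat (\<alpha> i) * v $ i * (x $ i) ^ (\<alpha> i - 1)) * (\<Prod>j\<in>UNIV-{i}. (x $ j) ^ \<alpha> j) =
      v $ i * (of_nat (\<alpha> i) * monomial (lower_exponent i \<alpha>) x)" by (simp add: mult_ac)
  qed
  finally show ?thesis unfolding monomial_def[abs_def] .
qed

text \<open>Differentiation costs a factor \<open>k\<close> in degree \<open>k\<close>, which is absorbed by passing from \<open>s\<close> to a
  larger radius \<open>r\<close> (Bernoulli's inequality).\<close>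

lemma exponent_times_power_le:
  fixes s r :: real
  assumes "0 < s" "s < r"
  shows "of_nat k * s ^ (k - 1) \<le> r ^ k / (r - s)"
proof (cases k)
  case (Suc m)
  have "1 + of_nat k * ((r - s) / s) \<le> (1 + (r - s) / s) ^ k"
    using assms by (intro Bernoulli_inequality) (auto simp: field_simps)
  also have "1 + (r - s) / s = r / s" using assms by (simp add: field_simps)
  finally have "of_nat k * ((r - s) / s) \<le> r ^ k / s ^ k" by (simp add: power_divide)
  then have "of_nat k * ((r - s) / s) * s ^ k \<le> r ^ k"
    using assms by (simp add: pos_le_divide_eq)
  moreover have "of_nat k * ((r - s) / s) * s ^ k = of_nat k * s ^ (k - 1) * (r - s)"
    using assms Suc by (simp add: field_simps)
  ultimately show ?thesis using assms by (simp add: pos_le_divide_eq)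
qed (use assms in simp)

text \<open>Term-by-term differentiation. The coefficients of the derivative are kept in the conclusion because
  the Euler equation is solved by comparing coefficients.\<close>

lemma mpowser_has_derivative:
  fixes c :: "('n::finite \<Rightarrow> nat) \<Rightarrow> 'k::{real_normed_field, euclidean_space}"
  assumes c: "coeff_weights r c summable_on UNIV"
    and f: "\<And>x. x \<in> polydisc r \<Longrightarrow> (power_terms c x has_sum f x) UNIV"
    and s: "0 < s" "s < r"
  obtains g N where "\<And>i. mpowser_le s N (g i)"
    "\<And>i x. x \<in> polydisc s \<Longrightarrow> ((\<lambda>\<alpha>. c \<alpha> * of_nat (\<alpha> i) * monomial (lower_exponent i \<alpha>) x) has_sum g i x) UNIV"
    "\<And>x. x \<in> open_polydisc s \<Longrightarrow> (f has_derivative (\<lambda>v. \<Sum>i\<in>UNIV. v $ i * g i x)) (at x)"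
proof -
  let ?B = "\<lambda>\<alpha>. norm (c \<alpha>) * r ^ mdeg \<alpha> / (r - s)"
  have B: "?B summable_on UNIV"
    using summable_on_cmult_left[OF c, of "1 / (r - s)"] by simp
  have le: "norm (c \<alpha> * of_nat (\<alpha> i)) * s ^ mdeg (lower_exponent i \<alpha>) \<le> ?B \<alpha>" for \<alpha> and i :: 'n
  proof (cases "\<alpha> i = 0")
    case True
    then show ?thesis using s by simp
  next
    case False
    have "real (\<alpha> i) * s ^ mdeg (lower_exponent i \<alpha>) \<le> real (mdeg \<alpha>) * s ^ (mdeg \<alpha> - 1)"
    proof (rule mult_mono)
      show "real (\<alpha> i) \<le> real (mdeg \<alpha>)" using member_le_sum[of i UNIV \<alpha>] by (simp only: mdeg_def of_nat_le_iff) simp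
      have "mdeg (lower_exponent i \<alpha>) = mdeg \<alpha> - 1" using mdeg_lower[of \<alpha> i] False by linarith
      then show "s ^ mdeg (lower_exponent i \<alpha>) \<le> s ^ (mdeg \<alpha> - 1)" by simp
    qed (use s in auto)
    also have "\<dots> \<le> r ^ mdeg \<alpha> / (r - s)"
      using s by (rule exponent_times_power_le)
    finally have "norm (c \<alpha>) * (real (\<alpha> i) * s ^ mdeg (lower_exponent i \<alpha>)) \<le> norm (c \<alpha>) * (r ^ mdeg \<alpha> / (r - s))"
      by (rule mult_left_mono) simp
    then show ?thesis by (simp add: norm_mult mult_ac)
  qed
  define g where "g i x = (\<Sum>\<^sub>\<infinity>\<alpha>. c \<alpha> * of_nat (\<alpha> i) * monomial (lower_exponent i \<alpha>) x)" for i and x :: "'k ^ 'n"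
  have bd: "norm (c \<alpha> * of_nat (\<alpha> i) * monomial (lower_exponent i \<alpha>) x) \<le> ?B \<alpha>" if "x \<in> polydisc s" for \<alpha> i x
  proof -
    have "norm (c \<alpha> * of_nat (\<alpha> i) * monomial (lower_exponent i \<alpha>) x) \<le> norm (c \<alpha> * of_nat (\<alpha> i)) * s ^ mdeg (lower_exponent i \<alpha>)"
      unfolding norm_mult by (intro mult_left_mono norm_monomial_le[OF that]) auto
    also have "\<dots> \<le> ?B \<alpha>" by (rule le)
    finally show ?thesis .
  qed
  have gs: "((\<lambda>\<alpha>. c \<alpha> * of_nat (\<alpha> i) * monomial (lower_exponent i \<alpha>) x) has_sum g i x) UNIV" if "x \<in> polydisc s" for i x
    unfolding g_def
    by (rule has_sum_infsum, rule abs_summable_summable,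
        rule Infinite_Sum.abs_summable_on_comparison_test'[OF B], rule bd[OF that])
  have pg: "mpowser_le s (infsum ?B UNIV) (g i)" for i
  proof (rule mpowser_sum[OF s(1) _ B gs])
    fix \<alpha>
    show "mpowser_le s (?B \<alpha>) (\<lambda>x. c \<alpha> * of_nat (\<alpha> i) * monomial (lower_exponent i \<alpha>) x)"
      by (rule mpowser_mono[OF mpowser_monomial le]) (use s in simp)
  qed auto
  have inf: "infinite (UNIV :: ('n \<Rightarrow> nat) set)"
  proof
    assume "finite (UNIV :: ('n \<Rightarrow> nat) set)"
    then have "finite ((\<lambda>h. h undefined) ` (UNIV :: ('n \<Rightarrow> nat) set))" by (rule finite_imageI)
    moreover have "((\<lambda>h. h undefined) ` (UNIV :: ('n \<Rightarrow> nat) set)) = UNIV"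
      by (auto intro!: image_eqI[of _ _ "\<lambda>_. _"])
    ultimately show False by simp
  qed
  define e where "e = from_nat_into (UNIV :: ('n \<Rightarrow> nat) set)"
  have e: "bij_betw e UNIV UNIV"
    unfolding e_def by (rule bij_betw_from_nat_into) (use inf in auto)
  let ?n = "real CARD('n)"
  let ?f' = "\<lambda>k x v. c (e k) * (\<Sum>i\<in>UNIV. v $ i * (of_nat (e k i) * monomial (lower_exponent i (e k)) x))"
  let ?g' = "\<lambda>x v. \<Sum>i\<in>UNIV. v $ i * g i x"
  have f'le: "norm (?f' k x v) \<le> ?n * ?B (e k) * norm v" if "x \<in> polydisc s" for k x v
  proof -
    have "?f' k x v = (\<Sum>i\<in>UNIV. v $ i * (c (e k) * of_nat (e k i) * monomial (lower_exponent i (e k)) x))"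
      by (simp add: sum_distrib_left mult_ac)
    also have "norm \<dots> \<le> (\<Sum>i\<in>(UNIV :: 'n set). norm v * ?B (e k))"
      by (rule sum_norm_le) (unfold norm_mult[of "v $ _"], intro mult_mono bd that Finite_Cartesian_Product.norm_nth_le, auto)
    finally show ?thesis by (simp add: mult_ac)
  qed
  have Bs: "summable (\<lambda>k. ?n * ?B (e k))"
    using B summable_on_reindex_bij_betw[OF e, of ?B] by (intro summable_mult summable_on_imp_summable) auto
  have f's: "(\<lambda>k. ?f' k x v) sums ?g' x v" if "x \<in> polydisc s" for x v
  proof -
    have "((\<lambda>\<alpha>. \<Sum>i\<in>UNIV. v $ i * (c \<alpha> * of_nat (\<alpha> i) * monomial (lower_exponent i \<alpha>) x)) has_sum ?g' x v) UNIV"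
      by (intro has_sum_finite_sum has_sum_cmult_right gs that)
    then have "((\<lambda>k. \<Sum>i\<in>UNIV. v $ i * (c (e k) * of_nat (e k i) * monomial (lower_exponent i (e k)) x)) has_sum ?g' x v) UNIV"
      by (subst has_sum_reindex_bij_betw[OF e, of "\<lambda>\<alpha>. \<Sum>i\<in>UNIV. v $ i * (c \<alpha> * of_nat (\<alpha> i) * monomial (lower_exponent i \<alpha>) x)"])
    then show ?thesis by (intro has_sum_imp_sums) (simp add: sum_distrib_left mult_ac)
  qed
  have fs: "(\<lambda>k. c (e k) * monomial (e k) x) sums f x" if "x \<in> polydisc s" for x
  proof -
    have "x \<in> polydisc r" using that polydisc_mono[of s r] s by auto
    then show ?thesis using f[of x] has_sum_reindex_bij_betw[OF e, of "\<lambda>\<alpha>. c \<alpha> * monomial \<alpha> x"]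
      by (intro has_sum_imp_sums) blast
  qed
  have "\<exists>h. \<forall>x\<in>polydisc s. (\<lambda>k. c (e k) * monomial (e k) x) sums h x \<and> (h has_derivative ?g' x) (at x within polydisc s)"
  proof (rule has_derivative_series[OF convex_polydisc])
    show "((\<lambda>x. c (e k) * monomial (e k) x) has_derivative ?f' k x) (at x within polydisc s)" for k x
      by (rule has_derivative_mult_right[OF has_derivative_monomial])
    show "\<forall>\<^sub>F n in sequentially. \<forall>x\<in>polydisc s. \<forall>h. norm ((\<Sum>i<n. ?f' i x h) - ?g' x h) \<le> \<epsilon> * norm h"
      if "\<epsilon> > 0" for \<epsilon>
    proof -
      have "\<forall>\<^sub>F n in sequentially. norm (\<Sum>k. ?n * ?B (e (k + n))) < \<epsilon>"
        using suminf_exist_split[OF that Bs] by (auto simp: eventually_sequentially)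
      then show ?thesis
      proof eventually_elim
        case (elim n)
        show ?case
        proof (intro ballI allI)
          fix x h :: "'k ^ 'n" assume x: "x \<in> polydisc s"
          have sm: "summable (\<lambda>k. ?n * ?B (e (k + n)) * norm h)"
            by (intro summable_mult2 summable_ignore_initial_segment[OF Bs, of n])
          have smn: "summable (\<lambda>k. norm (?f' (k + n) x h))"
            by (rule summable_comparison_test'[OF sm, of 0]) (use f'le[OF x] in auto)
          have "?g' x h = (\<Sum>k. ?f' (k + n) x h) + (\<Sum>i<n. ?f' i x h)"
            using suminf_split_initial_segment[OF sums_summable[OF f's[OF x, of h]], of n] sums_unique[OF f's[OF x, of h]] by simp
          then have "norm ((\<Sum>i<n. ?f' i x h) - ?g' x h) = norm (\<Sum>k. ?f' (k + n) x h)"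
            by (simp add: norm_minus_commute)
          also have "\<dots> \<le> (\<Sum>k. norm (?f' (k + n) x h))"
            by (rule summable_norm[OF smn])
          also have "\<dots> \<le> (\<Sum>k. ?n * ?B (e (k + n)) * norm h)"
            by (rule suminf_le[OF f'le[OF x] smn sm])
          also have "\<dots> = (\<Sum>k. ?n * ?B (e (k + n))) * norm h"
            by (rule suminf_mult2[symmetric], rule summable_ignore_initial_segment[OF Bs])
          also have "\<dots> \<le> \<epsilon> * norm h"
            using elim by (intro mult_right_mono) auto
          finally show "norm ((\<Sum>i<n. ?f' i x h) - ?g' x h) \<le> \<epsilon> * norm h" .
        qed
      qed
    qed
    show "0 \<in> polydisc s" using s by simp
    show "(\<lambda>k. c (e k) * monomial (e k) 0) sums f 0" using s by (intro fs) simp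
  qed
  then obtain h where h: "\<And>x. x \<in> polydisc s \<Longrightarrow> (\<lambda>k. c (e k) * monomial (e k) x) sums h x"
    "\<And>x. x \<in> polydisc s \<Longrightarrow> (h has_derivative ?g' x) (at x within polydisc s)" by blast
  have hf: "h x = f x" if "x \<in> polydisc s" for x
    using h(1)[OF that] fs[OF that] sums_unique2 by blast
  have "(f has_derivative ?g' x) (at x)" if "x \<in> open_polydisc s" for x
  proof -
    have "(h has_derivative ?g' x) (at x within open_polydisc s)"
      using h(2)[of x] that open_polydisc_subset_polydisc has_derivative_subset by blast
    then have "(h has_derivative ?g' x) (at x)"
      using at_within_open[OF that open_open_polydisc] by simp
    then show ?thesis
      by (rule has_derivative_transform_within_open[OF _ open_open_polydisc that])
        (use hf open_polydisc_subset_polydisc in auto)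
  qed
  with pg gs show ?thesis using that by blast
qed

section \<open>Functional equations for analytic germs\<close>

lemma mem_open_polydiscE:
  assumes "x \<in> open_polydisc (r :: real)" "r > 0"
  obtains s where "0 < s" "s < r" "x \<in> open_polydisc s"
proof -
  define m where "m = Max (range (\<lambda>i. norm (x $ i)))"
  have le: "norm (x $ i) \<le> m" for i unfolding m_def by (intro Max_ge) auto
  have "m \<in> range (\<lambda>i. norm (x $ i))" unfolding m_def by (intro Max_in) auto
  then have m: "0 \<le> m" "m < r" using assms(1) by (auto simp: open_polydisc_def)
  show ?thesis
  proof (rule that[of "(m + r) / 2"])
    have "m < (m + r) / 2" using m by simp
    then show "x \<in> open_polydisc ((m + r) / 2)" using le le_less_trans unfolding open_polydisc_def by blast
  qed (use m in auto)
qed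

lemma mpowser_partial_deriv:
  fixes f :: "'k::{real_normed_field, euclidean_space} ^ 'n::finite \<Rightarrow> 'k"
  assumes f: "mpowser_le r M f" and s: "0 < s" "s < r"
  shows "\<exists>N. \<forall>i. mpowser_le s N (partial_deriv i f)"
    and "\<And>x. x \<in> polydisc s \<Longrightarrow> (f has_derivative (\<lambda>v. \<Sum>i\<in>UNIV. v $ i * partial_deriv i f x)) (at x)"
proof -
  obtain c where c: "coeff_weights r c summable_on UNIV"
    "(coeff_norm r c) \<le> M"
    "\<And>x. x \<in> polydisc r \<Longrightarrow> (power_terms c x has_sum f x) UNIV"
    using mpowserE[OF f] by blast
  define t where "t = (s + r) / 2"
  have t: "0 < t" "t < r" "s < t" using s by (auto simp: t_def)
  obtain g N where g: "\<And>i. mpowser_le t N (g i)"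
    "\<And>i x. x \<in> polydisc t \<Longrightarrow> ((\<lambda>\<alpha>. c \<alpha> * of_nat (\<alpha> i) * monomial (lower_exponent i \<alpha>) x) has_sum g i x) UNIV"
    "\<And>x. x \<in> open_polydisc t \<Longrightarrow> (f has_derivative (\<lambda>v. \<Sum>i\<in>UNIV. v $ i * g i x)) (at x)"
  proof (rule mpowser_has_derivative[where f = f, OF c(1,3) t(1,2)])
  qed (assumption | rule that)+
  have eq: "partial_deriv i f x = g i x" if "x \<in> open_polydisc t" for i x
    by (rule partial_deriv_eqI[OF g(3)[OF that]])
  have sub: "x \<in> open_polydisc t" if "x \<in> polydisc s" for x :: "'k ^ 'n" using polydisc_subset_open_polydisc[OF t(3)] that by blast
  have "mpowser_le s N (partial_deriv i f)" for i
    by (rule mpowser_cong[OF mpowser_shrink_radius[OF g(1)[of i] s(1)]]) (use t eq sub in auto)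
  then show "\<exists>N. \<forall>i. mpowser_le s N (partial_deriv i f)" by blast
  show "(f has_derivative (\<lambda>v. \<Sum>i\<in>UNIV. v $ i * partial_deriv i f x)) (at x)" if "x \<in> polydisc s" for x
    using g(3)[OF sub[OF that]] eq[OF sub[OF that]] by simp
qed

lemma mpowser_isCont:
  assumes "mpowser_le r M f" "r > 0" "x \<in> open_polydisc r"
  shows "isCont f x"
proof -
  obtain s where s: "0 < s" "s < r" "x \<in> open_polydisc s" using mem_open_polydiscE[OF assms(3,2)] .
  then have "x \<in> polydisc s" using open_polydisc_subset_polydisc by blast
  then have "(f has_derivative (\<lambda>v. \<Sum>i\<in>UNIV. v $ i * partial_deriv i f x)) (at x)"
    by (rule mpowser_partial_deriv(2)[OF assms(1) s(1,2)])
  then show ?thesis by (rule has_derivative_continuous)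
qed

text \<open>The hypothesis is stable under partial derivatives, unlike a bound on the closed polydisc of
  radius \<open>r\<close> itself, and this is what lets the induction go through.\<close>

lemma mpowser_Ck_on:
  fixes f :: "'k::{real_normed_field, euclidean_space} ^ 'n::finite \<Rightarrow> 'k"
  assumes "r > 0" "\<And>s. 0 < s \<Longrightarrow> s < r \<Longrightarrow> \<exists>M. mpowser_le s M f"
  shows "Ck_on k (open_polydisc r) f"
  using assms(2)
proof (induction k arbitrary: f)
  case 0
  have "isCont f x" if x: "x \<in> open_polydisc r" for x :: "'k ^ 'n"
  proof -
    obtain s where s: "0 < s" "s < r" "x \<in> open_polydisc s" using mem_open_polydiscE[OF x assms(1)] .
    then show ?thesis using 0[of s] mpowser_isCont by blast
  qed
  then show ?case by (simp add: continuous_at_imp_continuous_on)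
next
  case (Suc k)
  show ?case
  proof (rule Ck_on_SucI[OF open_open_polydisc])
    fix x :: "'k ^ 'n" assume x: "x \<in> open_polydisc r"
    obtain s where s: "0 < s" "s < r" "x \<in> open_polydisc s" using mem_open_polydiscE[OF x assms(1)] .
    define t where "t = (s + r) / 2"
    have t: "0 < t" "t < r" "s < t" using s by (auto simp: t_def)
    obtain M where "mpowser_le t M f" using Suc.prems[OF t(1,2)] by blast
    from mpowser_partial_deriv(2)[OF this s(1) t(3)]
    show "(f has_derivative (\<lambda>v. \<Sum>i\<in>UNIV. v $ i * partial_deriv i f x)) (at x)"
      using s(3) open_polydisc_subset_polydisc by blast
  next
    fix v
    have "Ck_on k (open_polydisc r) (partial_deriv i f)" for i
    proof (rule Suc.IH)
      fix s assume s: "0 < s" "s < r"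
      define t where "t = (s + r) / 2"
      have t: "0 < t" "t < r" "s < t" using s by (auto simp: t_def)
      obtain M where "mpowser_le t M f" using Suc.prems[OF t(1,2)] by blast
      from mpowser_partial_deriv(1)[OF this s(1) t(3)]
      show "\<exists>M. mpowser_le s M (partial_deriv i f)" by blast
    qed
    then show "Ck_on k (open_polydisc r) (\<lambda>x. \<Sum>i\<in>UNIV. v $ i * partial_deriv i f x)"
      by (intro Ck_on_sum Ck_on_mult Ck_on_const open_open_polydisc)
  qed
qed

lemma sum_weights_le:
  "(\<Sum>i\<in>UNIV. w i * \<alpha> i) \<le> (total_weight w) * mdeg (\<alpha> :: 'n::finite \<Rightarrow> nat)"
proof -
  have "(\<Sum>i\<in>UNIV. w i * \<alpha> i) \<le> (\<Sum>i\<in>UNIV. w i * mdeg \<alpha>)"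
    by (intro sum_mono mult_left_mono) (auto simp: mdeg_def intro: member_le_sum)
  then show ?thesis by (simp add: sum_distrib_right)
qed

lemma monomial_weighted_scaling:
  "monomial \<alpha> (weighted_scaling w z x) = exp (of_nat (\<Sum>i\<in>UNIV. w i * \<alpha> i) * z) * monomial \<alpha> x"
proof -
  have "monomial \<alpha> (weighted_scaling w z x) = (\<Prod>i\<in>UNIV. exp (of_nat (w i) * z) ^ \<alpha> i) * monomial \<alpha> x"
    by (simp add: monomial_def power_mult_distrib prod.distrib)
  also have "(\<Prod>i\<in>UNIV. exp (of_nat (w i) * z) ^ \<alpha> i) = (\<Prod>i\<in>UNIV. exp (of_nat (w i * \<alpha> i) * z))"
    by (intro prod.cong refl) (simp add: exp_of_nat_mult[symmetric] mult_ac)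
  also have "\<dots> = exp (of_nat (\<Sum>i\<in>UNIV. w i * \<alpha> i) * z)"
    by (simp add: exp_sum[symmetric] sum_distrib_right)
  finally show ?thesis .
qed

text \<open>The operator \<open>E + W\<close> acts on a monomial of weighted degree \<open>m\<close> as multiplication by \<open>W + m\<close>, and
  \<open>W + m \<ge> 1\<close>, so dividing the coefficients does not increase the norm.\<close>

lemma analytic_euler_equation:
  fixes f :: "'k::{real_normed_field, euclidean_space} ^ 'n::finite \<Rightarrow> 'k"
  assumes f: "mpowser_le r M f" and s: "0 < s" "s < r" and W: "total_weight w > 0"
  obtains F where "mpowser_le r M F"
    "\<And>x. x \<in> open_polydisc s \<Longrightarrow> (\<Sum>i\<in>UNIV. of_nat (w i) * x $ i * partial_deriv i F x) + of_nat (total_weight w) * F x = f x"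
proof -
  obtain c where c: "coeff_weights r c summable_on UNIV"
    "(coeff_norm r c) \<le> M"
    "\<And>x. x \<in> polydisc r \<Longrightarrow> (power_terms c x has_sum f x) UNIV"
    using mpowserE[OF f] by blast
  define n where "n = (total_weight w)"
  define m where "m \<alpha> = (\<Sum>i\<in>UNIV. w i * \<alpha> i)" for \<alpha>
  define d where "d \<alpha> = c \<alpha> / of_nat (n + m \<alpha>)" for \<alpha>
  have n: "n > 0" using W by (simp add: n_def)
  have dc: "norm (d \<alpha>) * r ^ mdeg \<alpha> \<le> norm (c \<alpha>) * r ^ mdeg \<alpha>" for \<alpha>
  proof -
    have "norm (d \<alpha>) \<le> norm (c \<alpha>) / 1"
      unfolding d_def norm_divide norm_of_nat using n by (intro divide_left_mono) auto
    then show ?thesis using s by (intro mult_right_mono) auto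
  qed
  have ds: "coeff_weights r d summable_on UNIV"
    by (rule summable_on_comparison_test[OF c(1)]) (use dc s in auto)
  define F where "F x = (\<Sum>\<^sub>\<infinity>\<alpha>. d \<alpha> * monomial \<alpha> x)" for x
  have Fs: "(power_terms d x has_sum F x) UNIV" if "x \<in> polydisc r" for x
    unfolding F_def
    by (rule has_sum_infsum, rule abs_summable_summable,
        rule Infinite_Sum.abs_summable_on_comparison_test'[OF ds])
      (use norm_monomial_le[OF that] in \<open>auto simp: norm_mult intro!: mult_left_mono\<close>)
  have pF: "mpowser_le r M F" unfolding mpowser_le_def
    using ds Fs infsum_mono[OF ds c(1) dc] c(2) by (intro exI[of _ d]) auto
  obtain g N where g: "\<And>i. mpowser_le s N (g i)"
    "\<And>i x. x \<in> polydisc s \<Longrightarrow> ((\<lambda>\<alpha>. d \<alpha> * of_nat (\<alpha> i) * monomial (lower_exponent i \<alpha>) x) has_sum g i x) UNIV"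
    "\<And>x. x \<in> open_polydisc s \<Longrightarrow> (F has_derivative (\<lambda>v. \<Sum>i\<in>UNIV. v $ i * g i x)) (at x)"
  proof (rule mpowser_has_derivative[where f = F, OF ds Fs s])
  qed (assumption | rule that)+
  show ?thesis
  proof (rule that[OF pF])
    fix x :: "'k ^ 'n" assume x: "x \<in> open_polydisc s"
    then have xs: "x \<in> polydisc s" and xr: "x \<in> polydisc r"
      using open_polydisc_subset_polydisc polydisc_mono[of s r] s by auto
    have "((\<lambda>\<alpha>. \<Sum>i\<in>UNIV. of_nat (w i) * x $ i * (d \<alpha> * of_nat (\<alpha> i) * monomial (lower_exponent i \<alpha>) x))
       has_sum (\<Sum>i\<in>UNIV. of_nat (w i) * x $ i * g i x)) UNIV"
      by (intro has_sum_finite_sum has_sum_cmult_right g(2)[OF xs])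
    also have "(\<lambda>\<alpha>. \<Sum>i\<in>UNIV. of_nat (w i) * x $ i * (d \<alpha> * of_nat (\<alpha> i) * monomial (lower_exponent i \<alpha>) x)) =
       (\<lambda>\<alpha>. of_nat (m \<alpha>) * (d \<alpha> * monomial \<alpha> x))"
    proof
      fix \<alpha>
      have "of_nat (w i) * x $ i * (d \<alpha> * of_nat (\<alpha> i) * monomial (lower_exponent i \<alpha>) x) = of_nat (w i * \<alpha> i) * (d \<alpha> * monomial \<alpha> x)" for i
      proof -
        have "of_nat (w i) * x $ i * (d \<alpha> * of_nat (\<alpha> i) * monomial (lower_exponent i \<alpha>) x) =
          of_nat (w i) * d \<alpha> * (of_nat (\<alpha> i) * (x $ i * monomial (lower_exponent i \<alpha>) x))" by (simp add: mult_ac)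
        then show ?thesis unfolding monomial_lower by (simp add: mult_ac)
      qed
      then show "(\<Sum>i\<in>UNIV. of_nat (w i) * x $ i * (d \<alpha> * of_nat (\<alpha> i) * monomial (lower_exponent i \<alpha>) x)) = of_nat (m \<alpha>) * (d \<alpha> * monomial \<alpha> x)"
        by (simp only: m_def of_nat_sum sum_distrib_right)
    qed
    finally have "((\<lambda>\<alpha>. of_nat (m \<alpha>) * (d \<alpha> * monomial \<alpha> x) + of_nat n * (d \<alpha> * monomial \<alpha> x)) has_sum
       (\<Sum>i\<in>UNIV. of_nat (w i) * x $ i * g i x) + of_nat n * F x) UNIV"
      by (intro has_sum_add has_sum_cmult_right Fs xr)
    also have "(\<lambda>\<alpha>. of_nat (m \<alpha>) * (d \<alpha> * monomial \<alpha> x) + of_nat n * (d \<alpha> * monomial \<alpha> x)) = power_terms c x"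
    proof
      fix \<alpha>
      have "(of_nat (n + m \<alpha>) :: 'k) \<noteq> 0" using n by (simp del: of_nat_add)
      then have "of_nat (n + m \<alpha>) * d \<alpha> = c \<alpha>" by (simp add: d_def del: of_nat_add)
      then show "of_nat (m \<alpha>) * (d \<alpha> * monomial \<alpha> x) + of_nat n * (d \<alpha> * monomial \<alpha> x) = c \<alpha> * monomial \<alpha> x"
        by (metis (no_types, lifting) add.commute distrib_right mult.assoc of_nat_add)
    qed
    finally have "(\<Sum>i\<in>UNIV. of_nat (w i) * x $ i * g i x) + of_nat n * F x = f x"
      using c(3)[OF xr] has_sum_unique by blast
    then show "(\<Sum>i\<in>UNIV. of_nat (w i) * x $ i * partial_deriv i F x) + of_nat (total_weight w) * F x = f x"
      using partial_deriv_eqI[OF g(3)[OF x]] by (simp add: n_def)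
  qed
qed

lemma exp_minus_1_le: "exp x - 1 \<le> x * exp (x::real)"
proof -
  have "1 - x \<le> exp (- x)" using exp_ge_add_one_self[of "-x"] by simp
  then have "(1 - x) * exp x \<le> exp (- x) * exp x" by (intro mult_right_mono) auto
  then show ?thesis by (simp add: algebra_simps flip: exp_add)
qed

text \<open>In weighted degree \<open>m\<close> the two values differ by a multiple of
  \<open>exp (m \<sigma>') (exp (m (\<sigma> - \<sigma>')) - 1)\<close>. Its norm is at most \<open>d exp (3 m)\<close>, and \<open>m\<close> is at most \<open>W\<close>
  times the degree; hence the factor \<open>exp (- 3 W)\<close> in the radius \<open>r\<close>.\<close>

lemma mpowser_weighted_scaling_contraction:
  fixes b :: "'k::{real_normed_field, euclidean_space} ^ 'n::finite \<Rightarrow> 'k"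
  assumes b: "mpowser_le R M b" and R: "R > 0" and b0: "b 0 = 0"
    and q: "0 < q" "q \<le> 1" "q * M \<le> 1/2"
    and r: "r = R * q * exp (- 3 * real (total_weight w))"
    and \<sigma>: "mpowser_le r 1 \<sigma>" and \<sigma>': "mpowser_le r 1 \<sigma>'" and d: "mpowser_le r d (\<lambda>y. \<sigma> y - \<sigma>' y)" "0 \<le> d" "d \<le> 1"
  shows "mpowser_le r (d / 2) (\<lambda>y. b (weighted_scaling w (\<sigma> y) y) - b (weighted_scaling w (\<sigma>' y) y))"
proof -
  obtain c where c: "coeff_weights R c summable_on UNIV"
    "(coeff_norm R c) \<le> M"
    "\<And>x. x \<in> polydisc R \<Longrightarrow> (power_terms c x has_sum b x) UNIV"
    using mpowserE[OF b] by blast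
  have c0: "c (\<lambda>_. 0) = 0" using mpowser_coeff_0[OF R, of c b] c(3) b0 by auto
  define W where "W = real (total_weight w)"
  define m where "m \<alpha> = (\<Sum>i\<in>UNIV. w i * \<alpha> i)" for \<alpha>
  have W0: "W \<ge> 0" unfolding W_def by (rule of_nat_0_le_iff)
  have rR: "r * exp W \<le> R" "0 < r"
  proof -
    have "r * exp W = R * q * exp (- 2 * W)" unfolding r W_def[symmetric] by (simp flip: exp_add)
    also have "\<dots> \<le> R * 1 * 1" using R q W0 by (intro mult_mono) auto
    finally show "r * exp W \<le> R" by simp
    show "0 < r" using R q by (simp add: r)
  qed
  have in_R: "weighted_scaling w z y \<in> polydisc R" if "norm z \<le> 1" "y \<in> polydisc r" for z y
    unfolding polydisc_def
  proof (intro CollectI allI)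
    fix i
    have "norm (weighted_scaling w z y $ i) \<le> exp (W * norm z) * norm (y $ i)"
      unfolding W_def by (rule norm_weighted_scaling_nth_le)
    also have "\<dots> \<le> exp W * r"
      using that W0 rR by (intro mult_mono) (auto simp: polydisc_def mult_left_le)
    finally have "norm (weighted_scaling w z y $ i) \<le> exp W * r" .
    then show "norm (weighted_scaling w z y $ i) \<le> R" using rR by (simp add: mult.commute)
  qed
  let ?B = "\<lambda>\<alpha>. d * q * (norm (c \<alpha>) * R ^ mdeg \<alpha>)"
  have Bs: "?B summable_on UNIV" by (intro summable_on_cmult_right c)
  have "mpowser_le r (infsum ?B UNIV) (\<lambda>y. b (weighted_scaling w (\<sigma> y) y) - b (weighted_scaling w (\<sigma>' y) y))"
  proof (rule mpowser_sum[OF rR(2) _ Bs])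
    fix \<alpha>
    let ?m = "real (m \<alpha>)"
    have 1: "mpowser_le r (norm (c \<alpha>) * r ^ mdeg \<alpha> * (exp (?m * 1) * (exp (?m * d) - 1)))
      (\<lambda>y. c \<alpha> * monomial \<alpha> y * (exp (of_nat (m \<alpha>) * \<sigma>' y) * (exp (of_nat (m \<alpha>) * (\<sigma> y - \<sigma>' y)) - 1)))"
    proof -
      have "mpowser_le r (real (m \<alpha>) * 1) (\<lambda>y. of_nat (m \<alpha>) * \<sigma>' y)"
        using mpowser_mult[OF rR(2) mpowser_const \<sigma>', of "of_nat (m \<alpha>)"] rR by simp
      then have e1: "mpowser_le r (exp (?m * 1)) (\<lambda>y. exp (of_nat (m \<alpha>) * \<sigma>' y))"
        by (rule mpowser_exp[OF rR(2)]) simp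
      have "mpowser_le r (real (m \<alpha>) * d) (\<lambda>y. of_nat (m \<alpha>) * (\<sigma> y - \<sigma>' y))"
        using mpowser_mult[OF rR(2) mpowser_const d(1), of "of_nat (m \<alpha>)"] rR by simp
      then have e2: "mpowser_le r (exp (?m * d) - 1) (\<lambda>y. exp (of_nat (m \<alpha>) * (\<sigma> y - \<sigma>' y)) - 1)"
        by (rule mpowser_exp_minus_1[OF rR(2)]) (use d in simp)
      show ?thesis
        by (rule mpowser_mult[OF rR(2) mpowser_monomial mpowser_mult[OF rR(2) e1 e2]]) (use rR in simp)
    qed
    have "norm (c \<alpha>) * r ^ mdeg \<alpha> * (exp (?m * 1) * (exp (?m * d) - 1)) \<le> ?B \<alpha>"
    proof (cases "mdeg \<alpha> = 0")
      case True
      then show ?thesis using c0 by (simp add: mdeg_eq_0_iff)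
    next
      case False
      have mW: "?m \<le> W * real (mdeg \<alpha>)"
        unfolding m_def W_def of_nat_mult[symmetric] of_nat_le_iff by (rule sum_weights_le)
      have "exp (?m * d) - 1 \<le> ?m * d * exp (?m * d)" by (rule exp_minus_1_le)
      also have "\<dots> \<le> exp ?m * d * exp ?m"
      proof (intro mult_mono)
        show "?m \<le> exp ?m" using exp_ge_add_one_self[of ?m] by linarith
      qed (use d in \<open>auto simp: mult_left_le\<close>)
      finally have "exp (?m * 1) * (exp (?m * d) - 1) \<le> exp ?m * (exp ?m * d * exp ?m)"
        by (simp add: mult_left_mono)
      also have "\<dots> = d * exp (3 * ?m)"
      proof -
        have "exp (3 * ?m) = exp ?m * exp ?m * exp ?m" by (simp flip: exp_add)
        then show ?thesis by (simp add: mult_ac)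
      qed
      also have "\<dots> \<le> d * exp (3 * (W * real (mdeg \<alpha>)))" using mW d by (intro mult_left_mono) auto
      finally have "norm (c \<alpha>) * r ^ mdeg \<alpha> * (exp (?m * 1) * (exp (?m * d) - 1)) \<le>
        norm (c \<alpha>) * r ^ mdeg \<alpha> * (d * exp (3 * (W * real (mdeg \<alpha>))))"
        using rR by (intro mult_left_mono) auto
      also have "\<dots> = d * (norm (c \<alpha>) * (R * q) ^ mdeg \<alpha>)"
      proof -
        have "exp (3 * (W * real (mdeg \<alpha>))) = exp (3 * W) ^ mdeg \<alpha>"
          by (simp add: exp_of_nat_mult[symmetric] mult_ac)
        then have "r ^ mdeg \<alpha> * exp (3 * (W * real (mdeg \<alpha>))) = (r * exp (3 * W)) ^ mdeg \<alpha>"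
          by (simp add: power_mult_distrib)
        also have "r * exp (3 * W) = R * q" unfolding r W_def[symmetric] by (simp add: mult.assoc flip: exp_add)
        finally show ?thesis by (simp add: mult_ac)
      qed
      also have "\<dots> \<le> ?B \<alpha>"
      proof -
        have "q ^ mdeg \<alpha> \<le> q ^ 1" using q False by (intro power_decreasing) auto
        then have "(R * q) ^ mdeg \<alpha> \<le> q * R ^ mdeg \<alpha>"
          unfolding power_mult_distrib using R by (simp add: mult.commute mult_right_mono)
        then have "d * (norm (c \<alpha>) * (R * q) ^ mdeg \<alpha>) \<le> d * (norm (c \<alpha>) * (q * R ^ mdeg \<alpha>))"
          using d by (intro mult_left_mono) auto
        then show ?thesis by (simp add: mult_ac)
      qed
      finally show ?thesis .
    qed
    from mpowser_mono[OF 1 this]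
    show "mpowser_le r (?B \<alpha>) (\<lambda>y. c \<alpha> * monomial \<alpha> (weighted_scaling w (\<sigma> y) y) - c \<alpha> * monomial \<alpha> (weighted_scaling w (\<sigma>' y) y))"
    proof (rule mpowser_cong)
      fix y
      have "exp (of_nat (m \<alpha>) * \<sigma> y) = exp (of_nat (m \<alpha>) * \<sigma>' y) * exp (of_nat (m \<alpha>) * (\<sigma> y - \<sigma>' y))"
        by (simp add: algebra_simps flip: exp_add)
      then show "c \<alpha> * monomial \<alpha> y * (exp (of_nat (m \<alpha>) * \<sigma>' y) * (exp (of_nat (m \<alpha>) * (\<sigma> y - \<sigma>' y)) - 1)) =
        c \<alpha> * monomial \<alpha> (weighted_scaling w (\<sigma> y) y) - c \<alpha> * monomial \<alpha> (weighted_scaling w (\<sigma>' y) y)"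
        unfolding monomial_weighted_scaling m_def[symmetric] by (simp add: algebra_simps)
    qed
  next
    fix y :: "'k ^ 'n" assume y: "y \<in> polydisc r"
    have "((\<lambda>\<alpha>. c \<alpha> * monomial \<alpha> (weighted_scaling w (\<sigma> y) y) + - (c \<alpha> * monomial \<alpha> (weighted_scaling w (\<sigma>' y) y))) has_sum
      b (weighted_scaling w (\<sigma> y) y) + - b (weighted_scaling w (\<sigma>' y) y)) UNIV"
      by (intro has_sum_add has_sum_uminusI c(3) in_R y mpowser_bound[OF \<sigma> y] mpowser_bound[OF \<sigma>' y])
    then show "((\<lambda>\<alpha>. c \<alpha> * monomial \<alpha> (weighted_scaling w (\<sigma> y) y) - c \<alpha> * monomial \<alpha> (weighted_scaling w (\<sigma>' y) y)) has_sum
      b (weighted_scaling w (\<sigma> y) y) - b (weighted_scaling w (\<sigma>' y) y)) UNIV" by simp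
  qed
  moreover have "infsum ?B UNIV \<le> d / 2"
  proof -
    have "infsum ?B UNIV = d * (q * (coeff_norm R c))"
      by (simp add: infsum_cmult_right' mult.assoc)
    also have "\<dots> \<le> d * (q * M)" using c(2) q d by (intro mult_left_mono) auto
    also have "\<dots> \<le> d * (1 / 2)" using q d by (intro mult_left_mono) auto
    finally show ?thesis by simp
  qed
  ultimately show ?thesis by (rule mpowser_mono)
qed

text \<open>Inverting the map \<open>\<Phi>\<^sub>-\<^sub>b\<close> amounts to this fixed point equation for one function. The Picard
  iterates start at 0, and consecutive differences are at least halved in each step.\<close>

lemma analytic_scaling_fixpoint:
  fixes b :: "'k::{real_normed_field, euclidean_space} ^ 'n::finite \<Rightarrow> 'k"
  assumes b: "mpowser_le R M b" and R: "R > 0" and b0: "b 0 = 0"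
  obtains \<sigma> r where "r > 0" "mpowser_le r 1 \<sigma>" "\<And>y. y \<in> polydisc r \<Longrightarrow> \<sigma> y = b (weighted_scaling w (\<sigma> y) y)"
proof -
  have M0: "M \<ge> 0" using mpowser_bound[OF b zero_in_polydisc] R b0 by simp
  \<comment> \<open>Adding 1 to \<open>M\<close> keeps the denominator positive and gives \<open>q \<le> 1\<close>.\<close>
  define q where "q = 1 / (2 * (M + 1))"
  have q: "0 < q" "q \<le> 1" "q * M \<le> 1/2" using M0 by (auto simp: q_def field_simps)
  define W where "W = real (total_weight w)"
  have W0: "W \<ge> 0" unfolding W_def by (rule of_nat_0_le_iff)
  define r where "r = R * q * exp (- 3 * real (total_weight w))"
  have r: "r > 0" using R q by (simp add: r_def)
  have rW: "r * exp W < R"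
  proof -
    have "r * exp W = R * q * exp (- 2 * W)" unfolding r_def W_def[symmetric] by (simp flip: exp_add)
    also have "\<dots> \<le> R * (1/2) * 1" using R q W0 M0 by (intro mult_mono) (auto simp: q_def field_simps)
    finally show ?thesis using R by simp
  qed
  have rR: "r \<le> R * q"
    unfolding r_def using R q mult_left_mono[of "exp (- 3 * W)" 1 "R * q"] W0 by (simp add: W_def)
  define T where "T \<sigma> y = b (weighted_scaling w (\<sigma> y) y)" for \<sigma> y
  define S where "S j = (T ^^ j) (\<lambda>_. 0)" for j
  have S0: "S 0 = (\<lambda>_. 0)" and SS: "S (Suc j) = T (S j)" for j by (simp_all add: S_def)
  have inv: "mpowser_le r (1 - (1/2) ^ j) (S j) \<and> mpowser_le r ((1/2) ^ Suc j) (\<lambda>y. S (Suc j) y - S j y)" for j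
  proof (induction j)
    case 0
    have "mpowser_le r (r / R * M) b"
      by (rule mpowser_shrink[OF b r order_trans[OF rR] b0]) (use q R mult_left_mono[of q 1 R] in simp)
    moreover have "r / R * M \<le> 1 / 2"
    proof -
      have "r / R \<le> q" using rR R by (simp add: field_simps)
      then have "r / R * M \<le> q * M" using M0 by (intro mult_right_mono)
      then show ?thesis using q(3) by (rule order_trans)
    qed
    ultimately have "mpowser_le r (1/2) b" by (rule mpowser_mono)
    then show ?case using mpowser_const[of r 0] r by (simp add: S0 SS T_def[abs_def])
  next
    case (Suc j)
    have 1: "mpowser_le r (1 - (1/2) ^ Suc j) (S (Suc j))"
      using mpowser_add[OF r conjunct1[OF Suc] conjunct2[OF Suc]] by simp
    have le1: "(1/2::real) ^ Suc j \<le> 1" by (rule power_le_one) auto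
    have "mpowser_le r ((1/2) ^ Suc j / 2) (\<lambda>y. T (S (Suc j)) y - T (S j) y)"
      unfolding T_def
      by (rule mpowser_weighted_scaling_contraction[OF b R b0 q r_def _ _ conjunct2[OF Suc] _ le1])
        (use 1 Suc in \<open>auto intro: mpowser_mono simp del: power_Suc\<close>)
    then show ?case using 1 by (simp add: SS)
  qed
  have Sb: "mpowser_le r 1 (S j)" for j by (rule mpowser_mono[OF conjunct1[OF inv[of j]]]) simp
  have hs: "((\<lambda>j. (1/2::real) ^ Suc j) has_sum 1) UNIV"
    by (intro sums_nonneg_imp_has_sum) (use power_half_series in \<open>auto simp del: power_Suc\<close>)
  define \<sigma> where "\<sigma> y = (\<Sum>\<^sub>\<infinity>j. S (Suc j) y - S j y)" for y
  have hs\<sigma>: "((\<lambda>j. S (Suc j) y - S j y) has_sum \<sigma> y) UNIV" if "y \<in> polydisc r" for y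
    unfolding \<sigma>_def
    by (rule has_sum_infsum, rule abs_summable_summable,
        rule Infinite_Sum.abs_summable_on_comparison_test'[OF has_sum_imp_summable[OF hs]],
        rule mpowser_bound[OF conjunct2[OF inv] that])
  have p\<sigma>: "mpowser_le r 1 \<sigma>"
    using mpowser_sum[OF r conjunct2[OF inv] has_sum_imp_summable[OF hs] hs\<sigma>] infsumI[OF hs] by simp
  have lim: "(\<lambda>j. S j y) \<longlonglongrightarrow> \<sigma> y" if "y \<in> polydisc r" for y
  proof -
    have "(\<lambda>n. \<Sum>j<n. S (Suc j) y - S j y) \<longlonglongrightarrow> \<sigma> y"
      using has_sum_imp_sums[OF hs\<sigma>[OF that]] by (simp add: sums_def)
    moreover have "(\<Sum>j<n. S (Suc j) y - S j y) = S n y" for n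
      using sum_lessThan_telescope[of "\<lambda>j. S j y" n] by (simp add: S0)
    ultimately show ?thesis by simp
  qed
  show ?thesis
  proof (rule that[OF r p\<sigma>])
    fix y :: "'k ^ 'n" assume y: "y \<in> polydisc r"
    have "weighted_scaling w (\<sigma> y) y \<in> open_polydisc R"
      unfolding open_polydisc_def
    proof (intro CollectI allI)
      fix i
      have "norm (weighted_scaling w (\<sigma> y) y $ i) \<le> exp (W * norm (\<sigma> y)) * norm (y $ i)"
        unfolding W_def by (rule norm_weighted_scaling_nth_le)
      also have "\<dots> \<le> exp W * r"
        using mpowser_bound[OF p\<sigma> y] y W0 r by (intro mult_mono) (auto simp: polydisc_def mult_left_le)
      finally have "norm (weighted_scaling w (\<sigma> y) y $ i) \<le> exp W * r" .
      then show "norm (weighted_scaling w (\<sigma> y) y $ i) < R" using rW by (simp add: mult.commute)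
    qed
    then have "isCont b (weighted_scaling w (\<sigma> y) y)" by (rule mpowser_isCont[OF b R])
    moreover have "(\<lambda>j. weighted_scaling w (S j y) y) \<longlonglongrightarrow> weighted_scaling w (\<sigma> y) y"
      unfolding weighted_scaling_def by (intro tendsto_intros lim y)
    ultimately have "(\<lambda>j. b (weighted_scaling w (S j y) y)) \<longlonglongrightarrow> b (weighted_scaling w (\<sigma> y) y)"
      by (rule isCont_tendsto_compose)
    then have "(\<lambda>j. S (Suc j) y) \<longlonglongrightarrow> b (weighted_scaling w (\<sigma> y) y)" by (simp add: SS T_def)
    moreover have "(\<lambda>j. S (Suc j) y) \<longlonglongrightarrow> \<sigma> y" using lim[OF y] by (rule LIMSEQ_Suc)
    ultimately show "\<sigma> y = b (weighted_scaling w (\<sigma> y) y)" using LIMSEQ_unique by blast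
  qed
qed

text \<open>The quotient \<open>f / f(0)\<close> is close to 1 on a small polydisc, where the logarithmic series converges.
  Stating the logarithmic series as an assumption covers both ground fields at once.\<close>

lemma analytic_log:
  fixes f :: "'k::{real_normed_field, euclidean_space} ^ 'n::finite \<Rightarrow> 'k"
  assumes log: "\<And>u::'k. norm u < 1 \<Longrightarrow> \<exists>l. exp l = 1 + u \<and> (\<lambda>n. - ((- u) ^ n) / of_nat n) sums l"
    and f: "mpowser_le r M f" and r: "r > 0" and z: "f 0 = exp z"
  obtains l s N where "s > 0" "mpowser_le s N l" "l 0 = z" "\<And>x. x \<in> polydisc s \<Longrightarrow> exp (l x) = f x"
proof -
  define g where "g x = exp (- z) * f x - 1" for x
  have "mpowser_le r (norm (exp (- z)) * M + norm (- 1 :: 'k)) (\<lambda>x. exp (- z) * f x + - 1)"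
    using r f by (intro mpowser_add mpowser_mult mpowser_const) auto
  then have g: "mpowser_le r (norm (exp (- z)) * M + 1) g" by (simp add: g_def[abs_def])
  have g0: "g 0 = 0" by (simp add: g_def z flip: exp_add)
  define N where "N = norm (exp (- z)) * M + 1"
  have N: "N \<ge> 1" 
  proof -
    have "0 \<le> M" using mpowser_bound[OF f zero_in_polydisc] r norm_ge_zero[of "f 0"] by (meson less_imp_le order_trans)
    then show ?thesis by (simp add: N_def)
  qed
  define s where "s = r / (2 * N)"
  have s: "0 < s" "s \<le> r" using r N by (auto simp: s_def field_simps)
  have sg: "mpowser_le s (1/2) g"
    using mpowser_shrink[OF g s g0] r N by (simp add: s_def N_def[symmetric])
  define L where "L u = (SOME l. exp l = 1 + u \<and> (\<lambda>n. - ((- u) ^ n) / of_nat n) sums l)" for u :: 'k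
  have L: "exp (L u) = 1 + u" "(\<lambda>n. - ((- u) ^ n) / of_nat n) sums L u" if "norm u < 1" for u
    using someI_ex[OF log[OF that]] by (auto simp: L_def)
  let ?a = "\<lambda>n. - ((- 1) ^ n) / of_nat n :: 'k"
  have a: "?a n * u ^ n = - ((- u) ^ n) / of_nat n" for n u
    by (simp add: power_minus[of u])
  have "summable (\<lambda>n. norm (?a n) * (1/2) ^ n)"
  proof (rule summable_comparison_test'[of "\<lambda>n. (1/2::real) ^ n" 0])
    fix n
    have "norm (?a n) \<le> 1" by (cases n) (auto simp: norm_divide norm_power simp del: of_nat_Suc)
    then show "norm (norm (?a n) * (1/2) ^ n) \<le> (1/2) ^ n"
      by (simp add: abs_mult mult_left_le_one_le)
  qed simp
  from mpowser_compose_powser[OF s(1) sg _ this, of L]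
  have pL: "mpowser_le s (\<Sum>n. norm (?a n) * (1/2) ^ n) (\<lambda>x. L (g x))"
    using L(2) unfolding a by auto
  have "mpowser_le s (norm z + (\<Sum>n. norm (?a n) * (1/2) ^ n)) (\<lambda>x. z + L (g x))"
    using s by (intro mpowser_add mpowser_const pL) auto
  moreover have "z + L (g 0) = z"
  proof -
    have "(\<lambda>n. - ((- 0) ^ n) / of_nat n :: 'k) = (\<lambda>_. 0)" by (auto simp: power_0_left)
    then have "(\<lambda>_. 0) sums L 0" using L(2)[of 0] by simp
    then show ?thesis using sums_unique2 sums_zero g0 by auto
  qed
  moreover have "exp (z + L (g x)) = f x" if "x \<in> polydisc s" for x
  proof -
    have "exp (L (g x)) = 1 + g x" using mpowser_bound[OF sg that] by (intro L) simp
    then have "exp (z + L (g x)) = exp z * (exp (- z) * f x)" by (simp add: exp_add g_def)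
    then show ?thesis by (simp add: mult.assoc[symmetric] flip: exp_add)
  qed
  ultimately show ?thesis by (rule that[where l = "\<lambda>x. z + L (g x)", OF s(1)])
qed

section \<open>Classes of regular function germs\<close>

text \<open>What the geometric argument uses of a class of function germs. The parameter \<open>reg\<close> only fixes the
  ground field and the dimension.\<close>

locale regular_calculus =
  fixes C :: regularity and reg :: "('k::{real_normed_field, euclidean_space} ^ 'n::finite \<Rightarrow> 'k) \<Rightarrow> bool"
  assumes reg_eq: "reg = regular C"
    and reg_cong: "reg f \<Longrightarrow> \<forall>\<^sub>F x in nhds 0. f x = g x \<Longrightarrow> reg g"
    and reg_const: "reg (\<lambda>_. a)"
    and reg_coord: "reg (\<lambda>x. x $ i)"
    and reg_add: "reg f \<Longrightarrow> reg g \<Longrightarrow> reg (\<lambda>x. f x + g x)"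
    and reg_mult: "reg f \<Longrightarrow> reg g \<Longrightarrow> reg (\<lambda>x. f x * g x)"
    and reg_compose: "reg f \<Longrightarrow> (\<And>i. reg (\<lambda>x. \<phi> x $ i)) \<Longrightarrow> \<phi> 0 = 0 \<Longrightarrow> reg (\<lambda>x. f (\<phi> x))"
    and reg_exp: "reg f \<Longrightarrow> reg (\<lambda>x. exp (f x))"
    and reg_log: "reg f \<Longrightarrow> f 0 = exp z \<Longrightarrow> \<exists>l. reg l \<and> l 0 = z \<and> (\<forall>\<^sub>F x in nhds 0. exp (l x) = f x)"
    and reg_smooth: "reg f \<Longrightarrow> smooth_at_0 f"
    and reg_partial_deriv: "reg f \<Longrightarrow> reg (partial_deriv i f)"
    and reg_has_derivative: "reg f \<Longrightarrow>
      \<forall>\<^sub>F x in nhds 0. (f has_derivative (\<lambda>v. \<Sum>i\<in>UNIV. v $ i * partial_deriv i f x)) (at x)"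
    and reg_euler_equation: "reg f \<Longrightarrow> (total_weight w) > 0 \<Longrightarrow> \<exists>F. reg F \<and> (\<forall>\<^sub>F x in nhds 0.
      (\<Sum>i\<in>UNIV. of_nat (w i) * x $ i * partial_deriv i F x) + of_nat (total_weight w) * F x = f x)"
    and reg_scaling_fixpoint: "reg b \<Longrightarrow> b 0 = 0 \<Longrightarrow> \<exists>\<sigma>. reg \<sigma> \<and>
      (\<forall>\<^sub>F y in nhds 0. \<sigma> y = b (weighted_scaling w (\<sigma> y) y))"

lemma eventually_open_polydisc: "r > 0 \<Longrightarrow> \<forall>\<^sub>F x in nhds (0 :: 'k::real_normed_vector ^ 'n::finite). x \<in> open_polydisc r"
  by (rule eventually_nhds_in_open[OF open_open_polydisc]) simp

lemma eventually_polydisc: "r > 0 \<Longrightarrow> \<forall>\<^sub>F x in nhds (0 :: 'k::real_normed_vector ^ 'n::finite). x \<in> polydisc r"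
  using eventually_open_polydisc by (rule eventually_mono) (auto dest: subsetD[OF open_polydisc_subset_polydisc])

lemma eventually_at_right_0_between: "r > 0 \<Longrightarrow> \<forall>\<^sub>F t in at_right 0. 0 < t \<and> t \<le> (r::real)"
  by (auto simp: eventually_at_right_field intro!: exI[of _ r])

text \<open>Uniformity for all small radii lets several germs be treated on a common polydisc.\<close>

lemma analytic_at_0_iff_eventually:
  fixes f :: "'k::{real_normed_field, euclidean_space} ^ 'n::finite \<Rightarrow> 'k"
  shows "analytic_at_0 f \<longleftrightarrow> (\<exists>M. \<forall>\<^sub>F t in at_right 0. mpowser_le t M f)"
proof
  assume "analytic_at_0 f"
  then obtain r M where r: "r > 0" and f: "mpowser_le r M f" by (auto simp: analytic_at_0_iff_mpowser)
  have "\<forall>\<^sub>F t in at_right 0. mpowser_le t M f"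
    using eventually_at_right_0_between[OF r] by (rule eventually_mono) (use mpowser_shrink_radius[OF f] in blast)
  then show "\<exists>M. \<forall>\<^sub>F t in at_right 0. mpowser_le t M f" by blast
next
  assume "\<exists>M. \<forall>\<^sub>F t in at_right 0. mpowser_le t M f"
  then obtain M where "\<forall>\<^sub>F t in at_right 0. mpowser_le t M f" by blast
  then have "\<forall>\<^sub>F t in at_right 0. 0 < t \<and> mpowser_le t M f"
    using eventually_at_right_0_between[OF zero_less_one] by eventually_elim auto
  then show "analytic_at_0 f"
    unfolding analytic_at_0_iff_mpowser using eventually_happens trivial_limit_at_right_real by blast
qed

lemma eventually_mpowser_small:
  fixes f :: "'k::{real_normed_field, euclidean_space} ^ 'n::finite \<Rightarrow> 'k"
  assumes "analytic_at_0 f" "f 0 = 0" "\<epsilon> > 0"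
  shows "\<forall>\<^sub>F t in at_right 0. mpowser_le t \<epsilon> f"
proof -
  obtain r M where r: "r > 0" and f: "mpowser_le r M f" using assms(1) by (auto simp: analytic_at_0_iff_mpowser)
  have M: "M \<ge> 0" using mpowser_bound[OF f zero_in_polydisc] r assms(2) by simp
  have "r * \<epsilon> / (M + 1) > 0" using r M assms by simp
  from eventually_at_right_0_between[OF this] show ?thesis
    using eventually_at_right_0_between[OF r]
  proof eventually_elim
    case (elim t)
    have "t * (M + 1) \<le> r * \<epsilon>" using elim M by (simp add: field_simps)
    then have "t / r * M \<le> \<epsilon>" using r elim by (simp add: field_simps)
    then show ?case using mpowser_mono[OF mpowser_shrink[OF f _ _ assms(2)]] elim by blast
  qed
qed

lemma analytic_regular_calculus:
  assumes log: "\<And>u::'k::{real_normed_field, euclidean_space}. norm u < 1 \<Longrightarrow>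
    \<exists>l. exp l = 1 + u \<and> (\<lambda>n. - ((- u) ^ n) / of_nat n) sums l"
  shows "regular_calculus Analytic (analytic_at_0 :: ('k ^ 'n::finite \<Rightarrow> 'k) \<Rightarrow> bool)"
proof
  show "analytic_at_0 = (regular Analytic :: ('k ^ 'n \<Rightarrow> 'k) \<Rightarrow> bool)" by (simp add: fun_eq_iff)
next
  fix f g :: "'k ^ 'n \<Rightarrow> 'k"
  assume "analytic_at_0 f" and eq: "\<forall>\<^sub>F x in nhds 0. f x = g x"
  then obtain c r where r: "r > 0"
    and c: "\<And>x. x \<in> ball 0 r \<Longrightarrow> ((\<lambda>\<alpha>. c \<alpha> * (\<Prod>i\<in>UNIV. (x $ i) ^ \<alpha> i)) has_sum f x) UNIV"
    unfolding analytic_at_0_def by blast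
  obtain d where d: "d > 0" "\<And>x. x \<in> ball 0 d \<Longrightarrow> f x = g x"
    using eq unfolding eventually_nhds_metric by (auto simp: dist_commute)
  have "((\<lambda>\<alpha>. c \<alpha> * (\<Prod>i\<in>UNIV. (x $ i) ^ \<alpha> i)) has_sum g x) UNIV" if "x \<in> ball 0 (min r d)" for x
    using c[of x] d(2)[of x] that by simp
  then show "analytic_at_0 g" unfolding analytic_at_0_def
    using r d(1) by (intro exI[of _ c] exI[of _ "min r d"]) auto
next
  show "analytic_at_0 (\<lambda>_ :: 'k ^ 'n. a)" for a :: 'k
    unfolding analytic_at_0_iff_mpowser using mpowser_const[of 1 a] by (intro exI[of _ 1]) auto
  show "analytic_at_0 (\<lambda>x :: 'k ^ 'n. x $ i)" for i
    unfolding analytic_at_0_iff_mpowser using mpowser_coord[of 1 i] by (intro exI[of _ 1]) auto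
next
  fix f g :: "'k ^ 'n \<Rightarrow> 'k"
  assume "analytic_at_0 f" "analytic_at_0 g"
  then obtain M N where f: "\<forall>\<^sub>F t in at_right 0. mpowser_le t M f" and g: "\<forall>\<^sub>F t in at_right 0. mpowser_le t N g"
    unfolding analytic_at_0_iff_eventually by blast
  have "\<forall>\<^sub>F t in at_right 0. mpowser_le t (M + N) (\<lambda>x. f x + g x)"
    using f g eventually_at_right_0_between[OF zero_less_one] by eventually_elim (auto intro: mpowser_add)
  then show "analytic_at_0 (\<lambda>x. f x + g x)" unfolding analytic_at_0_iff_eventually by blast
  have "\<forall>\<^sub>F t in at_right 0. mpowser_le t (M * N) (\<lambda>x. f x * g x)"
    using f g eventually_at_right_0_between[OF zero_less_one] by eventually_elim (auto intro: mpowser_mult)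
  then show "analytic_at_0 (\<lambda>x. f x * g x)" unfolding analytic_at_0_iff_eventually by blast
next
  fix f :: "'k ^ 'n \<Rightarrow> 'k" and \<phi> :: "'k ^ 'n \<Rightarrow> 'k ^ 'n"
  assume "analytic_at_0 f" and \<phi>: "\<And>i. analytic_at_0 (\<lambda>x. \<phi> x $ i)" "\<phi> 0 = 0"
  then obtain r M where r: "r > 0" and f: "mpowser_le r M f" by (auto simp: analytic_at_0_iff_mpowser)
  have "\<forall>\<^sub>F t in at_right 0. \<forall>i. mpowser_le t r (\<lambda>x. \<phi> x $ i)"
    by (intro eventually_all_finite eventually_mpowser_small \<phi> r) (simp add: \<phi>)
  then have "\<forall>\<^sub>F t in at_right 0. mpowser_le t M (\<lambda>x. f (\<phi> x))"
    using eventually_at_right_0_between[OF zero_less_one]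
  proof eventually_elim
    case (elim t)
    show ?case by (rule mpowser_compose[OF f]) (use elim in auto)
  qed
  then show "analytic_at_0 (\<lambda>x. f (\<phi> x))" unfolding analytic_at_0_iff_eventually by blast
next
  fix f :: "'k ^ 'n \<Rightarrow> 'k" assume "analytic_at_0 f"
  then obtain r M where r: "r > 0" and f: "mpowser_le r M f" by (auto simp: analytic_at_0_iff_mpowser)
  have "norm (f 0) \<le> M" using mpowser_bound[OF f zero_in_polydisc] r by simp
  then have M: "M \<ge> 0" using norm_ge_zero order_trans by blast
  show "analytic_at_0 (\<lambda>x. exp (f x))"
    unfolding analytic_at_0_iff_mpowser using mpowser_exp[OF r f M] r by blast
  show "smooth_at_0 f"
    unfolding smooth_at_0_def Cinf_on_def
  proof (intro exI conjI allI)
    show "Ck_on k (open_polydisc r) f" for k by (rule mpowser_Ck_on[OF r]) (rule exI[of _ M], rule mpowser_shrink_radius[OF f], auto)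
  qed (use r open_open_polydisc in auto)
  show "analytic_at_0 (partial_deriv i f)" for i
    unfolding analytic_at_0_iff_mpowser using mpowser_partial_deriv(1)[OF f, of "r/2"] r
    by (intro exI[of _ "r/2"]) auto
  show "\<forall>\<^sub>F x in nhds 0. (f has_derivative (\<lambda>v. \<Sum>i\<in>UNIV. v $ i * partial_deriv i f x)) (at x)"
    using eventually_polydisc[of "r/2"] r
    by (intro eventually_mono[OF eventually_polydisc[of "r/2"] mpowser_partial_deriv(2)[OF f]]) auto
  show "\<exists>l. analytic_at_0 l \<and> l 0 = z \<and> (\<forall>\<^sub>F x in nhds 0. exp (l x) = f x)" if z: "f 0 = exp z" for z
  proof -
    obtain l s N where l: "s > 0" "mpowser_le s N l" "l 0 = z" "\<And>x. x \<in> polydisc s \<Longrightarrow> exp (l x) = f x"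
    proof (rule analytic_log[OF log f r z])
    qed (assumption | rule that)+
    have "\<forall>\<^sub>F x in nhds 0. exp (l x) = f x"
      by (rule eventually_mono[OF eventually_polydisc[OF l(1)] l(4)])
    then show ?thesis unfolding analytic_at_0_iff_mpowser using l(1-3) by blast
  qed
  show "\<exists>F. analytic_at_0 F \<and> (\<forall>\<^sub>F x in nhds 0.
      (\<Sum>i\<in>UNIV. of_nat (w i) * x $ i * partial_deriv i F x) + of_nat (total_weight w) * F x = f x)"
    if w: "total_weight w > 0" for w :: "'n \<Rightarrow> nat"
  proof -
    have r2: "0 < r / 2" "r / 2 < r" using r by auto
    obtain F where F: "mpowser_le r M F"
      "\<And>x. x \<in> open_polydisc (r/2) \<Longrightarrow> (\<Sum>i\<in>UNIV. of_nat (w i) * x $ i * partial_deriv i F x) + of_nat (total_weight w) * F x = f x"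
    proof (rule analytic_euler_equation[OF f r2 w])
    qed (assumption | rule that)+
    have "\<forall>\<^sub>F x in nhds 0. (\<Sum>i\<in>UNIV. of_nat (w i) * x $ i * partial_deriv i F x) + of_nat (total_weight w) * F x = f x"
      by (rule eventually_mono[OF eventually_open_polydisc[OF r2(1)] F(2)])
    then show ?thesis unfolding analytic_at_0_iff_mpowser using F(1) r by blast
  qed
  show "\<exists>\<sigma>. analytic_at_0 \<sigma> \<and> (\<forall>\<^sub>F y in nhds 0. \<sigma> y = f (weighted_scaling w (\<sigma> y) y))" if f0: "f 0 = 0" for w
  proof -
    obtain \<sigma> s where \<sigma>: "s > 0" "mpowser_le s 1 \<sigma>" "\<And>y. y \<in> polydisc s \<Longrightarrow> \<sigma> y = f (weighted_scaling w (\<sigma> y) y)"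
    proof (rule analytic_scaling_fixpoint[OF f r f0])
    qed (assumption | rule that)+
    have "\<forall>\<^sub>F y in nhds 0. \<sigma> y = f (weighted_scaling w (\<sigma> y) y)"
      by (rule eventually_mono[OF eventually_polydisc[OF \<sigma>(1)] \<sigma>(3)])
    then show ?thesis unfolding analytic_at_0_iff_mpowser using \<sigma>(1,2) by blast
  qed
qed

lemma Cinf_on_subset: "Cinf_on S f \<Longrightarrow> T \<subseteq> S \<Longrightarrow> Cinf_on T f"
  by (auto simp: Cinf_on_def intro: Ck_on_subset)

lemma smooth_at_0_iff_eventually:
  fixes f :: "'k::{real_normed_field} ^ 'n::finite \<Rightarrow> 'k"
  shows "smooth_at_0 f \<longleftrightarrow> (\<forall>\<^sub>F r in at_right 0. Cinf_on (ball 0 r) f)"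
proof
  assume "smooth_at_0 f"
  then obtain U where U: "open U" "0 \<in> U" "Cinf_on U f" by (auto simp: smooth_at_0_def)
  then obtain r where r: "r > 0" "ball 0 r \<subseteq> U" using open_contains_ball by blast
  show "\<forall>\<^sub>F r in at_right 0. Cinf_on (ball 0 r) f"
    using eventually_at_right_0_between[OF r(1)]
  proof eventually_elim
    case (elim t)
    then have "ball 0 t \<subseteq> U" using r(2) subset_ball[of t r 0] by blast
    then show ?case by (rule Cinf_on_subset[OF U(3)])
  qed
next
  assume "\<forall>\<^sub>F r in at_right 0. Cinf_on (ball 0 r) f"
  then have "\<forall>\<^sub>F r in at_right 0. r > 0 \<and> Cinf_on (ball 0 r) f"
    using eventually_at_right_0_between[OF zero_less_one] by eventually_elim auto
  then obtain r where "r > 0" "Cinf_on (ball 0 r) f"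
    using eventually_happens trivial_limit_at_right_real by blast
  then show "smooth_at_0 f" unfolding smooth_at_0_def by (intro exI[of _ "ball 0 r"]) auto
qed

lemma smooth_at_0E:
  fixes f :: "'k::{real_normed_field} ^ 'n::finite \<Rightarrow> 'k"
  assumes "smooth_at_0 f"
  obtains r where "r > 0" "Cinf_on (ball 0 r) f"
proof -
  obtain U where U: "open U" "0 \<in> U" "Cinf_on U f" using assms by (auto simp: smooth_at_0_def)
  then obtain r where "r > 0" "ball 0 r \<subseteq> U" using open_contains_ball by blast
  then show ?thesis using that Cinf_on_subset[OF U(3)] by blast
qed

lemma Ck_on_ln: "Ck_on k {0<..} (ln :: real \<Rightarrow> real)"
proof (cases k)
  case 0
  then show ?thesis by (auto intro!: continuous_intros)
next
  case (Suc m)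
  have 1: "(ln has_derivative (\<lambda>v. v * inverse x)) (at x)" if "x \<in> {0<..}" for x :: real
    using DERIV_ln[of x] that by (simp add: has_field_derivative_def mult.commute[of _ "inverse x"])
  have 2: "Ck_on m {0<..} (\<lambda>x. v * inverse x)" for v :: real
    by (intro Ck_on_mult Ck_on_const Ck_on_subset[OF Ck_on_inverse]) auto
  show ?thesis unfolding Suc
    by (rule Ck_on_SucI[where D = "\<lambda>x v. v * inverse x", OF _ 1 2]) auto
qed

lemma smooth_regular_calculus: "regular_calculus Smooth (smooth_at_0 :: (real ^ 'n::finite \<Rightarrow> real) \<Rightarrow> bool)"
proof
  show "smooth_at_0 = (regular Smooth :: (real ^ 'n \<Rightarrow> real) \<Rightarrow> bool)" by (simp add: fun_eq_iff)
next
  fix f g :: "real ^ 'n \<Rightarrow> real"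
  assume "smooth_at_0 f" and eq: "\<forall>\<^sub>F x in nhds 0. f x = g x"
  then obtain U where U: "open U" "0 \<in> U" "Cinf_on U f" by (auto simp: smooth_at_0_def)
  obtain V where V: "open V" "0 \<in> V" "\<And>x. x \<in> V \<Longrightarrow> f x = g x" using eq by (auto simp: eventually_nhds)
  have "Ck_on k (U \<inter> V) g" for k
    by (rule Ck_on_cong[of "U \<inter> V" f]) (use U V in \<open>auto intro: Ck_on_subset[OF Cinf_on_Ck]\<close>)
  then show "smooth_at_0 g" unfolding smooth_at_0_def Cinf_on_def
    using U V by (intro exI[of _ "U \<inter> V"]) auto
next
  show "smooth_at_0 (\<lambda>_ :: real ^ 'n. a)" for a :: real
    unfolding smooth_at_0_def Cinf_on_def by (intro exI[of _ UNIV]) (auto intro: Ck_on_const)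
  show "smooth_at_0 (\<lambda>x :: real ^ 'n. x $ i)" for i
    unfolding smooth_at_0_def Cinf_on_def
    by (intro exI[of _ UNIV]) (auto intro: Ck_on_bounded_linear bounded_linear_vec_nth)
next
  fix f g :: "real ^ 'n \<Rightarrow> real"
  assume f: "smooth_at_0 f" and g: "smooth_at_0 g"
  show "smooth_at_0 (\<lambda>x. f x + g x)"
    using f g unfolding smooth_at_0_iff_eventually
    by eventually_elim (auto simp: Cinf_on_def intro: Ck_on_add)
  show "smooth_at_0 (\<lambda>x. f x * g x)"
    using f g unfolding smooth_at_0_iff_eventually
    by eventually_elim (auto simp: Cinf_on_def intro: Ck_on_mult)
next
  fix f :: "real ^ 'n \<Rightarrow> real" and \<phi> :: "real ^ 'n \<Rightarrow> real ^ 'n"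
  assume "smooth_at_0 f" and \<phi>: "\<And>i. smooth_at_0 (\<lambda>x. \<phi> x $ i)" "\<phi> 0 = 0"
  then obtain U where U: "open U" "0 \<in> U" "Cinf_on U f" by (auto simp: smooth_at_0_def)
  have "\<forall>\<^sub>F r in at_right 0. \<forall>i. Cinf_on (ball 0 r) (\<lambda>x. \<phi> x $ i)"
    using \<phi> by (intro eventually_all_finite) (simp add: smooth_at_0_iff_eventually)
  then have "\<forall>\<^sub>F r in at_right 0. 0 < r \<and> (\<forall>i. Cinf_on (ball 0 r) (\<lambda>x. \<phi> x $ i))"
    using eventually_at_right_0_between[OF zero_less_one] by eventually_elim auto
  then obtain r where r: "r > 0" "\<And>i. Cinf_on (ball 0 r) (\<lambda>x. \<phi> x $ i)"
    using eventually_happens trivial_limit_at_right_real by blast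
  have C\<phi>: "Ck_on k (ball 0 r) \<phi>" for k
    by (rule Ck_on_vec[OF open_ball Cinf_on_Ck[OF r(2)]])
  define S where "S = ball 0 r \<inter> \<phi> -` U"
  have S: "open S" unfolding S_def
    by (rule continuous_open_preimage[OF Ck_on_continuous_on[OF C\<phi>] open_ball U(1)])
  have "Ck_on k S (\<lambda>x. f (\<phi> x))" for k
    by (rule Ck_on_compose[OF S _ Ck_on_subset[OF C\<phi>] Cinf_on_Ck[OF U(3)]]) (auto simp: S_def)
  then show "smooth_at_0 (\<lambda>x. f (\<phi> x))" unfolding smooth_at_0_def Cinf_on_def
    using S r U \<phi> by (intro exI[of _ S]) (auto simp: S_def)
next
  fix f :: "real ^ 'n \<Rightarrow> real" assume f: "smooth_at_0 f"
  show "smooth_at_0 (\<lambda>x. exp (f x))"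
    using f unfolding smooth_at_0_iff_eventually
    by eventually_elim (auto simp: Cinf_on_def intro: Ck_on_compose[OF _ _ _ Ck_on_exp])
  show "smooth_at_0 f" by (rule f)
  obtain r where r: "r > 0" "Cinf_on (ball 0 r) f" using smooth_at_0E[OF f] .
  have lin: "(g has_derivative (\<lambda>v. \<Sum>i\<in>UNIV. v $ i * frechet_derivative g (at x) (axis i 1))) (at x)"
    if "(g has_derivative frechet_derivative g (at x)) (at x)" for g :: "real ^ 'n \<Rightarrow> real" and x
    by (rule has_derivative_eq_rhs[OF that], rule ext, rule has_derivative_coords[OF that, unfolded real_scaleR_def])
  have D: "(f has_derivative (\<lambda>v. \<Sum>i\<in>UNIV. v $ i * frechet_derivative f (at x) (axis i 1))) (at x)" if "x \<in> ball 0 r" for x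
    by (rule lin[OF Ck_on_SucD(1)[OF Cinf_on_Ck[OF r(2)] that]])
  have eq: "partial_deriv i f x = frechet_derivative f (at x) (axis i 1)" if "x \<in> ball 0 r" for x i
    by (rule partial_deriv_eqI[OF D[OF that]])
  have "Ck_on k (ball 0 r) (partial_deriv i f)" for k i
    by (rule Ck_on_cong[OF open_ball _ Ck_on_SucD(2)[OF Cinf_on_Ck[OF r(2)]]]) (use eq in auto)
  then show "smooth_at_0 (partial_deriv i f)" for i
    unfolding smooth_at_0_def Cinf_on_def using r(1) by (intro exI[of _ "ball 0 r"]) auto
  have ev: "\<forall>\<^sub>F x in nhds 0. x \<in> ball (0 :: real ^ 'n) r"
    using r(1) by (intro eventually_nhds_in_open) auto
  then show "\<forall>\<^sub>F x in nhds 0. (f has_derivative (\<lambda>v. \<Sum>i\<in>UNIV. v $ i * partial_deriv i f x)) (at x)"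
    by (rule eventually_mono) (use D eq in simp)
  have cf: "continuous_on (ball 0 r) f" by (rule Ck_on_continuous_on[OF Cinf_on_Ck[OF r(2)]])
  show "\<exists>l. smooth_at_0 l \<and> l 0 = z \<and> (\<forall>\<^sub>F x in nhds 0. exp (l x) = f x)" if z: "f 0 = exp z" for z
  proof (intro exI conjI)
    define S where "S = ball 0 r \<inter> f -` {0<..}"
    have S: "open S" unfolding S_def by (rule continuous_open_preimage[OF cf]) auto
    have S0: "0 \<in> S" using r z by (simp add: S_def)
    have "Ck_on k S (\<lambda>x. ln (f x))" for k
      by (rule Ck_on_compose[OF S _ Ck_on_subset[OF Cinf_on_Ck[OF r(2)]] Ck_on_ln]) (auto simp: S_def)
    then show "smooth_at_0 (\<lambda>x. ln (f x))" unfolding smooth_at_0_def Cinf_on_def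
      using S S0 by blast
    show "ln (f 0) = z" by (simp add: z)
    show "\<forall>\<^sub>F x in nhds 0. exp (ln (f x)) = f x"
      using eventually_nhds_in_open[OF S S0] by (rule eventually_mono) (simp add: S_def)
  qed
  show "\<exists>F. smooth_at_0 F \<and> (\<forall>\<^sub>F x in nhds 0.
      (\<Sum>i\<in>UNIV. of_nat (w i) * x $ i * partial_deriv i F x) + of_nat (total_weight w) * F x = f x)"
    if w: "total_weight w > 0" for w :: "'n \<Rightarrow> nat"
  proof -
    obtain F where F: "Cinf_on (ball 0 r) F"
      "\<And>x. x \<in> ball 0 r \<Longrightarrow> frechet_derivative F (at x) (\<chi> i. real (w i) * x $ i) + real (total_weight w) * F x = f x"
    proof (rule smooth_euler_equation[OF r(2) w])
    qed (assumption | rule that)+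
    have "(\<Sum>i\<in>UNIV. of_nat (w i) * x $ i * partial_deriv i F x) + of_nat (total_weight w) * F x = f x"
      if x: "x \<in> ball 0 r" for x
    proof -
      note F' = Ck_on_SucD(1)[OF Cinf_on_Ck[OF F(1)] x]
      have "(F has_derivative (\<lambda>v. \<Sum>i\<in>UNIV. v $ i * frechet_derivative F (at x) (axis i 1))) (at x)"
        by (rule lin[OF F'])
      then have "partial_deriv i F x = frechet_derivative F (at x) (axis i 1)" for i
        by (rule partial_deriv_eqI)
      then show ?thesis
        using F(2)[OF x] unfolding has_derivative_coords[OF F', of "\<chi> i. real (w i) * x $ i"] by simp
    qed
    then show ?thesis using F(1) r(1) eventually_mono[OF ev]
      unfolding smooth_at_0_def by (intro exI[of _ F] conjI exI[of _ "ball 0 r"]) auto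
  qed
  show "\<exists>\<sigma>. smooth_at_0 \<sigma> \<and> (\<forall>\<^sub>F y in nhds 0. \<sigma> y = f (weighted_scaling w (\<sigma> y) y))" if f0: "f 0 = 0" for w
  proof -
    let ?k = "\<lambda>x. weighted_scaling w (- f x) x"
    have "Ck_on k (ball 0 r) (\<lambda>x. exp (of_nat (w i) * - f x) * x $ i)" for k i
    proof (rule Ck_on_mult[OF open_ball _ Ck_on_bounded_linear[OF open_ball bounded_linear_vec_nth]])
      have "Ck_on k (ball 0 r) (\<lambda>x. of_nat (w i) * (- 1) * f x)"
        by (intro Ck_on_mult Ck_on_const open_ball Cinf_on_Ck[OF r(2)])
      from Ck_on_compose[OF open_ball _ this Ck_on_exp]
      show "Ck_on k (ball 0 r) (\<lambda>x. exp (of_nat (w i) * - f x))" by simp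
    qed
    then have Ck: "Cinf_on (ball 0 r) ?k"
      unfolding Cinf_on_def by (intro allI Ck_on_vec open_ball) simp
    have f': "(f has_derivative frechet_derivative f (at 0)) (at 0)"
      by (rule Ck_on_SucD(1)[OF Cinf_on_Ck[OF r(2)]]) (use r in simp)
    have "(?k has_derivative (\<lambda>v. v)) (at 0)"
    proof (rule has_derivative_vec)
      fix i
      show "((\<lambda>x. weighted_scaling w (- f x) x $ i) has_derivative (\<lambda>v. v $ i)) (at 0)"
        unfolding weighted_scaling_nth
        by (rule derivative_eq_intros f' bounded_linear.has_derivative[OF bounded_linear_vec_nth] refl | simp add: f0)+
    qed
    note k' = this
    have "0 \<in> ball (0 :: real ^ 'n) r" using r by simp
    note inverse = smooth_inverse_function[where f = ?k, OF open_ball this Ck weighted_scaling_zero k']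
    obtain V g where V: "open V" "0 \<in> V" "g 0 = 0" "g ` V \<subseteq> ball 0 r" "Cinf_on V g" "\<And>y. y \<in> V \<Longrightarrow> ?k (g y) = y"
    proof (rule inverse)
    qed (assumption | rule that)+
    have "Ck_on k V (\<lambda>y. f (g y))" for k
      by (rule Ck_on_compose[OF V(1,4) Cinf_on_Ck[OF V(5)] Cinf_on_Ck[OF r(2)]])
    moreover have "f (g y) = f (weighted_scaling w (f (g y)) y)" if "y \<in> V" for y
    proof -
      have "weighted_scaling w (f (g y)) y = weighted_scaling w (f (g y)) (?k (g y))" using V(6)[OF that] by simp
      also have "\<dots> = g y" by (rule weighted_scaling_minus)
      finally show ?thesis by simp
    qed
    ultimately show ?thesis
      unfolding smooth_at_0_def Cinf_on_def using V(1,2) eventually_mono[OF eventually_nhds_in_open[OF V(1,2)]]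
      by (intro exI[of _ "\<lambda>y. f (g y)"] conjI exI[of _ V]) auto
  qed
qed

lemma real_log_series: "\<bar>u::real\<bar> < 1 \<Longrightarrow> \<exists>l. exp l = 1 + u \<and> (\<lambda>n. - ((- u) ^ n) / of_nat n) sums l"
  using ln_series'[of u] by (intro exI[of _ "ln (1 + u)"]) auto

lemma complex_log_series: "norm (u::complex) < 1 \<Longrightarrow> \<exists>l. exp l = 1 + u \<and> (\<lambda>n. - ((- u) ^ n) / of_nat n) sums l"
proof -
  assume u: "norm u < 1"
  then have "1 + u \<noteq> 0" by (auto simp: add_eq_0_iff)
  then show ?thesis using Ln_series'[OF u] by (intro exI[of _ "Ln (1 + u)"]) simp
qed

section \<open>Alternating forms and determinants\<close>

lemma alternating_formD:
  assumes "alternating_form \<eta>"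
  shows "\<eta> (v(i := x + y)) = \<eta> (v(i := x)) + \<eta> (v(i := y))"
    and "\<eta> (v(i := c *s x)) = c * \<eta> (v(i := x))"
    and "i \<noteq> j \<Longrightarrow> v i = v j \<Longrightarrow> \<eta> v = 0"
  using assms unfolding alternating_form_def Vector_Spaces.linear_iff by blast+

lemma alternating_formI:
  assumes "\<And>v i x y. \<eta> (v(i := x + y)) = \<eta> (v(i := x)) + \<eta> (v(i := y))"
    and "\<And>v i c x. \<eta> (v(i := c *s x)) = c * \<eta> (v(i := x))"
    and "\<And>v i j. i \<noteq> j \<Longrightarrow> v i = v j \<Longrightarrow> \<eta> v = 0"
  shows "alternating_form \<eta>"
  using assms unfolding alternating_form_def Vector_Spaces.linear_iff
  by (auto simp: vec.vector_space_axioms vector_space_over_itself.vector_space_axioms)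

lemma alternating_form_sum:
  assumes "alternating_form \<eta>"
  shows "\<eta> (v(i := (\<Sum>j\<in>J. c j *s x j))) = (\<Sum>j\<in>J. c j * \<eta> (v(i := x j)))"
proof -
  have zero: "\<eta> (v(i := 0)) = 0"
    using alternating_formD(2)[OF assms, of v i 0 "v i"] by (simp only: vector_smult_lzero mult_zero_left)
  show ?thesis
  proof (induction J rule: infinite_finite_induct)
    case (infinite A)
    show ?case by (simp only: sum.infinite[OF infinite] zero)
  next
    case (insert j J)
    show ?case
      by (simp only: sum.insert[OF insert.hyps] alternating_formD(1,2)[OF assms] insert.IH)
  qed (simp_all only: sum.empty zero)
qed

lemma alternating_form_swap:
  assumes \<eta>: "alternating_form \<eta>" and ab: "a \<noteq> b"
  shows "\<eta> (v \<circ> Transposition.transpose a b) = - \<eta> v"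
proof -
  let ?D = "\<lambda>x y. \<eta> (v(a := x, b := y))"
  have add: "?D (x + x') y = ?D x y + ?D x' y" "?D x (y + y') = ?D x y + ?D x y'" for x x' y y'
    using alternating_formD(1)[OF \<eta>, of "v(b := y)" a x x'] alternating_formD(1)[OF \<eta>, of "v(a := x)" b y y'] ab
    by (auto simp: fun_upd_twist)
  have "?D x x = 0" for x
    by (rule alternating_formD(3)[OF \<eta>, of a b]) (use ab in auto)
  moreover have "?D (x + y) (x + y) = ?D x x + ?D x y + (?D y x + ?D y y)" for x y
    by (simp only: add add_ac)
  ultimately have "0 = ?D (v a) (v b) + ?D (v b) (v a)"
    by (metis add.left_neutral add.right_neutral)
  moreover have "v(a := v a, b := v b) = v" by simp
  moreover have "v(a := v b, b := v a) = v \<circ> Transposition.transpose a b"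
    by (auto simp: fun_eq_iff Transposition.transpose_def)
  ultimately have "0 = \<eta> v + \<eta> (v \<circ> Transposition.transpose a b)" by (simp only:)
  then show ?thesis by (metis add.commute eq_neg_iff_add_eq_0)
qed

lemma vec_eq_sum_basis: "(x :: 'k::field ^ 'n::finite) = (\<Sum>j\<in>UNIV. x $ j *s axis j 1)"
  by (simp add: vec_eq_iff axis_def if_distrib[of "(*) _"] cong: if_cong)

text \<open>By multilinearity it suffices to treat tuples of basis vectors. Repeated vectors give 0, and a
  permutation of the basis is a product of transpositions, each of which changes only the sign.\<close>

lemma alternating_form_eq_0:
  fixes \<eta> :: "('n::finite \<Rightarrow> 'k::field ^ 'n) \<Rightarrow> 'k"
  assumes \<eta>: "alternating_form \<eta>" and 0: "\<eta> (\<lambda>i. axis i 1) = 0"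
  shows "\<eta> v = 0"
proof -
  have perm: "\<eta> ((\<lambda>i. axis i 1) \<circ> p) = 0" if "p permutes (UNIV :: 'n set)" for p
    using finite_class.finite_UNIV that
  proof (induction p rule: permutes_rev_induct)
    case id
    then show ?case using 0 by simp
  next
    case (swap a b p)
    show ?case
    proof (cases "a = b")
      case False
      then show ?thesis
        using alternating_form_swap[OF \<eta> False, of "(\<lambda>i. axis i 1) \<circ> p"] swap
        by (simp only: o_assoc neg_0_equal_iff_equal neg_equal_0_iff_equal)
    qed (use swap in simp)
  qed
  have "\<forall>v. (\<forall>i. i \<notin> T \<longrightarrow> (\<exists>j. v i = axis j 1)) \<longrightarrow> \<eta> v = 0" if "finite T" for T
    using that
  proof (induction T rule: finite_induct)
    case empty
    show ?case
    proof (intro allI impI)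
      fix v :: "'n \<Rightarrow> 'k ^ 'n" assume "\<forall>i. i \<notin> {} \<longrightarrow> (\<exists>j. v i = axis j 1)"
      then obtain p where p: "\<And>i. v i = axis (p i) 1" by (metis empty_iff)
      show "\<eta> v = 0"
      proof (cases "inj p")
        case True
        then have "p permutes UNIV"
          using finite_UNIV_inj_surj[OF _ True] by (intro bij_imp_permutes) (auto simp: bij_betw_def)
        moreover have "v = (\<lambda>i. axis i 1) \<circ> p" using p by auto
        ultimately show ?thesis using perm by simp
      next
        case False
        then obtain i j where "i \<noteq> j" "p i = p j" by (auto simp: inj_def)
        then show ?thesis using alternating_formD(3)[OF \<eta>, of i j v] p by simp
      qed
    qed
  next
    case (insert k T)
    show ?case
    proof (intro allI impI)
      fix v :: "'n \<Rightarrow> 'k ^ 'n" assume v: "\<forall>i. i \<notin> insert k T \<longrightarrow> (\<exists>j. v i = axis j 1)"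
      have "\<eta> v = \<eta> (v(k := (\<Sum>j\<in>UNIV. v k $ j *s axis j 1)))"
        by (simp flip: vec_eq_sum_basis)
      also have "\<dots> = (\<Sum>j\<in>UNIV. v k $ j * \<eta> (v(k := axis j 1)))"
        by (rule alternating_form_sum[OF \<eta>])
      also have "\<dots> = 0"
      proof (intro sum.neutral ballI)
        fix j
        have "\<eta> (v(k := axis j 1)) = 0"
          by (intro insert.IH[rule_format]) (use v in auto)
        then show "v k $ j * \<eta> (v(k := axis j 1)) = 0" by simp
      qed
      finally show "\<eta> v = 0" .
    qed
  qed
  from this[of UNIV] show ?thesis by simp
qed

lemma alternating_form_det: "alternating_form (\<lambda>v. c * det (\<chi> i. v i) :: 'k::field)"
proof (rule alternating_formI)
  fix v :: "'n \<Rightarrow> 'k ^ 'n" and i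
  have e: "(\<chi> k. (v(i := y)) k) = (\<chi> k. if k = i then y else v k)" for y by (simp add: vec_eq_iff)
  show "c * det (\<chi> k. (v(i := x + y)) k) = c * det (\<chi> k. (v(i := x)) k) + c * det (\<chi> k. (v(i := y)) k)" for x y
    unfolding e det_row_add by (simp add: algebra_simps)
  show "c * det (\<chi> k. (v(i := d *s x)) k) = d * (c * det (\<chi> k. (v(i := x)) k))" for d x
    unfolding e det_row_mul by (simp add: algebra_simps)
next
  fix v :: "'n \<Rightarrow> 'k ^ 'n" and i j assume "i \<noteq> j" "v i = v j"
  then have "det (\<chi> i. v i) = 0" by (intro det_identical_rows[of i j]) (auto simp: row_def)
  then show "c * det (\<chi> i. v i) = 0" by simp
qed

text \<open>The difference of the two sides is alternating and vanishes on the standard basis.\<close>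

lemma alternating_form_eq_det:
  fixes \<eta> :: "('n::finite \<Rightarrow> 'k::field ^ 'n) \<Rightarrow> 'k"
  assumes \<eta>: "alternating_form \<eta>"
  shows "\<eta> v = \<eta> (\<lambda>i. axis i 1) * det (\<chi> i. v i)"
proof -
  let ?c = "\<eta> (\<lambda>i. axis i 1)"
  have e: "(\<chi> i. axis i 1) = (mat 1 :: 'k ^ 'n ^ 'n)" by (auto simp: vec_eq_iff mat_def axis_def)
  have diff: "alternating_form (\<lambda>v. \<eta> v - \<theta> v)" if \<theta>: "alternating_form \<theta>" for \<theta>
    by (rule alternating_formI)
      (simp_all only: alternating_formD(1,2)[OF \<eta>] alternating_formD(1,2)[OF \<theta>]
        alternating_formD(3)[OF \<eta>] alternating_formD(3)[OF \<theta>] right_diff_distrib add_diff_add diff_self)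
  have "alternating_form (\<lambda>v. \<eta> v - ?c * det (\<chi> i. v i))"
    by (rule diff[OF alternating_form_det])
  then have "\<eta> v - ?c * det (\<chi> i. v i) = 0"
    by (rule alternating_form_eq_0) (simp add: e det_I)
  then show ?thesis by simp
qed

lemma det_rows_matrix_vector_mult:
  "det (\<chi> i. A *v v i) = det (A :: 'k::field ^ 'n ^ 'n) * det (\<chi> i. v i)"
proof -
  have "(\<chi> i. A *v v i) = (\<chi> i. v i) ** transpose A"
    by (simp add: vec_eq_iff matrix_vector_mult_def matrix_matrix_mult_def transpose_def mult.commute)
  then show ?thesis by (simp add: det_mul)
qed

text \<open>The updated rows are introduced one at a time. Expanding a row produces the determinant of the
  smaller update and one in which that row is a multiple of \<open>b\<close>; there every other update contributes
  nothing, since it would give a second row proportional to \<open>b\<close>.\<close>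

lemma det_rank_one_update:
  fixes a :: "'n::finite \<Rightarrow> 'k::field" and b :: "'k ^ 'n"
  shows "det (\<chi> i. axis i 1 + a i *s b) = 1 + (\<Sum>i\<in>UNIV. a i * b $ i)"
proof -
  let ?e = "\<lambda>i. axis i 1 :: 'k ^ 'n"
  let ?m = "\<lambda>T i. if i \<in> T then ?e i + a i *s b else ?e i"
  have E: "k \<notin> T \<Longrightarrow> det (\<chi> i. if i = k then b else ?m T i) = b $ k" if "finite T" for T k
    using that
  proof (induction T rule: finite_induct)
    case empty
    have "det (\<chi> i. if i = k then \<Sum>j\<in>UNIV. b $ j *s row j (mat 1) else row i (mat 1 :: 'k ^ 'n ^ 'n)) = b $ k * det (mat 1 :: 'k ^ 'n ^ 'n)"
      by (rule cramer_lemma_transpose)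
    moreover have "row j (mat 1 :: 'k ^ 'n ^ 'n) = ?e j" for j
      by (auto simp: row_def mat_def axis_def vec_eq_iff)
    ultimately show ?case
      by (simp only: vec_eq_sum_basis[symmetric] empty_iff if_False det_I mult_1_right)
  next
    case (insert m T)
    let ?c = "\<lambda>i. if i = k then b else ?m T i"
    have "(\<chi> i. if i = k then b else ?m (insert m T) i) = (\<chi> i. if i = m then ?e m + a m *s b else ?c i)"
      using insert.prems insert.hyps by (auto simp: vec_eq_iff)
    moreover have "det (\<chi> i. if i = m then b else ?c i) = 0"
      by (rule det_identical_rows[of m k]) (use insert.prems in \<open>auto simp: row_def vec_eq_iff\<close>)
    moreover have "(\<chi> i. if i = m then ?e m else ?c i) = (\<chi> i. ?c i)"
      using insert.prems insert.hyps by (auto simp: vec_eq_iff)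
    ultimately show ?case using insert.IH insert.prems by (simp add: det_row_add det_row_mul)
  qed
  have "det (\<chi> i. ?m T i) = 1 + (\<Sum>i\<in>T. a i * b $ i)" if "finite T" for T
    using that
  proof (induction T rule: finite_induct)
    case empty
    have "(\<chi> i. ?e i) = (mat 1 :: 'k ^ 'n ^ 'n)" by (auto simp: vec_eq_iff mat_def axis_def)
    then show ?case by (simp add: det_I)
  next
    case (insert k T)
    have "(\<chi> i. ?m (insert k T) i) = (\<chi> i. if i = k then ?e k + a k *s b else ?m T i)"
      using insert.hyps by (auto simp: vec_eq_iff)
    moreover have "(\<chi> i. if i = k then ?e k else ?m T i) = (\<chi> i. ?m T i)"
      using insert.hyps by (auto simp: vec_eq_iff)
    ultimately show ?case using E[OF insert.hyps(1,2)] insert.IH insert.hyps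
      by (simp add: det_row_add det_row_mul)
  qed
  from this[of UNIV] show ?thesis by simp
qed

section \<open>Diffeomorphism germs and densities\<close>

lemma has_derivative_exp_compose:
  fixes g :: "'a::real_normed_vector \<Rightarrow> 'b::{real_normed_field, banach}"
  assumes "(g has_derivative g') (at x)"
  shows "((\<lambda>x. exp (g x)) has_derivative (\<lambda>v. g' v * exp (g x))) (at x)"
proof -
  have "(exp has_derivative (\<lambda>v. v * exp (g x))) (at (g x))"
    using DERIV_exp[of "g x"] by (simp only: has_field_derivative_def mult_commute_abs)
  from has_derivative_compose[OF assms this] show ?thesis .
qed

definition jacobian_matrix :: "('k::real_normed_field ^ 'n::finite \<Rightarrow> 'k ^ 'n) \<Rightarrow> 'k ^ 'n \<Rightarrow> 'k ^ 'n ^ 'n" where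
  "jacobian_matrix \<phi> x = (\<chi> i j. partial_deriv j (\<lambda>x. \<phi> x $ i) x)"

text \<open>The substitution \<open>\<Phi>\<^sub>s\<close>: the flow of the Euler field for a time that depends on the point.\<close>

definition scaling_map :: "('n::finite \<Rightarrow> nat) \<Rightarrow> ('k ^ 'n \<Rightarrow> 'k) \<Rightarrow> 'k::{real_normed_field, banach} ^ 'n \<Rightarrow> 'k ^ 'n" where
  "scaling_map w s x = weighted_scaling w (s x) x"

lemma scaling_map_0 [simp]: "scaling_map w s 0 = 0"
  by (simp add: scaling_map_def)

lemma jacobian_cong_germ:
  assumes "\<forall>\<^sub>F x in nhds 0. \<phi> x = \<psi> x"
  shows "\<forall>\<^sub>F x in nhds 0. jacobian_matrix \<phi> x = jacobian_matrix \<psi> x"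
proof -
  have "\<forall>\<^sub>F x in nhds 0. \<forall>j. partial_deriv j (\<lambda>x. \<phi> x $ i) x = partial_deriv j (\<lambda>x. \<psi> x $ i) x" for i
    by (rule partial_deriv_cong_germ, rule eventually_mono[OF assms]) simp
  then have "\<forall>\<^sub>F x in nhds 0. \<forall>i j. partial_deriv j (\<lambda>x. \<phi> x $ i) x = partial_deriv j (\<lambda>x. \<psi> x $ i) x"
    by (rule eventually_all_finite)
  then show ?thesis by (rule eventually_mono) (simp add: jacobian_matrix_def)
qed

context regular_calculus
begin

lemma reg_sum: "(\<And>i. i \<in> I \<Longrightarrow> reg (f i)) \<Longrightarrow> reg (\<lambda>x. \<Sum>i\<in>I. f i x)"
  by (induction I rule: infinite_finite_induct) (auto intro: reg_const reg_add)

lemma reg_prod: "(\<And>i. i \<in> I \<Longrightarrow> reg (f i)) \<Longrightarrow> reg (\<lambda>x. \<Prod>i\<in>I. f i x)"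
  by (induction I rule: infinite_finite_induct) (auto intro: reg_const reg_mult)

lemma reg_cmult: "reg f \<Longrightarrow> reg (\<lambda>x. a * f x)"
  by (intro reg_mult reg_const)

lemma reg_uminus: "reg f \<Longrightarrow> reg (\<lambda>x. - f x)"
  using reg_cmult[of f "- 1"] by simp

lemma reg_det: "(\<And>i j. reg (\<lambda>x. A x $ i $ j)) \<Longrightarrow> reg (\<lambda>x. det (A x :: 'k ^ 'm::finite ^ 'm))"
  unfolding det_def by (intro reg_sum reg_mult reg_const reg_prod)

definition reg_map :: "('k ^ 'n \<Rightarrow> 'k ^ 'n) \<Rightarrow> bool" where
  "reg_map \<phi> \<longleftrightarrow> (\<forall>i. reg (\<lambda>x. \<phi> x $ i)) \<and> \<phi> 0 = 0"

lemma reg_mapI: "(\<And>i. reg (\<lambda>x. \<phi> x $ i)) \<Longrightarrow> \<phi> 0 = 0 \<Longrightarrow> reg_map \<phi>"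
  by (simp add: reg_map_def)

lemma reg_mapD: "reg_map \<phi> \<Longrightarrow> reg (\<lambda>x. \<phi> x $ i)" "reg_map \<phi> \<Longrightarrow> \<phi> 0 = 0"
  by (simp_all add: reg_map_def)

lemma reg_map_iff: "reg_map \<phi> \<longleftrightarrow> regular_map C \<phi> \<and> \<phi> 0 = 0"
  by (auto simp: reg_map_def regular_map_def reg_eq[symmetric])

lemma diffeos_iff:
  "\<phi> \<in> diffeos C \<longleftrightarrow> reg_map \<phi> \<and> (\<exists>\<psi>. reg_map \<psi> \<and>
     (\<forall>\<^sub>F x in nhds 0. \<psi> (\<phi> x) = x) \<and> (\<forall>\<^sub>F x in nhds 0. \<phi> (\<psi> x) = x))"
  by (simp only: diffeos_def mem_Collect_eq reg_map_iff conj_assoc)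

lemma reg_compose_map: "reg f \<Longrightarrow> reg_map \<phi> \<Longrightarrow> reg (\<lambda>x. f (\<phi> x))"
  by (rule reg_compose) (simp_all only: reg_mapD)

lemma reg_map_compose:
  assumes "reg_map \<phi>" "reg_map \<psi>"
  shows "reg_map (\<lambda>x. \<phi> (\<psi> x))"
  using reg_compose_map[OF reg_mapD(1)[OF assms(1)] assms(2)] assms by (intro reg_mapI) (simp_all add: reg_mapD(2))

lemma reg_scaling_map: "reg s \<Longrightarrow> reg_map (scaling_map w s)"
  using reg_mult[OF reg_exp[OF reg_cmult] reg_coord, of s]
  by (intro reg_mapI) (simp_all add: scaling_map_def)

lemma reg_map_has_derivative:
  assumes "reg_map \<phi>"
  shows "\<forall>\<^sub>F x in nhds 0. (\<phi> has_derivative (\<lambda>v. jacobian_matrix \<phi> x *v v)) (at x)"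
proof -
  have "\<forall>\<^sub>F x in nhds 0. \<forall>i. ((\<lambda>x. \<phi> x $ i) has_derivative
      (\<lambda>v. \<Sum>j\<in>UNIV. v $ j * partial_deriv j (\<lambda>x. \<phi> x $ i) x)) (at x)"
    by (intro eventually_all_finite reg_has_derivative reg_mapD assms)
  then show ?thesis
  proof (rule eventually_mono)
    fix x assume *: "\<forall>i. ((\<lambda>x. \<phi> x $ i) has_derivative
      (\<lambda>v. \<Sum>j\<in>UNIV. v $ j * partial_deriv j (\<lambda>x. \<phi> x $ i) x)) (at x)"
    show "(\<phi> has_derivative (\<lambda>v. jacobian_matrix \<phi> x *v v)) (at x)"
      by (rule has_derivative_vec) (use * in \<open>simp add: jacobian_matrix_def matrix_vector_mult_def mult.commute\<close>)
  qed
qed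

lemma reg_map_frechet_derivative:
  assumes "reg_map \<phi>"
  shows "\<forall>\<^sub>F x in nhds 0. frechet_derivative \<phi> (at x) = (\<lambda>v. jacobian_matrix \<phi> x *v v)"
  using reg_map_has_derivative[OF assms] by (rule eventually_mono) (rule frechet_derivative_at[symmetric])

lemma reg_tendsto:
  assumes "reg f"
  shows "filterlim f (nhds (f 0)) (nhds 0)"
proof -
  have "isCont f 0"
    using eventually_nhds_x_imp_x[OF reg_has_derivative[OF assms]] by (rule has_derivative_continuous)
  then show ?thesis by (simp add: isCont_def tendsto_at_iff_tendsto_nhds)
qed

lemma reg_map_tendsto:
  assumes "reg_map \<phi>"
  shows "filterlim \<phi> (nhds 0) (nhds 0)"
proof -
  have "isCont \<phi> 0"
    using eventually_nhds_x_imp_x[OF reg_map_has_derivative[OF assms]] by (rule has_derivative_continuous)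
  then have "filterlim \<phi> (nhds (\<phi> 0)) (nhds 0)" by (simp only: isCont_def tendsto_at_iff_tendsto_nhds)
  then show ?thesis using reg_mapD(2)[OF assms] by simp
qed

lemma eventually_reg_map:
  "reg_map \<phi> \<Longrightarrow> \<forall>\<^sub>F x in nhds 0. P x \<Longrightarrow> \<forall>\<^sub>F x in nhds 0. P (\<phi> x)"
  by (rule eventually_compose_filterlim[OF _ reg_map_tendsto])

lemma jacobian_compose:
  assumes \<phi>: "reg_map \<phi>" and \<psi>: "reg_map \<psi>"
  shows "\<forall>\<^sub>F x in nhds 0. jacobian_matrix (\<lambda>x. \<phi> (\<psi> x)) x = jacobian_matrix \<phi> (\<psi> x) ** jacobian_matrix \<psi> x"
  using reg_map_has_derivative[OF reg_map_compose[OF \<phi> \<psi>]] reg_map_has_derivative[OF \<psi>]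
    eventually_reg_map[OF \<psi> reg_map_has_derivative[OF \<phi>]]
proof eventually_elim
  case (elim x)
  have "((\<lambda>x. \<phi> (\<psi> x)) has_derivative (\<lambda>v. jacobian_matrix \<phi> (\<psi> x) *v (jacobian_matrix \<psi> x *v v))) (at x)"
    by (rule has_derivative_compose[OF elim(2,3)])
  then have "(\<lambda>v. jacobian_matrix (\<lambda>x. \<phi> (\<psi> x)) x *v v) = (\<lambda>v. jacobian_matrix \<phi> (\<psi> x) *v (jacobian_matrix \<psi> x *v v))"
    using elim(1) has_derivative_unique by blast
  then show ?case by (simp add: matrix_eq matrix_vector_mul_assoc fun_eq_iff)
qed

definition euler_deriv :: "('n \<Rightarrow> nat) \<Rightarrow> ('k ^ 'n \<Rightarrow> 'k) \<Rightarrow> 'k ^ 'n \<Rightarrow> 'k" where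
  "euler_deriv w f x = (\<Sum>i\<in>UNIV. of_nat (w i) * x $ i * partial_deriv i f x)"

text \<open>Up to the diagonal factor \<open>exp (w\<^sub>i s)\<close> the Jacobian matrix is the identity plus the product of
  the column \<open>(w\<^sub>i x\<^sub>i)\<close> and the row of partial derivatives of \<open>s\<close>.\<close>

lemma det_jacobian_scaling_map:
  assumes s: "reg s"
  shows "\<forall>\<^sub>F x in nhds 0. det (jacobian_matrix (scaling_map w s) x) =
    exp (of_nat (total_weight w) * s x) * (1 + euler_deriv w s x)"
  using reg_has_derivative[OF s]
proof (rule eventually_mono)
  fix x assume D: "(s has_derivative (\<lambda>v. \<Sum>i\<in>UNIV. v $ i * partial_deriv i s x)) (at x)"
  let ?E = "\<lambda>i. exp (of_nat (w i) * s x)"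
  let ?b = "\<chi> j. partial_deriv j s x"
  have D': "((\<lambda>x. scaling_map w s x $ i) has_derivative
     (\<lambda>v. \<Sum>j\<in>UNIV. v $ j * (?E i * (axis i 1 + (of_nat (w i) * x $ i) *s ?b) $ j))) (at x)" for i
  proof -
    have "((\<lambda>x. exp (of_nat (w i) * s x)) has_derivative
       (\<lambda>v. (of_nat (w i) * (\<Sum>j\<in>UNIV. v $ j * partial_deriv j s x)) * ?E i)) (at x)"
      by (rule has_derivative_exp_compose[OF has_derivative_mult_right[OF D]])
    from has_derivative_mult[OF this bounded_linear_imp_has_derivative[OF bounded_linear_vec_nth[of i]]]
    have "((\<lambda>x. scaling_map w s x $ i) has_derivative
      (\<lambda>v. ?E i * v $ i + (of_nat (w i) * (\<Sum>j\<in>UNIV. v $ j * partial_deriv j s x)) * ?E i * x $ i)) (at x)"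
      by (simp add: scaling_map_def)
    then show ?thesis
    proof (rule has_derivative_eq_rhs, intro ext)
      fix v :: "'k ^ 'n"
      have "(\<Sum>j\<in>UNIV. v $ j * (?E i * (axis i 1 + (of_nat (w i) * x $ i) *s ?b) $ j)) =
        (\<Sum>j\<in>UNIV. ?E i * (v $ j * axis i 1 $ j)) + (\<Sum>j\<in>UNIV. of_nat (w i) * (v $ j * partial_deriv j s x) * ?E i * x $ i)"
        unfolding sum.distrib[symmetric] by (intro sum.cong refl) (simp add: algebra_simps)
      also have "(\<Sum>j\<in>UNIV. ?E i * (v $ j * axis i 1 $ j)) = ?E i * v $ i"
        by (simp add: axis_def if_distrib[of "(*) _"] cong: if_cong)
      finally show "?E i * v $ i + (of_nat (w i) * (\<Sum>j\<in>UNIV. v $ j * partial_deriv j s x)) * ?E i * x $ i =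
        (\<Sum>j\<in>UNIV. v $ j * (?E i * (axis i 1 + (of_nat (w i) * x $ i) *s ?b) $ j))"
        by (simp add: sum_distrib_left sum_distrib_right)
    qed
  qed
  have "jacobian_matrix (scaling_map w s) x = (\<chi> i. ?E i *s (axis i 1 + (of_nat (w i) * x $ i) *s ?b))"
    by (simp add: jacobian_matrix_def vec_eq_iff partial_deriv_eqI[OF D'] algebra_simps)
  then have "det (jacobian_matrix (scaling_map w s) x) = (\<Prod>i\<in>UNIV. ?E i) * (1 + (\<Sum>i\<in>UNIV. (of_nat (w i) * x $ i) * ?b $ i))"
    by (simp only: det_rows_mul det_rank_one_update)
  also have "(\<Prod>i\<in>UNIV. ?E i) = exp (of_nat (total_weight w) * s x)"
    by (simp add: exp_sum[symmetric] sum_distrib_right)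
  finally show "det (jacobian_matrix (scaling_map w s) x) =
    exp (of_nat (total_weight w) * s x) * (1 + euler_deriv w s x)"
    by (simp add: euler_deriv_def)
qed

text \<open>With \<open>F = c exp (W s)\<close> the left-hand side of the Euler equation becomes
  \<open>c W exp (W s) (1 + E s)\<close>, which is the Jacobian determinant of \<open>\<Phi>\<^sub>s\<close> times a constant.\<close>

lemma density_normal_form:
  assumes \<rho>: "reg \<rho>" and F: "reg F" and W: "total_weight w > 0"
    and eq: "\<forall>\<^sub>F x in nhds 0. euler_deriv w F x + of_nat (total_weight w) * F x = \<rho> x"
    and c: "c \<noteq> 0" and F0: "F 0 = c * exp z"
  obtains s where "reg s" "\<forall>\<^sub>F x in nhds 0. \<rho> x = c * of_nat (total_weight w) * det (jacobian_matrix (scaling_map w s) x)"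
proof -
  let ?W = "of_nat (total_weight w) :: 'k"
  have W0: "?W \<noteq> 0" using W by (simp only: of_nat_eq_0_iff)
  have "reg (\<lambda>x. inverse c * F x)" by (rule reg_cmult[OF F])
  moreover have "inverse c * F 0 = exp z" using c F0 by simp
  ultimately obtain l where l: "reg l" "\<forall>\<^sub>F x in nhds 0. exp (l x) = inverse c * F x"
    using reg_log by blast
  define s where "s x = inverse ?W * l x" for x
  have s: "reg s" unfolding s_def by (rule reg_cmult[OF l(1)])
  have Fs: "\<forall>\<^sub>F x in nhds 0. F x = c * exp (?W * s x)"
    using l(2)
  proof (rule eventually_mono)
    fix x assume "exp (l x) = inverse c * F x"
    moreover have "?W * s x = l x" unfolding s_def mult.assoc[symmetric] right_inverse[OF W0] by simp
    ultimately show "F x = c * exp (?W * s x)" using c by simp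
  qed
  have "\<forall>\<^sub>F x in nhds 0. \<rho> x = c * ?W * det (jacobian_matrix (scaling_map w s) x)"
    using det_jacobian_scaling_map[OF s, of w] eq Fs partial_deriv_cong_germ[OF Fs] reg_has_derivative[OF s]
  proof eventually_elim
    case (elim x)
    have "((\<lambda>x. c * exp (?W * s x)) has_derivative
       (\<lambda>v. c * ((?W * (\<Sum>j\<in>UNIV. v $ j * partial_deriv j s x)) * exp (?W * s x)))) (at x)"
      by (intro has_derivative_mult_right has_derivative_exp_compose elim(5))
    then have "((\<lambda>x. c * exp (?W * s x)) has_derivative
       (\<lambda>v. \<Sum>j\<in>UNIV. v $ j * (c * ?W * exp (?W * s x) * partial_deriv j s x))) (at x)"
      by (rule has_derivative_eq_rhs) (simp add: sum_distrib_left sum_distrib_right mult_ac del: of_nat_sum)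
    then have "partial_deriv i F x = c * ?W * exp (?W * s x) * partial_deriv i s x" for i
      using elim(4)[rule_format, of i] partial_deriv_eqI[of "\<lambda>x. c * exp (?W * s x)" _ x i] by simp
    then have "euler_deriv w F x = c * ?W * exp (?W * s x) * euler_deriv w s x"
      by (simp add: euler_deriv_def sum_distrib_left mult_ac del: of_nat_sum)
    then show ?case using elim(1,2,3) by (simp add: algebra_simps del: of_nat_sum)
  qed
  with s show ?thesis by (rule that)
qed

text \<open>The map \<open>\<Phi>\<^sub>\<sigma>\<close> is a right inverse if \<open>\<sigma>(y) = - s(\<Phi>\<^sub>\<sigma>(y))\<close>. Splitting off the constant \<open>- s(0)\<close>
  from \<open>\<sigma>\<close> reduces this to a fixed point equation whose right-hand side vanishes at the origin.\<close>

lemma scaling_map_right_inverse: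
  assumes s: "reg s"
  obtains \<sigma> where "reg \<sigma>" "\<forall>\<^sub>F y in nhds 0. scaling_map w s (scaling_map w \<sigma> y) = y"
proof -
  \<comment> \<open>Writing \<open>\<sigma> = - s 0 + \<tau>\<close>, the equation for \<open>\<sigma>\<close> becomes \<open>\<tau> y = b (weighted_scaling w (\<tau> y) y)\<close>.\<close>
  define b where "b y = s 0 + - s (weighted_scaling w (- s 0) y)" for y
  have "reg_map (scaling_map w (\<lambda>_. - s 0))" by (rule reg_scaling_map[OF reg_const])
  then have "reg (\<lambda>y. s (scaling_map w (\<lambda>_. - s 0) y))" by (rule reg_compose_map[OF s])
  then have b: "reg b" unfolding b_def scaling_map_def by (intro reg_add reg_const reg_uminus)
  have "b 0 = 0" by (simp add: b_def)
  then obtain \<tau> where \<tau>: "reg \<tau>" "\<forall>\<^sub>F y in nhds 0. \<tau> y = b (weighted_scaling w (\<tau> y) y)"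
    using reg_scaling_fixpoint[OF b] by blast
  define \<sigma> where "\<sigma> y = - s 0 + \<tau> y" for y
  have "\<forall>\<^sub>F y in nhds 0. scaling_map w s (scaling_map w \<sigma> y) = y"
    using \<tau>(2)
  proof (rule eventually_mono)
    fix y assume t: "\<tau> y = b (weighted_scaling w (\<tau> y) y)"
    have e: "weighted_scaling w (\<sigma> y) y = weighted_scaling w (- s 0) (weighted_scaling w (\<tau> y) y)"
      unfolding \<sigma>_def by (rule weighted_scaling_add)
    have "s (weighted_scaling w (\<sigma> y) y) = s 0 - b (weighted_scaling w (\<tau> y) y)"
      unfolding e b_def by simp
    also have "\<dots> = - \<sigma> y" by (simp add: \<sigma>_def flip: t)
    finally have *: "s (weighted_scaling w (\<sigma> y) y) = - \<sigma> y" .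
    show "scaling_map w s (scaling_map w \<sigma> y) = y"
      by (simp add: scaling_map_def * weighted_scaling_minus)
  qed
  moreover have "reg \<sigma>" unfolding \<sigma>_def by (intro reg_add reg_const \<tau>(1))
  ultimately show ?thesis by (rule that[rotated])
qed

text \<open>The right inverse has a right inverse of its own, which must agree with \<open>\<Phi>\<^sub>s\<close>.\<close>

lemma scaling_map_inverse:
  assumes s: "reg s"
  obtains \<sigma> where "reg \<sigma>" "\<forall>\<^sub>F y in nhds 0. scaling_map w s (scaling_map w \<sigma> y) = y"
    "\<forall>\<^sub>F x in nhds 0. scaling_map w \<sigma> (scaling_map w s x) = x"
proof -
  obtain \<sigma> where \<sigma>: "reg \<sigma>" "\<forall>\<^sub>F y in nhds 0. scaling_map w s (scaling_map w \<sigma> y) = y"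
    by (rule scaling_map_right_inverse[OF s])
  obtain \<tau> where \<tau>: "reg \<tau>" "\<forall>\<^sub>F y in nhds 0. scaling_map w \<sigma> (scaling_map w \<tau> y) = y"
    by (rule scaling_map_right_inverse[OF \<sigma>(1)])
  have "\<forall>\<^sub>F x in nhds 0. scaling_map w \<sigma> (scaling_map w s x) = x"
    using \<tau>(2) eventually_reg_map[OF reg_scaling_map[OF \<tau>(1), of w] \<sigma>(2)]
  proof eventually_elim
    case (elim x)
    have "scaling_map w s x = scaling_map w \<tau> x" using elim(2) unfolding elim(1) .
    then show ?case using elim(1) by simp
  qed
  with \<sigma> show ?thesis by (rule that)
qed

lemma scaling_map_diffeo:
  assumes s: "reg s"
  shows "scaling_map w s \<in> diffeos C"
proof -
  obtain \<sigma> where \<sigma>: "reg \<sigma>" "\<forall>\<^sub>F y in nhds 0. scaling_map w s (scaling_map w \<sigma> y) = y"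
    "\<forall>\<^sub>F x in nhds 0. scaling_map w \<sigma> (scaling_map w s x) = x"
    by (rule scaling_map_inverse[OF s])
  show ?thesis unfolding diffeos_iff
    by (intro conjI exI[of _ "scaling_map w \<sigma>"] reg_scaling_map s \<sigma>)
qed

text \<open>Both densities are pullbacks of the same constant, \<open>\<rho>\<^sub>0\<close> under \<open>\<Phi>\<^sub>s\<^sub>0\<close> and \<open>\<rho>\<^sub>1\<close> under \<open>\<Phi>\<^sub>s\<^sub>1\<close>, and
  \<open>\<Phi>\<^sub>S\<close> is \<open>\<Phi>\<^sub>s\<^sub>0\<close> followed by the inverse of \<open>\<Phi>\<^sub>s\<^sub>1\<close>; the chain rule gives the claim.\<close>

lemma scaling_map_equalizes_densities:
  assumes \<rho>: "reg \<rho>0" "reg \<rho>1" and W: "total_weight w > 0"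
    and 0: "\<rho>1 0 \<noteq> 0" "\<rho>0 0 = \<rho>1 0 * exp z"
  obtains S where "reg S" "\<forall>\<^sub>F x in nhds 0. \<rho>1 (scaling_map w S x) * det (jacobian_matrix (scaling_map w S) x) = \<rho>0 x"
proof -
  let ?W = "of_nat (total_weight w) :: 'k"
  have W0: "?W \<noteq> 0" using W by (simp only: of_nat_eq_0_iff)
  obtain F0 where F0: "reg F0" "\<forall>\<^sub>F x in nhds 0. euler_deriv w F0 x + ?W * F0 x = \<rho>0 x"
    using reg_euler_equation[OF \<rho>(1) W] unfolding euler_deriv_def by blast
  obtain F1 where F1: "reg F1" "\<forall>\<^sub>F x in nhds 0. euler_deriv w F1 x + ?W * F1 x = \<rho>1 x"
    using reg_euler_equation[OF \<rho>(2) W] unfolding euler_deriv_def by blast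
  have v: "?W * F0 0 = \<rho>0 0" "?W * F1 0 = \<rho>1 0"
    using eventually_nhds_x_imp_x[OF F0(2)] eventually_nhds_x_imp_x[OF F1(2)] by (simp_all add: euler_deriv_def)
  define c where "c = F1 0"
  have c: "c \<noteq> 0" using v 0 by (auto simp: c_def)
  have c0: "F0 0 = c * exp z"
  proof -
    have "?W * F0 0 = ?W * (c * exp z)" using v 0 by (simp add: c_def mult.assoc[symmetric] del: of_nat_sum)
    then show ?thesis using mult_left_cancel[OF W0] by blast
  qed
  have c1: "F1 0 = c * exp 0" by (simp add: c_def)
  obtain s0 where s0: "reg s0" "\<forall>\<^sub>F x in nhds 0. \<rho>0 x = c * ?W * det (jacobian_matrix (scaling_map w s0) x)"
    by (rule density_normal_form[OF \<rho>(1) F0(1) W F0(2) c c0])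
  obtain s1 where s1: "reg s1" "\<forall>\<^sub>F x in nhds 0. \<rho>1 x = c * ?W * det (jacobian_matrix (scaling_map w s1) x)"
    by (rule density_normal_form[OF \<rho>(2) F1(1) W F1(2) c c1])
  obtain \<sigma> where \<sigma>: "reg \<sigma>" "\<forall>\<^sub>F y in nhds 0. scaling_map w s1 (scaling_map w \<sigma> y) = y"
    by (rule scaling_map_right_inverse[OF s1(1)])
  define S where "S x = \<sigma> (scaling_map w s0 x) + s0 x" for x
  have S: "reg S" unfolding S_def
    by (intro reg_add s0(1) reg_compose_map[OF \<sigma>(1)] reg_scaling_map)
  have hS: "scaling_map w S x = scaling_map w \<sigma> (scaling_map w s0 x)" for x
    by (simp add: scaling_map_def S_def weighted_scaling_add)
  let ?h = "scaling_map w S"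
  have h: "reg_map ?h" by (rule reg_scaling_map[OF S])
  have comp: "\<forall>\<^sub>F x in nhds 0. scaling_map w s1 (?h x) = scaling_map w s0 x"
    unfolding hS by (rule eventually_reg_map[OF reg_scaling_map[OF s0(1)] \<sigma>(2)])
  have "\<forall>\<^sub>F x in nhds 0. \<rho>1 (?h x) * det (jacobian_matrix ?h x) = \<rho>0 x"
    using jacobian_cong_germ[OF comp] jacobian_compose[OF reg_scaling_map[OF s1(1), of w] h] s0(2) eventually_reg_map[OF h s1(2)]
  proof eventually_elim
    case (elim x)
    have "det (jacobian_matrix (scaling_map w s0) x) = det (jacobian_matrix (scaling_map w s1) (?h x)) * det (jacobian_matrix ?h x)"
      using elim(1,2) by (simp only: det_mul[symmetric])
    then show ?case by (simp only: elim(3,4) mult.assoc)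
  qed
  with S show ?thesis by (rule that)
qed

end

section \<open>Volume forms and quasihomogeneous functions\<close>

definition volume_density :: "('k::real_normed_field, 'n::finite) top_form \<Rightarrow> 'k ^ 'n \<Rightarrow> 'k" where
  "volume_density \<Omega> x = \<Omega> x (\<lambda>i. axis i 1)"

lemma norm_weighted_scaling_le:
  fixes x :: "'k::{real_normed_field, banach} ^ 'n::finite"
  shows "norm (weighted_scaling w z x) \<le> exp (real (total_weight w) * norm z) * norm x"
proof -
  let ?K = "exp (real (total_weight w) * norm z)"
  have "norm (weighted_scaling w z x) \<le> L2_set (\<lambda>i. ?K * norm (x $ i)) UNIV"
    unfolding norm_vec_def by (intro L2_set_mono norm_weighted_scaling_nth_le) auto
  also have "\<dots> = ?K * norm x"
    unfolding norm_vec_def by (rule L2_set_right_distrib[symmetric]) simp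
  finally show ?thesis .
qed

context regular_calculus
begin

lemma volume_formD:
  assumes "volume_form C \<Omega>"
  shows "reg (volume_density \<Omega>)" "volume_density \<Omega> 0 \<noteq> 0"
    and "\<forall>\<^sub>F x in nhds 0. \<forall>v. \<Omega> x v = volume_density \<Omega> x * det (\<chi> i. v i)"
proof -
  have *: "\<forall>\<^sub>F x in nhds 0. alternating_form (\<Omega> x)" "\<And>v. reg (\<lambda>x. \<Omega> x v)" "\<exists>v. \<Omega> 0 v \<noteq> 0"
    using assms by (auto simp: volume_form_def reg_eq[symmetric])
  show "reg (volume_density \<Omega>)" unfolding volume_density_def by (rule *(2))
  show ev: "\<forall>\<^sub>F x in nhds 0. \<forall>v. \<Omega> x v = volume_density \<Omega> x * det (\<chi> i. v i)"
    using *(1) unfolding volume_density_def by (rule eventually_mono) (blast intro: alternating_form_eq_det)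
  show "volume_density \<Omega> 0 \<noteq> 0" using *(3) eventually_nhds_x_imp_x[OF ev] by auto
qed

lemma pullback_form_eventually_eq:
  assumes \<Omega>: "volume_form C \<Omega>" and \<phi>: "reg_map \<phi>"
  shows "\<forall>\<^sub>F x in nhds 0. \<forall>v. pullback_form \<phi> \<Omega> x v =
    volume_density \<Omega> (\<phi> x) * det (jacobian_matrix \<phi> x) * det (\<chi> i. v i)"
  using reg_map_frechet_derivative[OF \<phi>] eventually_reg_map[OF \<phi> volume_formD(3)[OF \<Omega>]]
proof eventually_elim
  case (elim x)
  then show ?case by (simp add: pullback_form_def det_rows_matrix_vector_mult)
qed

lemma volume_form_pullback:
  assumes \<Omega>: "volume_form C \<Omega>" and \<phi>: "reg_map \<phi>" and nz: "det (jacobian_matrix \<phi> 0) \<noteq> 0"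
  shows "volume_form C (pullback_form \<phi> \<Omega>)"
  unfolding volume_form_def
proof (intro conjI allI)
  note eq = pullback_form_eventually_eq[OF \<Omega> \<phi>]
  show "\<forall>\<^sub>F x in nhds 0. alternating_form (pullback_form \<phi> \<Omega> x)"
    using eq
  proof (rule eventually_mono)
    fix x assume "\<forall>v. pullback_form \<phi> \<Omega> x v = volume_density \<Omega> (\<phi> x) * det (jacobian_matrix \<phi> x) * det (\<chi> i. v i)"
    then have "pullback_form \<phi> \<Omega> x = (\<lambda>v. volume_density \<Omega> (\<phi> x) * det (jacobian_matrix \<phi> x) * det (\<chi> i. v i))" by blast
    then show "alternating_form (pullback_form \<phi> \<Omega> x)" using alternating_form_det by simp
  qed
  have reg: "reg (\<lambda>x. volume_density \<Omega> (\<phi> x) * det (jacobian_matrix \<phi> x) * det (\<chi> i. v i))" for v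
  proof (intro reg_mult reg_const reg_det)
    show "reg (\<lambda>x. volume_density \<Omega> (\<phi> x))" by (rule reg_compose_map[OF volume_formD(1)[OF \<Omega>] \<phi>])
    show "reg (\<lambda>x. jacobian_matrix \<phi> x $ i $ j)" for i j
      using reg_partial_deriv[OF reg_mapD(1)[OF \<phi>]] by (simp add: jacobian_matrix_def)
  qed
  have "reg (\<lambda>x. pullback_form \<phi> \<Omega> x v)" for v
    by (rule reg_cong[OF reg[of v]]) (rule eventually_mono[OF eq], simp)
  then show "regular C (\<lambda>x. pullback_form \<phi> \<Omega> x v)" for v by (simp add: reg_eq[symmetric])
  have "(\<chi> i. axis i 1) = (mat 1 :: 'k ^ 'n ^ 'n)" by (auto simp: vec_eq_iff mat_def axis_def)
  then have "pullback_form \<phi> \<Omega> 0 (\<lambda>i. axis i 1) = volume_density \<Omega> 0 * det (jacobian_matrix \<phi> 0)"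
    using eventually_nhds_x_imp_x[OF eq] reg_mapD(2)[OF \<phi>] by (simp add: det_I)
  then show "\<exists>v. pullback_form \<phi> \<Omega> 0 v \<noteq> 0" using nz volume_formD(2)[OF \<Omega>] by (intro exI[of _ "\<lambda>i. axis i 1"]) simp
qed

lemma volume_density_pullback_form:
  assumes "volume_form C \<Omega>" and "reg_map \<phi>"
  shows "volume_density (pullback_form \<phi> \<Omega>) 0 = volume_density \<Omega> 0 * det (jacobian_matrix \<phi> 0)"
proof -
  have "(\<chi> i. axis i 1) = (mat 1 :: 'k ^ 'n ^ 'n)" by (auto simp: vec_eq_iff mat_def axis_def)
  then show ?thesis
    using eventually_nhds_x_imp_x[OF pullback_form_eventually_eq[OF assms]] reg_mapD(2)[OF assms(2)]
    by (simp add: det_I volume_density_def)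
qed

lemma pullback_form_compose:
  assumes \<phi>: "reg_map \<phi>" and \<psi>: "reg_map \<psi>"
  shows "\<forall>\<^sub>F x in nhds 0. pullback_form (\<lambda>x. \<phi> (\<psi> x)) \<Omega> x = pullback_form \<psi> (pullback_form \<phi> \<Omega>) x"
  using reg_map_frechet_derivative[OF reg_map_compose[OF \<phi> \<psi>]] reg_map_frechet_derivative[OF \<psi>]
    eventually_reg_map[OF \<psi> reg_map_frechet_derivative[OF \<phi>]] jacobian_compose[OF \<phi> \<psi>]
proof eventually_elim
  case (elim x)
  then show ?case by (simp add: pullback_form_def fun_eq_iff matrix_vector_mul_assoc)
qed

lemma scaling_map_equalizes_volume_forms:
  assumes \<Omega>: "volume_form C \<Omega>0" "volume_form C \<Omega>1" and W: "total_weight w > 0"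
    and z: "volume_density \<Omega>0 0 = volume_density \<Omega>1 0 * exp z"
  obtains S where "reg S" "\<forall>\<^sub>F x in nhds 0. pullback_form (scaling_map w S) \<Omega>1 x = \<Omega>0 x"
proof -
  obtain S where S: "reg S"
    "\<forall>\<^sub>F x in nhds 0. volume_density \<Omega>1 (scaling_map w S x) * det (jacobian_matrix (scaling_map w S) x) = volume_density \<Omega>0 x"
    by (rule scaling_map_equalizes_densities[OF volume_formD(1)[OF \<Omega>(1)] volume_formD(1)[OF \<Omega>(2)] W volume_formD(2)[OF \<Omega>(2)] z])
  have "\<forall>\<^sub>F x in nhds 0. pullback_form (scaling_map w S) \<Omega>1 x = \<Omega>0 x"
    using S(2) volume_formD(3)[OF \<Omega>(1)] pullback_form_eventually_eq[OF \<Omega>(2) reg_scaling_map[OF S(1), of w]]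
    by eventually_elim (simp add: fun_eq_iff)
  with S(1) show ?thesis by (rule that)
qed

text \<open>Along the segment from \<open>x\<close> to \<open>\<Phi>\<^sub>s(x)\<close> on the Euler orbit, \<open>exp (- \<delta> \<theta> s(x)) g\<close> has derivative 0.
  Only the value \<open>s(x)\<close> enters, so \<open>s\<close> is not differentiated, and all points of the segment are near
  the origin although \<open>s(0)\<close> may be large.\<close>

lemma quasihomogeneous_scaling_map:
  assumes g: "reg g" and q: "quasihomogeneous w \<delta> (germ g)" and s: "reg s"
  shows "\<forall>\<^sub>F x in nhds 0. g (scaling_map w s x) = exp (of_int \<delta> * s x) * g x"
proof -
  have "\<forall>\<^sub>F x in nhds 0. euler_deriv w g x = of_int \<delta> * g x"
    using q unfolding quasihomogeneous.abs_eq euler_deriv_def .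
  then have "\<forall>\<^sub>F x in nhds 0. euler_deriv w g x = of_int \<delta> * g x \<and>
      (g has_derivative (\<lambda>v. \<Sum>i\<in>UNIV. v $ i * partial_deriv i g x)) (at x)"
    using reg_has_derivative[OF g] by eventually_elim blast
  then obtain r where r: "r > 0" "\<And>x. norm x < r \<Longrightarrow> euler_deriv w g x = of_int \<delta> * g x"
      "\<And>x. norm x < r \<Longrightarrow> (g has_derivative (\<lambda>v. \<Sum>i\<in>UNIV. v $ i * partial_deriv i g x)) (at x)"
    unfolding eventually_nhds_metric by (auto simp: dist_norm)
  \<comment> \<open>A bound for \<open>s\<close> near the origin, and for the distortion of the norm by flow times up to \<open>B\<close>.\<close>
  define B where "B = norm (s 0) + 1"
  define K where "K = exp (real (total_weight w) * B)"
  have K: "K > 0" by (simp add: K_def)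
  have "((\<lambda>x. norm (s x)) \<longlongrightarrow> norm (s 0)) (nhds 0)"
    by (rule tendsto_norm[OF reg_tendsto[OF s]])
  then have evB: "\<forall>\<^sub>F x in nhds 0. norm (s x) < B"
    by (rule order_tendstoD) (simp add: B_def)
  have evr: "\<forall>\<^sub>F x in nhds (0 :: 'k ^ 'n). norm x < r / K"
    unfolding eventually_nhds_metric using r(1) K by (intro exI[of _ "r / K"]) simp
  show ?thesis
    using evB evr
  proof eventually_elim
    case (elim x)
    let ?y = "\<lambda>\<theta>::real. weighted_scaling w (of_real \<theta> * s x) x"
    define u where "u \<theta> = exp (- (of_int \<delta> * (of_real \<theta> * s x))) * g (?y \<theta>)" for \<theta> :: real
    have "\<exists>c. \<forall>\<theta>\<in>{0..1}. u \<theta> = c"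
    proof (rule has_derivative_zero_constant)
      show "convex {0..1::real}" by simp
      fix \<theta> :: real assume \<theta>: "\<theta> \<in> {0..1}"
      have "norm (of_real \<theta> * s x) \<le> 1 * norm (s x)"
        unfolding norm_mult using \<theta> by (intro mult_right_mono) auto
      then have "norm (of_real \<theta> * s x) \<le> B" using elim(1) by linarith
      then have "exp (real (total_weight w) * norm (of_real \<theta> * s x)) \<le> K"
        unfolding K_def exp_le_cancel_iff by (intro mult_left_mono of_nat_0_le_iff)
      then have "norm (?y \<theta>) \<le> K * norm x"
        using norm_weighted_scaling_le[of w "of_real \<theta> * s x" x] mult_right_mono[of _ K "norm x"] order_trans by fastforce
      also have "\<dots> < r" using elim(2) K by (simp add: field_simps)
      finally have y: "norm (?y \<theta>) < r" .
      have lin: "((\<lambda>\<theta>. a * (of_real \<theta> * s x)) has_derivative (\<lambda>h. a * (of_real h * s x))) (at \<theta>)" for a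
        by (auto intro!: derivative_eq_intros)
      have Dy: "(?y has_derivative (\<lambda>h. \<chi> i. of_real h * (of_nat (w i) * s x * ?y \<theta> $ i))) (at \<theta>)"
      proof (rule has_derivative_vec)
        fix i
        show "((\<lambda>\<theta>. ?y \<theta> $ i) has_derivative (\<lambda>h. (\<chi> i. of_real h * (of_nat (w i) * s x * ?y \<theta> $ i)) $ i)) (at \<theta>)"
          unfolding weighted_scaling_nth
          by (rule has_derivative_eq_rhs[OF has_derivative_mult_left[OF has_derivative_exp_compose[OF lin]]])
            (simp add: fun_eq_iff mult_ac)
      qed
      have "((\<lambda>\<theta>. g (?y \<theta>)) has_derivative
          (\<lambda>h. \<Sum>i\<in>UNIV. (of_real h * (of_nat (w i) * s x * ?y \<theta> $ i)) * partial_deriv i g (?y \<theta>))) (at \<theta>)"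
        using has_derivative_compose[OF Dy r(3)[OF y]] by simp
      also have "(\<lambda>h. \<Sum>i\<in>UNIV. (of_real h * (of_nat (w i) * s x * ?y \<theta> $ i)) * partial_deriv i g (?y \<theta>)) =
          (\<lambda>h. of_real h * s x * euler_deriv w g (?y \<theta>))"
        unfolding euler_deriv_def sum_distrib_left by (intro ext sum.cong refl) (simp only: mult_ac)
      also have "\<dots> = (\<lambda>h. of_real h * s x * (of_int \<delta> * g (?y \<theta>)))"
        by (simp only: r(2)[OF y])
      finally have Dg: "((\<lambda>\<theta>. g (?y \<theta>)) has_derivative (\<lambda>h. of_real h * s x * (of_int \<delta> * g (?y \<theta>)))) (at \<theta>)" .
      have "((\<lambda>\<theta>. exp (- (of_int \<delta> * (of_real \<theta> * s x)))) has_derivative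
          (\<lambda>h. - (of_int \<delta> * (of_real h * s x)) * exp (- (of_int \<delta> * (of_real \<theta> * s x))))) (at \<theta>)"
        by (rule has_derivative_exp_compose[OF has_derivative_minus[OF lin]])
      from has_derivative_mult[OF this Dg] have "(u has_derivative (\<lambda>h. 0)) (at \<theta>)"
        unfolding u_def[abs_def] by (rule has_derivative_eq_rhs) (simp add: fun_eq_iff algebra_simps)
      then show "(u has_derivative (\<lambda>h. 0)) (at \<theta> within {0..1})"
        by (rule has_derivative_at_withinI)
    qed
    then have "u 1 = u 0" by auto
    then have "exp (- (of_int \<delta> * s x)) * g (scaling_map w s x) = g x"
      by (simp add: u_def scaling_map_def)
    then have "exp (of_int \<delta> * s x) * (exp (- (of_int \<delta> * s x)) * g (scaling_map w s x)) = exp (of_int \<delta> * s x) * g x"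
      by simp
    then show ?case by (simp add: mult.assoc[symmetric] flip: exp_add)
  qed
qed

end

section \<open>The action on ideals of germs\<close>

text \<open>Composition with \<open>\<phi>\<close>; it does not depend on the representative when \<open>\<phi>\<close> is continuous at the
  fixed point 0.\<close>

definition germ_pullback :: "('k::real_normed_field ^ 'n \<Rightarrow> 'k ^ 'n) \<Rightarrow> ('k ^ 'n, 'k) germ \<Rightarrow> ('k ^ 'n, 'k) germ" where
  "germ_pullback \<phi> a = germ (rep_germ a \<circ> \<phi>)"

lemma germ_eq_iff: "germ f = germ g \<longleftrightarrow> (\<forall>\<^sub>F x in nhds 0. f x = g x)"
  by (rule germ.abs_eq_iff)

lemma germ_rep_germ: "germ (rep_germ a) = a"
  by (rule Quotient_abs_rep[OF Quotient_germ])

context regular_calculus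
begin

abbreviation R :: "('k ^ 'n, 'k) germ ring" where "R \<equiv> germ_ring C"

lemma germ_in_carrier_iff: "germ f \<in> carrier R \<longleftrightarrow> reg f"
proof
  assume "germ f \<in> carrier R"
  then obtain g where "germ f = germ g" "reg g" unfolding germ_ring_def reg_eq[symmetric] by auto
  then show "reg f" by (intro reg_cong[of g f]) (auto simp: germ_eq_iff eq_commute)
qed (auto simp: germ_ring_def reg_eq[symmetric])

lemma germ_ring_simps:
  "monoid.mult R = (*)" "\<one>\<^bsub>R\<^esub> = 1" "\<zero>\<^bsub>R\<^esub> = 0" "add R = (+)"
  by (simp_all add: germ_ring_def)

lemma carrierE:
  assumes "a \<in> carrier R"
  obtains f where "a = germ f" "reg f"
  using assms germ_in_carrier_iff by (metis germ_rep_germ)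

lemma cring_germ_ring: "cring R"
proof (rule cringI)
  have add: "a + b \<in> carrier R" and mult: "a * b \<in> carrier R" if "a \<in> carrier R" "b \<in> carrier R" for a b
    using that by (auto elim!: carrierE simp: plus_germ.abs_eq times_germ.abs_eq germ_in_carrier_iff intro: reg_add reg_mult)
  have zero: "0 \<in> carrier R" and one: "1 \<in> carrier R"
    unfolding zero_germ_def one_germ_def germ_in_carrier_iff by (rule reg_const)+
  have minus: "- a \<in> carrier R" if "a \<in> carrier R" for a
    using that by (auto elim!: carrierE simp: uminus_germ.abs_eq germ_in_carrier_iff intro: reg_uminus)
  show "abelian_group R"
    by (rule abelian_groupI) (use add zero minus in \<open>auto simp: germ_ring_simps intro: bexI[of _ "- _"]\<close>)
  show "comm_monoid R"
    by (rule comm_monoidI) (use mult one in \<open>auto simp: germ_ring_simps mult_ac\<close>)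
qed (simp add: germ_ring_simps distrib_right)

lemma ring_germ_ring: "ring R"
  by (rule cring.axioms(1)[OF cring_germ_ring])

lemma germ_pullback_germ:
  assumes "reg_map \<phi>"
  shows "germ_pullback \<phi> (germ f) = germ (f \<circ> \<phi>)"
proof -
  have "\<forall>\<^sub>F x in nhds 0. rep_germ (germ f) x = f x"
    using germ_rep_germ[of "germ f"] by (simp add: germ_eq_iff)
  from eventually_reg_map[OF assms this] show ?thesis
    by (simp add: germ_pullback_def germ_eq_iff)
qed

lemma germ_pullback_in_carrier:
  assumes \<phi>: "reg_map \<phi>" and "a \<in> carrier R"
  shows "germ_pullback \<phi> a \<in> carrier R"
  using assms(2) reg_compose_map[OF _ \<phi>]
  by (auto elim!: carrierE simp: germ_pullback_germ[OF \<phi>] germ_in_carrier_iff o_def)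

lemma germ_pullback_ring_hom:
  assumes \<phi>: "reg_map \<phi>"
  shows "ring_hom_ring R R (germ_pullback \<phi>)"
proof (rule ring_hom_ringI[OF ring_germ_ring ring_germ_ring])
  show "germ_pullback \<phi> a \<in> carrier R" if "a \<in> carrier R" for a by (rule germ_pullback_in_carrier[OF \<phi> that])
  show "germ_pullback \<phi> (a \<otimes>\<^bsub>R\<^esub> b) = germ_pullback \<phi> a \<otimes>\<^bsub>R\<^esub> germ_pullback \<phi> b" if "a \<in> carrier R" "b \<in> carrier R" for a b
    using that by (auto elim!: carrierE simp: germ_pullback_germ[OF \<phi>] germ_ring_simps times_germ.abs_eq o_def)
  show "germ_pullback \<phi> (a \<oplus>\<^bsub>R\<^esub> b) = germ_pullback \<phi> a \<oplus>\<^bsub>R\<^esub> germ_pullback \<phi> b" if "a \<in> carrier R" "b \<in> carrier R" for a b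
    using that by (auto elim!: carrierE simp: germ_pullback_germ[OF \<phi>] germ_ring_simps plus_germ.abs_eq o_def)
  show "germ_pullback \<phi> \<one>\<^bsub>R\<^esub> = \<one>\<^bsub>R\<^esub>"
    by (simp add: germ_ring_simps one_germ_def germ_pullback_germ[OF \<phi>] o_def)
qed

lemma germ_pullback_compose:
  assumes "reg_map \<phi>" "reg_map \<psi>"
  shows "germ_pullback \<psi> (germ_pullback \<phi> a) = germ_pullback (\<lambda>x. \<phi> (\<psi> x)) a"
proof -
  have "germ_pullback \<psi> (germ_pullback \<phi> (germ f)) = germ_pullback (\<lambda>x. \<phi> (\<psi> x)) (germ f)" for f
    using assms reg_map_compose[OF assms] by (simp add: germ_pullback_germ o_def)
  then show ?thesis by (metis germ_rep_germ)
qed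

lemma germ_pullback_id:
  assumes \<phi>: "reg_map \<phi>" and "\<forall>\<^sub>F x in nhds 0. \<phi> x = x"
  shows "germ_pullback \<phi> a = a"
proof -
  have "germ_pullback \<phi> (germ f) = germ f" for f
    unfolding germ_pullback_germ[OF \<phi>] germ_eq_iff using assms(2) by (rule eventually_mono) simp
  then show ?thesis by (metis germ_rep_germ)
qed

lemma ideal_preimage_germ_pullback:
  "reg_map \<phi> \<Longrightarrow> ideal I R \<Longrightarrow> ideal {a \<in> carrier R. germ_pullback \<phi> a \<in> I} R"
  by (rule ring_hom_ring.ideal_vimage[OF germ_pullback_ring_hom])

lemma ideal_subset_carrier: "ideal I R \<Longrightarrow> I \<subseteq> carrier R"
  by (rule additive_subgroup.a_subset[OF ideal.axioms(1)])

lemma genideal_ideal_eq: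
  assumes "ideal I R"
  shows "genideal R I = I"
  using ring.genideal_minimal[OF ring_germ_ring assms subset_refl]
    ring.genideal_self[OF ring_germ_ring ideal_subset_carrier[OF assms]] by blast

text \<open>For a diffeomorphism germ the compositions already form an ideal, the preimage of \<open>I\<close> under pullback
  along the inverse, so generating an ideal from them adds nothing.\<close>

lemma pullback_ideal_eq:
  assumes \<phi>: "\<phi> \<in> diffeos C" and I: "ideal I R"
  shows "pullback_ideal C \<phi> I = germ_pullback \<phi> ` I" "ideal (germ_pullback \<phi> ` I) R"
proof -
  obtain \<psi> where r: "reg_map \<phi>" "reg_map \<psi>" and inv: "\<forall>\<^sub>F x in nhds 0. \<psi> (\<phi> x) = x" "\<forall>\<^sub>F x in nhds 0. \<phi> (\<psi> x) = x"
    using \<phi> unfolding diffeos_iff by blast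
  have 1: "germ_pullback \<phi> (germ_pullback \<psi> a) = a" for a
    unfolding germ_pullback_compose[OF r(2,1)] by (rule germ_pullback_id[OF reg_map_compose[OF r(2,1)] inv(1)])
  have 2: "germ_pullback \<psi> (germ_pullback \<phi> a) = a" for a
    unfolding germ_pullback_compose[OF r(1,2)] by (rule germ_pullback_id[OF reg_map_compose[OF r(1,2)] inv(2)])
  have "germ_pullback \<phi> ` I = {a \<in> carrier R. germ_pullback \<psi> a \<in> I}"
  proof (intro equalityI subsetI)
    fix a assume "a \<in> germ_pullback \<phi> ` I"
    then obtain b where b: "b \<in> I" "a = germ_pullback \<phi> b" by blast
    have "germ_pullback \<phi> b \<in> carrier R"
      by (rule germ_pullback_in_carrier[OF r(1) subsetD[OF ideal_subset_carrier[OF I] b(1)]])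
    then show "a \<in> {a \<in> carrier R. germ_pullback \<psi> a \<in> I}" using b 2 by simp
  next
    fix a assume "a \<in> {a \<in> carrier R. germ_pullback \<psi> a \<in> I}"
    then show "a \<in> germ_pullback \<phi> ` I" using imageI[of "germ_pullback \<psi> a" I "germ_pullback \<phi>"] 1[of a] by simp
  qed
  then show id: "ideal (germ_pullback \<phi> ` I) R" using ideal_preimage_germ_pullback[OF r(2) I] by simp
  have "{germ (f \<circ> \<phi>) | f. germ f \<in> I} = germ_pullback \<phi> ` I"
  proof (intro equalityI subsetI)
    fix a assume "a \<in> {germ (f \<circ> \<phi>) | f. germ f \<in> I}"
    then show "a \<in> germ_pullback \<phi> ` I" by (auto simp flip: germ_pullback_germ[OF r(1)])
  next
    fix a assume "a \<in> germ_pullback \<phi> ` I"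
    then obtain b where b: "b \<in> I" "a = germ_pullback \<phi> b" by blast
    then have "germ (rep_germ b) \<in> I" "a = germ (rep_germ b \<circ> \<phi>)"
      by (simp_all add: germ_rep_germ germ_pullback_def)
    then show "a \<in> {germ (f \<circ> \<phi>) | f. germ f \<in> I}" by blast
  qed
  then show "pullback_ideal C \<phi> I = germ_pullback \<phi> ` I"
    unfolding pullback_ideal_def by (simp only: genideal_ideal_eq[OF id])
qed

lemma diffeos_compose:
  fixes \<phi> \<theta> :: "'k ^ 'n \<Rightarrow> 'k ^ 'n"
  assumes "\<phi> \<in> diffeos C" "\<theta> \<in> diffeos C"
  shows "(\<lambda>x. \<phi> (\<theta> x)) \<in> diffeos C"
proof -
  obtain \<phi>' where 1: "reg_map \<phi>" "reg_map \<phi>'" "\<forall>\<^sub>F x in nhds 0. \<phi>' (\<phi> x) = x" "\<forall>\<^sub>F x in nhds 0. \<phi> (\<phi>' x) = x"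
    using assms(1) unfolding diffeos_iff by blast
  obtain \<theta>' where 2: "reg_map \<theta>" "reg_map \<theta>'" "\<forall>\<^sub>F x in nhds 0. \<theta>' (\<theta> x) = x" "\<forall>\<^sub>F x in nhds 0. \<theta> (\<theta>' x) = x"
    using assms(2) unfolding diffeos_iff by blast
  have a: "\<forall>\<^sub>F x in nhds 0. \<theta>' (\<phi>' (\<phi> (\<theta> x))) = x"
    using eventually_reg_map[OF 2(1) 1(3)] 2(3) by eventually_elim simp
  have b: "\<forall>\<^sub>F x in nhds 0. \<phi> (\<theta> (\<theta>' (\<phi>' x))) = x"
    using eventually_reg_map[OF 1(2) 2(4)] 1(4) by eventually_elim simp
  show ?thesis unfolding diffeos_iff
    by (intro conjI exI[of _ "\<lambda>x. \<theta>' (\<phi>' x)"]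
      reg_map_compose[OF 1(1) 2(1)] reg_map_compose[OF 2(2) 1(2)] a b)
qed

lemma pullback_ideal_compose:
  assumes "\<phi> \<in> diffeos C" "\<theta> \<in> diffeos C" "ideal I R"
  shows "pullback_ideal C (\<lambda>x. \<phi> (\<theta> x)) I = pullback_ideal C \<theta> (pullback_ideal C \<phi> I)"
proof -
  have r: "reg_map \<phi>" "reg_map \<theta>" using assms by (simp_all add: diffeos_iff)
  show ?thesis
    unfolding pullback_ideal_eq(1)[OF diffeos_compose[OF assms(1,2)] assms(3)] pullback_ideal_eq(1)[OF assms(1,3)]
      pullback_ideal_eq(1)[OF assms(2) pullback_ideal_eq(2)[OF assms(1,3)]]
    by (simp only: image_image germ_pullback_compose[OF r])
qed

text \<open>A scaling map multiplies the generators by units, so its pullback sends \<open>I\<close> into \<open>I\<close>. The same holds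
  for the inverse, which is again a scaling map, and this gives equality.\<close>

lemma scaling_map_stabilizes_ideal:
  assumes G: "G \<subseteq> carrier R" "I = genideal R G" and q: "\<And>g. g \<in> G \<Longrightarrow> \<exists>\<delta>. quasihomogeneous w \<delta> g"
    and s: "reg s"
  shows "scaling_map w s \<in> ideal_stabilizer C I"
proof -
  have I: "ideal I R" unfolding G(2) by (rule ring.genideal_ideal[OF ring_germ_ring G(1)])
  have GI: "G \<subseteq> I" unfolding G(2) by (rule ring.genideal_self[OF ring_germ_ring G(1)])
  have sub: "germ_pullback (scaling_map w t) ` I \<subseteq> I" if t: "reg t" for t
  proof -
    have rt: "reg_map (scaling_map w t)" by (rule reg_scaling_map[OF t])
    have "G \<subseteq> {a \<in> carrier R. germ_pullback (scaling_map w t) a \<in> I}"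
    proof
      fix a assume a: "a \<in> G"
      then obtain f where f: "a = germ f" "reg f" using G(1) carrierE by blast
      obtain \<delta> where d: "quasihomogeneous w \<delta> (germ f)" using q[OF a] f(1) by blast
      have u: "germ (\<lambda>x. exp (of_int \<delta> * t x)) \<in> carrier R"
        unfolding germ_in_carrier_iff by (intro reg_exp reg_cmult t)
      have "germ_pullback (scaling_map w t) a = germ (\<lambda>x. exp (of_int \<delta> * t x)) * germ f"
        unfolding f(1) germ_pullback_germ[OF rt] times_germ.abs_eq germ_eq_iff o_def
        by (rule quasihomogeneous_scaling_map[OF f(2) d t])
      also have "\<dots> \<in> I"
        using ideal.I_l_closed[OF I, of "germ f" "germ (\<lambda>x. exp (of_int \<delta> * t x))"] u a f(1) GI
        by (auto simp: germ_ring_simps)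
      finally show "a \<in> {a \<in> carrier R. germ_pullback (scaling_map w t) a \<in> I}" using a G(1) by blast
    qed
    then have "I \<subseteq> {a \<in> carrier R. germ_pullback (scaling_map w t) a \<in> I}"
      unfolding G(2) by (rule ring.genideal_minimal[OF ring_germ_ring ideal_preimage_germ_pullback[OF rt I[unfolded G(2)]]])
    then show ?thesis by blast
  qed
  obtain \<sigma> where \<sigma>: "reg \<sigma>" "\<forall>\<^sub>F y in nhds 0. scaling_map w s (scaling_map w \<sigma> y) = y"
    "\<forall>\<^sub>F x in nhds 0. scaling_map w \<sigma> (scaling_map w s x) = x"
    by (rule scaling_map_inverse[OF s])
  note r = reg_scaling_map[OF \<sigma>(1), of w] reg_scaling_map[OF s, of w]
  have "germ_pullback (scaling_map w s) (germ_pullback (scaling_map w \<sigma>) a) = a" for a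
    unfolding germ_pullback_compose[OF r] by (rule germ_pullback_id[OF reg_map_compose[OF r] \<sigma>(3)])
  then have "I \<subseteq> germ_pullback (scaling_map w s) ` I"
    using sub[OF \<sigma>(1)] by (metis image_subset_iff rev_image_eqI subsetI)
  then have "pullback_ideal C (scaling_map w s) I = I"
    using pullback_ideal_eq(1)[OF scaling_map_diffeo[OF s] I] sub[OF s] by blast
  then show ?thesis using scaling_map_diffeo[OF s] by (simp add: ideal_stabilizer_def)
qed

section \<open>Isotopies and volume preserving maps\<close>

lemma scaling_isotopy_smooth:
  assumes S: "reg S"
  obtains U where "open U" "{0..1} \<times> {0} \<subseteq> U" "Cinf_on U (\<lambda>(t::real, x). scaling_map w (\<lambda>x. of_real t * S x) x)"
proof -
  obtain V where V: "open V" "0 \<in> V" "Cinf_on V S" using reg_smooth[OF S] by (auto simp: smooth_at_0_def)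
  define U where "U = (UNIV :: real set) \<times> V"
  have U: "open U" unfolding U_def by (intro open_Times open_UNIV V)
  have "Ck_on k U (\<lambda>(t, x). scaling_map w (\<lambda>x. of_real t * S x) x)" for k
  proof (rule Ck_on_vec[OF U])
    fix i
    have 1: "Ck_on k U (\<lambda>p. S (snd p))"
      by (rule Ck_on_compose[OF U _ Ck_on_bounded_linear[OF U bounded_linear_snd] Cinf_on_Ck[OF V(3)]]) (auto simp: U_def)
    have 2: "Ck_on k U (\<lambda>p. of_real (fst p) :: 'k)"
      by (rule Ck_on_bounded_linear_compose[OF U bounded_linear_of_real Ck_on_bounded_linear[OF U bounded_linear_fst]])
    have 3: "Ck_on k U (\<lambda>p. snd p $ i)"
      by (rule Ck_on_bounded_linear_compose[OF U bounded_linear_vec_nth Ck_on_bounded_linear[OF U bounded_linear_snd]])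
    have 4: "Ck_on k U (\<lambda>p. of_nat (w i) * (of_real (fst p) * S (snd p)))"
      by (intro Ck_on_mult[OF U Ck_on_const[OF U]] Ck_on_mult[OF U 2 1])
    have 5: "Ck_on k U (\<lambda>p. exp (of_nat (w i) * (of_real (fst p) * S (snd p))))"
      by (rule Ck_on_compose[OF U _ 4 Ck_on_exp]) simp
    show "Ck_on k U (\<lambda>p. (case p of (t, x) \<Rightarrow> scaling_map w (\<lambda>x. of_real t * S x) x) $ i)"
      using Ck_on_mult[OF U 5 3] by (simp add: scaling_map_def case_prod_beta)
  qed
  then show ?thesis using that[OF U] V(2) by (auto simp: Cinf_on_def U_def)
qed

text \<open>Multiplying the flow time \<open>S\<close> of the equalizing map by \<open>t\<close> deforms it to the identity through
  maps that all preserve \<open>I\<close>.\<close>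

lemma volume_forms_joined_by_isotopy:
  fixes I :: "('k ^ 'n, 'k) germ set"
  assumes I: "wqh C I" and \<Omega>: "volume_form C \<Omega>0" "volume_form C \<Omega>1"
    and z: "volume_density \<Omega>0 0 = volume_density \<Omega>1 0 * exp z"
  shows "joined_by_isotopy C I \<Omega>0 \<Omega>1"
proof -
  obtain G w where G: "G \<subseteq> carrier R" "I = genideal R G" "total_weight w > 0"
    "\<And>g. g \<in> G \<Longrightarrow> \<exists>\<delta>. quasihomogeneous w \<delta> g"
    using I unfolding wqh_def by blast
  obtain S where S: "reg S" "\<forall>\<^sub>F x in nhds 0. pullback_form (scaling_map w S) \<Omega>1 x = \<Omega>0 x"
    by (rule scaling_map_equalizes_volume_forms[OF \<Omega> G(3) z])
  let ?\<phi> = "\<lambda>t::real. scaling_map w (\<lambda>x. of_real t * S x)"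
  obtain U where U: "open U" "{0..1} \<times> {0} \<subseteq> U" "Cinf_on U (\<lambda>(t, x). ?\<phi> t x)"
    by (rule scaling_isotopy_smooth[OF S(1)])
  show ?thesis unfolding joined_by_isotopy_def
  proof (intro exI[of _ ?\<phi>] conjI ballI)
    show "\<exists>U. open U \<and> {0..1} \<times> {0} \<subseteq> U \<and> Cinf_on U (\<lambda>(t, x). ?\<phi> t x)" using U by blast
    show "?\<phi> t \<in> ideal_stabilizer C I" for t
      by (rule scaling_map_stabilizes_ideal[OF G(1,2,4) reg_cmult[OF S(1)]])
    show "\<forall>\<^sub>F x in nhds 0. ?\<phi> 0 x = x" by (simp add: scaling_map_def)
    show "\<forall>\<^sub>F x in nhds 0. pullback_form (?\<phi> 1) \<Omega>1 x = \<Omega>0 x" using S(2) by simp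
  qed
qed

lemma jacobian_ident: "\<forall>\<^sub>F x in nhds 0. jacobian_matrix (\<lambda>x. x) x = (mat 1 :: 'k ^ 'n ^ 'n)"
proof -
  have "reg_map (\<lambda>x. x)" by (intro reg_mapI reg_coord) simp
  from reg_map_has_derivative[OF this] show ?thesis
  proof (rule eventually_mono)
    fix x :: "'k ^ 'n" assume "((\<lambda>x. x) has_derivative (\<lambda>v. jacobian_matrix (\<lambda>x. x) x *v v)) (at x)"
    from has_derivative_unique[OF this has_derivative_ident]
    show "jacobian_matrix (\<lambda>x. x) x = mat 1" by (simp add: matrix_eq fun_eq_iff)
  qed
qed

lemma det_jacobian_inverse:
  assumes "reg_map \<phi>" "reg_map \<psi>" "\<forall>\<^sub>F x in nhds 0. \<phi> (\<psi> x) = x"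
  shows "det (jacobian_matrix \<phi> 0) * det (jacobian_matrix \<psi> 0) = 1"
proof -
  have "jacobian_matrix \<phi> 0 ** jacobian_matrix \<psi> 0 = mat 1"
    using eventually_nhds_x_imp_x[OF jacobian_compose[OF assms(1,2)]] eventually_nhds_x_imp_x[OF jacobian_cong_germ[OF assms(3)]]
      eventually_nhds_x_imp_x[OF jacobian_ident] reg_mapD(2)[OF assms(2)] by simp
  then show ?thesis by (metis det_mul det_I)
qed

lemma diffeo_det_jacobian_nonzero:
  fixes \<phi> :: "'k ^ 'n \<Rightarrow> 'k ^ 'n"
  assumes "\<phi> \<in> diffeos C"
  shows "det (jacobian_matrix \<phi> 0) \<noteq> 0"
proof -
  obtain \<psi> where "reg_map \<phi>" "reg_map \<psi>" "\<forall>\<^sub>F x in nhds 0. \<phi> (\<psi> x) = x"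
    using assms unfolding diffeos_iff by blast
  from det_jacobian_inverse[OF this] show ?thesis by auto
qed

text \<open>If \<open>k\<close> pulls \<open>\<Omega>\<close> back to the pullback of \<open>\<Omega>\<close> under \<open>\<phi>\<inverse>\<close>, then \<open>k \<circ> \<phi>\<close> preserves \<open>\<Omega>\<close>; if \<open>k\<close> also
  stabilizes \<open>I\<close>, then \<open>k \<circ> \<phi>\<close> pulls \<open>I\<close> back to the same ideal as \<open>\<phi>\<close>.\<close>

lemma volume_preserving_representative:
  fixes I :: "('k ^ 'n, 'k) germ set"
  assumes I: "wqh C I" "ideal I R" and \<Omega>: "volume_form C \<Omega>"
    and \<phi>: "\<phi> \<in> diffeos C" and z: "det (jacobian_matrix \<phi> 0) = exp z"
  obtains h where "h \<in> volume_preserving C \<Omega>" "pullback_ideal C h I = pullback_ideal C \<phi> I"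
proof -
  obtain \<psi> where r: "reg_map \<phi>" "reg_map \<psi>" and inv: "\<forall>\<^sub>F x in nhds 0. \<psi> (\<phi> x) = x" "\<forall>\<^sub>F x in nhds 0. \<phi> (\<psi> x) = x"
    using \<phi> unfolding diffeos_iff by blast
  have "exp z * det (jacobian_matrix \<psi> 0) = 1"
    using det_jacobian_inverse[OF r inv(2)] z by simp
  then have dpsi: "det (jacobian_matrix \<psi> 0) = exp (- z)" by (simp add: exp_minus field_simps)
  define \<Omega>' where "\<Omega>' = pullback_form \<psi> \<Omega>"
  have \<Omega>': "volume_form C \<Omega>'" unfolding \<Omega>'_def by (rule volume_form_pullback[OF \<Omega> r(2)]) (simp add: dpsi)
  have d: "volume_density \<Omega>' 0 = volume_density \<Omega> 0 * exp (- z)"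
    unfolding \<Omega>'_def volume_density_pullback_form[OF \<Omega> r(2)] dpsi ..
  obtain G w where G: "G \<subseteq> carrier R" "I = genideal R G" "total_weight w > 0"
    "\<And>g. g \<in> G \<Longrightarrow> \<exists>\<delta>. quasihomogeneous w \<delta> g"
    using I(1) unfolding wqh_def by blast
  obtain S where S: "reg S" "\<forall>\<^sub>F x in nhds 0. pullback_form (scaling_map w S) \<Omega> x = \<Omega>' x"
    by (rule scaling_map_equalizes_volume_forms[OF \<Omega>' \<Omega> G(3) d])
  let ?k = "scaling_map w S"
  let ?h = "\<lambda>x. ?k (\<phi> x)"
  have k: "?k \<in> diffeos C" by (rule scaling_map_diffeo[OF S(1)])
  have rk: "reg_map ?k" by (rule reg_scaling_map[OF S(1)])
  have "\<forall>\<^sub>F x in nhds 0. pullback_form ?h \<Omega> x = \<Omega> x"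
    using pullback_form_compose[OF rk r(1), of \<Omega>] eventually_reg_map[OF r(1) S(2)]
      pullback_form_compose[OF r(2,1), of \<Omega>] inv(1) reg_map_frechet_derivative[OF reg_map_compose[OF r(2,1)]]
      jacobian_cong_germ[OF inv(1)] jacobian_ident
  proof eventually_elim
    case (elim x)
    have "pullback_form ?h \<Omega> x = pullback_form \<phi> \<Omega>' x"
      unfolding elim(1) by (simp add: pullback_form_def[of \<phi>] elim(2) fun_eq_iff)
    also have "\<dots> = pullback_form (\<lambda>x. \<psi> (\<phi> x)) \<Omega> x" by (simp only: elim(3) \<Omega>'_def)
    also have "\<dots> = \<Omega> x"
    proof -
      have "frechet_derivative (\<lambda>x. \<psi> (\<phi> x)) (at x) = (\<lambda>v. v)"
        unfolding elim(5,6,7) by (simp add: fun_eq_iff)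
      then show ?thesis by (simp add: pullback_form_def elim(4) fun_eq_iff)
    qed
    finally show ?case .
  qed
  then have "?h \<in> volume_preserving C \<Omega>"
    using diffeos_compose[OF k \<phi>] by (simp add: volume_preserving_def)
  moreover have "pullback_ideal C ?h I = pullback_ideal C \<phi> I"
    using pullback_ideal_compose[OF k \<phi> I(2)] scaling_map_stabilizes_ideal[OF G(1,2,4) S(1)]
    by (simp add: ideal_stabilizer_def)
  ultimately show ?thesis by (rule that)
qed

end

section \<open>The complex and the real case\<close>

interpretation complex_analytic: regular_calculus Analytic "analytic_at_0 :: (complex ^ 'n::finite \<Rightarrow> complex) \<Rightarrow> bool"
  by (rule analytic_regular_calculus[OF complex_log_series])

lemma real_regular_calculus: "regular_calculus C (regular C :: (real ^ 'n::finite \<Rightarrow> real) \<Rightarrow> bool)"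
proof -
  have "(regular Analytic :: (real ^ 'n \<Rightarrow> real) \<Rightarrow> bool) = analytic_at_0" "(regular Smooth :: (real ^ 'n \<Rightarrow> real) \<Rightarrow> bool) = smooth_at_0"
    by (simp_all add: fun_eq_iff)
  then show ?thesis
    using analytic_regular_calculus[OF real_log_series] smooth_regular_calculus by (cases C) (simp_all add: real_norm_def)
qed

interpretation real: regular_calculus C "regular C :: (real ^ 'n::finite \<Rightarrow> real) \<Rightarrow> bool" for C
  by (rule real_regular_calculus)

theorem theorem4p4:
  fixes IC :: "(complex ^ 'n::finite, complex) germ set"
    and IR :: "(real ^ 'n::finite, real) germ set"
    and C :: regularity
  shows
    "(ideal IC (germ_ring Analytic) \<and> wqh Analytic IC \<longrightarrow>
        (\<forall>\<Omega>0 \<Omega>1. volume_form Analytic \<Omega>0 \<and> volume_form Analytic \<Omega>1 \<longrightarrow>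
           joined_by_isotopy Analytic IC \<Omega>0 \<Omega>1) \<and>
        (\<forall>\<Omega> J. volume_form Analytic \<Omega> \<and> ideal J (germ_ring Analytic) \<and>
           (\<exists>\<phi>\<in>diffeos Analytic. pullback_ideal Analytic \<phi> IC = J) \<longrightarrow>
           (\<exists>h\<in>volume_preserving Analytic \<Omega>. pullback_ideal Analytic h IC = J)))
     \<and>
     (ideal IR (germ_ring C) \<and> wqh C IR \<and> (C = Smooth \<longrightarrow> finitely_generated C IR) \<longrightarrow>
        (\<forall>\<Omega>0 \<Omega>1. volume_form C \<Omega>0 \<and> volume_form C \<Omega>1 \<and> same_orientation \<Omega>0 \<Omega>1 \<longrightarrow>
           joined_by_isotopy C IR \<Omega>0 \<Omega>1) \<and>
        (\<forall>\<Omega> J. volume_form C \<Omega> \<and> ideal J (germ_ring C) \<and>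
           (\<exists>\<phi>\<in>oriented_diffeos C. pullback_ideal C \<phi> IR = J) \<longrightarrow>
           (\<exists>h\<in>volume_preserving C \<Omega>. pullback_ideal C h IR = J)))"
proof (intro conjI impI allI; elim conjE)
  fix \<Omega>0 \<Omega>1 :: "(complex, 'n) top_form"
  assume I: "wqh Analytic IC" and \<Omega>: "volume_form Analytic \<Omega>0" "volume_form Analytic \<Omega>1"
  have nz: "volume_density \<Omega>0 0 \<noteq> 0" "volume_density \<Omega>1 0 \<noteq> 0"
    using complex_analytic.volume_formD(2) \<Omega> by blast+
  show "joined_by_isotopy Analytic IC \<Omega>0 \<Omega>1"
    by (rule complex_analytic.volume_forms_joined_by_isotopy[OF I \<Omega>, of "Ln (volume_density \<Omega>0 0 / volume_density \<Omega>1 0)"])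
      (use nz in simp)
next
  fix \<Omega> :: "(complex, 'n) top_form" and J
  assume I: "wqh Analytic IC" "ideal IC (germ_ring Analytic)" and \<Omega>: "volume_form Analytic \<Omega>"
    and "\<exists>\<phi>\<in>diffeos Analytic. pullback_ideal Analytic \<phi> IC = J"
  then obtain \<phi> where \<phi>: "\<phi> \<in> diffeos Analytic" "pullback_ideal Analytic \<phi> IC = J" by blast
  have "det (jacobian_matrix \<phi> 0) = exp (Ln (det (jacobian_matrix \<phi> 0)))"
    using complex_analytic.diffeo_det_jacobian_nonzero[OF \<phi>(1)] by simp
  then obtain h where "h \<in> volume_preserving Analytic \<Omega>" "pullback_ideal Analytic h IC = pullback_ideal Analytic \<phi> IC"
    by (rule complex_analytic.volume_preserving_representative[OF I \<Omega> \<phi>(1)])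
  then show "\<exists>h\<in>volume_preserving Analytic \<Omega>. pullback_ideal Analytic h IC = J"
    unfolding \<phi>(2) by blast
next
  fix \<Omega>0 \<Omega>1 :: "(real, 'n) top_form"
  assume I: "wqh C IR" and \<Omega>: "volume_form C \<Omega>0" "volume_form C \<Omega>1" and o: "same_orientation \<Omega>0 \<Omega>1"
  have nz: "volume_density \<Omega>0 0 \<noteq> 0" "volume_density \<Omega>1 0 \<noteq> 0"
    using real.volume_formD(2) \<Omega> by blast+
  have "volume_density \<Omega>0 0 > 0 \<longleftrightarrow> volume_density \<Omega>1 0 > 0" using o by (simp add: same_orientation_def volume_density_def)
  with nz have "volume_density \<Omega>0 0 / volume_density \<Omega>1 0 > 0" by (auto simp: zero_less_divide_iff)
  then show "joined_by_isotopy C IR \<Omega>0 \<Omega>1"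
    by (intro real.volume_forms_joined_by_isotopy[OF I \<Omega>, of "ln (volume_density \<Omega>0 0 / volume_density \<Omega>1 0)"])
      (use nz in simp)
next
  fix \<Omega> :: "(real, 'n) top_form" and J
  assume I: "wqh C IR" "ideal IR (germ_ring C)" and \<Omega>: "volume_form C \<Omega>"
    and "\<exists>\<phi>\<in>oriented_diffeos C. pullback_ideal C \<phi> IR = J"
  then obtain \<phi> where \<phi>: "\<phi> \<in> diffeos C" "pullback_ideal C \<phi> IR = J"
    and pos: "det (matrix (frechet_derivative \<phi> (at 0))) > 0"
    by (auto simp: oriented_diffeos_def)
  have "real.reg_map C \<phi>" using \<phi>(1) real.diffeos_iff by blast
  from eventually_nhds_x_imp_x[OF real.reg_map_frechet_derivative[OF this]]
  have "matrix (frechet_derivative \<phi> (at 0)) = jacobian_matrix \<phi> 0" by simp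
  with pos have "det (jacobian_matrix \<phi> 0) = exp (ln (det (jacobian_matrix \<phi> 0)))" by simp
  then obtain h where "h \<in> volume_preserving C \<Omega>" "pullback_ideal C h IR = pullback_ideal C \<phi> IR"
    by (rule real.volume_preserving_representative[OF I \<Omega> \<phi>(1)])
  then show "\<exists>h\<in>volume_preserving C \<Omega>. pullback_ideal C h IR = J"
    unfolding \<phi>(2) by blast
qed

end
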